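(* Let $\mathsf L_1(\mathbf y|\vartheta)$ and $\mathsf L_2(\mathbf y|\vartheta)$ be the joint Laplace transforms (defined in the context) of an OU model driven by an FGGC subordinator with parameters $\theta>0$ and probability measure $H$. Specify $\omega_i=(y_i^2+\beta^2)/2$, $i=1,\dots,n$. Let $(T_i,M_i)\overset d=(T_{\theta a},M_{\theta aQ_a})$, $i=1,\ldots,n$, be iid pairs of independent random variables (so that $T_iM_i\overset d=T_{\theta a}M_{\theta aQ_a}$). Independently of this sequence, let $(G_i,M_{\omega_i})$ be independent pairs, where $G_i\overset d=T_{\theta a}$ and, independent of $G_i$, $M_{\omega_i}\overset d=M_{\theta aQ_{a|\omega_i}}$ for fixed $\omega_i$. Let $$\Xi_1=(v(0),(T_i,M_i),(G_i,M_{\omega_i}))$$ be the vector of $4n+1$ independent components, with joint density $f_{\Xi_1}(\cdot|\vartheta,\mathbf y)$, and let $\Xi_2=(v(0),(T_i,M_i))$ be the vector of $2n+1$ independent components, with density $f_{\Xi_2}(\cdot|\vartheta)$ not depending on $\mathbf y$. Then: (i) $\mathsf L_1(\mathbf y|\vartheta)=E[e^{-s_1v(0)}]\prod_{i=1}^nE[e^{-\omega_iT_iM_i}]\prod_{i=1}^nE[e^{-v_iG_iM_{\omega_i}}]$. (ii) $\mathsf L_2(\mathbf y|\vartheta)=E[e^{-s_1v(0)}]\prod_{i=1}^nE[e^{-\omega_iT_iM_i}]$. (iii) Suppose that $\int_{\mathbb R_+^n}\mathsf L_1(\mathbf y|\vartheta)\prod_{i=1}^ndy_i<\infty$. Then,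 by augmenting the expression in (i), there exists a joint density of $(\Xi_1,\mathbf Y)$ given by $$f_{\Xi_1}(\zeta_1,\mathbf y|\vartheta)\propto e^{-s_1v}\prod_{i=1}^ne^{-\omega_it_im_i}\prod_{i=1}^ne^{-v_iu_im_{\omega_i}}\,f_{\Xi_1}(\zeta_1|\vartheta,\mathbf y),$$ where $\zeta_1=(v,(t_i,m_i),(u_i,m_{\omega_i}))$ is the argument corresponding to $\Xi_1$. (iv) Suppose that $\int_{\mathbb R_+^n}\mathsf L_2(\mathbf y|\vartheta)\prod_{i=1}^ndy_i<\infty$. Then, by augmenting the expression in (ii), there exists a joint density of $(\Xi_2,\mathbf Y)$ given by $$f_{\Xi_2}(\zeta_2,\mathbf y|\vartheta)\propto e^{-s_1v}\prod_{i=1}^ne^{-\omega_it_im_i}\,f_{\Xi_2}(\zeta_2|\vartheta),\qquad\zeta_2=(v,(t_i,m_i)).$$ (v) Writing $v(0)=T_\theta\tilde M_\theta$, with $\tilde M_\theta$ independent of $T_\theta$, and integrating out all the Gamma random variables in (iii), there exists a joint density of $(\tilde M_\theta,(M_i),(M_{\omega_i}),\mathbf Y)$ proportional to $$f_{\tilde M_\theta}(t)(1+s_1t)^{-\theta}\prod_{i=1}^n(1+\omega_im_i)^{-\theta a}(1+v_ir_i)^{-\theta a}f_{M_i}(m_i)f_{M_{\omega_i}}(r_i),$$ where $t,m_i,r_i$ are the arguments corresponding to $\tilde M_\theta,M_i,M_{\omega_i}$, and $f_{\tilde M_\theta},f_{M_i},f_{M_{\omega_i}}$ are the respective densities.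
   Context: $T_c$ denotes a Gamma$(c,1)$ random variable, $d_c(\omega)=c\log(1+\omega)$. Let $\lambda,\Delta>0$, $a=\lambda\Delta$, $\beta\in\mathbb R$; $\vartheta$ denotes the parameters. The driving subordinator $Z$ is an FGGC: $E[e^{-\omega Z(t)}]=e^{-t\psi(\omega)}$ with $\psi(\omega)=\int_0^\infty d_\theta(\omega x)H(dx)$, $H$ a probability measure on $(0,\infty)$. The OU process is $v(t)=e^{-\lambda t}v(0)+e^{-\lambda t}\int_0^te^{\lambda y}Z(d\lambda y)$, where $\int_0^{t}g(y)Z(d\lambda y):=\int_0^{\lambda t}g(s/\lambda)Z(ds)$; $v(0)$ is independent of $Z$, with Lévy exponent $\varphi(s)=-\log E[e^{-sv(0)}]$, equal to $\int_0^1\psi(su)u^{-1}du$ in the stationary case. For $\mathbf y\in\mathbb R_+^n$ and $\omega_i=(y_i^2+\beta^2)/2$ set $s_l=(1-e^{-a})\sum_{i=l}^n\omega_ie^{-a(i-1)}$ for $l=1,\dots,n$, $s_{n+1}=0$ (empty sum), and $v_i=e^{ai}s_{i+1}$ (so $v_n=0$). With the scale factor $\lambda^{-1}$ absorbed in the $\omega_i$'s, put $$\Phi(\omega|v)=\int_{e^{-a}}^1\psi(vu+\omega(1-u))\frac{du}u,\qquad\Phi(\omega)=\int_{e^{-a}}^1\psi(\omega(1-u))\frac{du}u,$$ $$\mathsf L_1(\mathbf y|\vartheta)=e^{-\varphi(s_1)}e^{-\Phi(\omega_n)}\prod_{i=1}^{n-1}e^{-\Phi(\omega_i|v_i)},\qquad\mathsf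 L_2(\mathbf y|\vartheta)=e^{-\varphi(s_1)}\prod_{i=1}^ne^{-\Phi(\omega_i)}.$$ ($\mathsf L_1$ is the joint Laplace transform, at $(\omega_1,\dots,\omega_n)$, of $\lambda\int_{(i-1)\Delta}^{i\Delta}v(s)ds$, $i=1,\dots,n$.) $F_a$ is the distribution on $[e^{-a},1]$ with density $1/(au)$. With $U\sim F_a$ and $W\sim H$ independent, $Q_a$ is the law of $(1-U)W$ and $Q_{a|\omega}$ is the law of $UW/(1+W(1-U)\omega)$. For $c>0$ and a probability measure $Q$, $M_{cQ}=\int xP_{cQ}(dx)$ where $P_{cQ}$ is the Dirichlet process with shape measure $cQ$ (normalized Gamma random measure). *)

theory Defs
  imports "HOL-Probability.Probability"
begin

subsection \<open>Gamma random measures and means of Dirichlet processes\<close>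

definition gamma_density :: "real \<Rightarrow> real \<Rightarrow> real" where
  "gamma_density c x = (if 0 < x then x powr (c - 1) * exp (- x) / Gamma c else 0)"

text \<open>The law of \<open>T\<^sub>c\<close>, i.e. Gamma\<open>(c,1)\<close>; the degenerate case \<open>c = 0\<close>
  is needed for the values of a gamma random measure on null sets of its shape measure.\<close>

definition gamma_law :: "real \<Rightarrow> real measure" where
  "gamma_law c = (if c = 0 then return borel 0
                  else density lborel (\<lambda>x. ennreal (gamma_density c x)))"

text \<open>The space of finite Borel measures on the line, with the sigma-algebra generated by the
  evaluations; this is the analogue of \<^const>\<open>subprob_algebra\<close>. A random measure is
  represented by its law on this space.\<close>

definition finite_measures :: "real measure measure" where
  "finite_measures = (SUP A \<in> sets borel.
     vimage_algebra {m. finite_measure m \<and> sets m = sets borel} (\<lambda>m. emeasure m A) borel)"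

definition gamma_random_measure :: "real measure \<Rightarrow> real measure measure \<Rightarrow> bool" where
  "gamma_random_measure \<alpha> N \<longleftrightarrow>
     prob_space N \<and> sets N = sets finite_measures \<and>
     (\<forall>A \<in> sets borel. distr N borel (\<lambda>m. measure m A) = gamma_law (measure \<alpha> A)) \<and>
     (\<forall>(A :: nat \<Rightarrow> real set) k. A ` {..<k} \<subseteq> sets borel \<and> disjoint_family_on A {..<k} \<longrightarrow>
        prob_space.indep_vars N (\<lambda>_. borel) (\<lambda>i m. measure m (A i)) {..<k})"

definition normalized :: "real measure \<Rightarrow> real measure" where
  "normalized m = scale_measure (1 / emeasure m (space m)) m"

text \<open>\<open>D\<close> is the law of the Dirichlet process \<open>P\<^sub>\<alpha>\<close> with shape measure \<open>\<alpha>\<close>.\<close>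

definition dirichlet_process :: "real measure \<Rightarrow> real measure measure \<Rightarrow> bool" where
  "dirichlet_process \<alpha> D \<longleftrightarrow>
     (\<exists>N. gamma_random_measure \<alpha> N \<and> D = distr N finite_measures normalized)"

text \<open>\<open>\<nu>\<close> is the law of the mean functional \<open>M\<^bsub>cQ\<^esub> = \<integral> x P\<^bsub>cQ\<^esub>(dx)\<close>.\<close>

definition dirichlet_mean_law :: "real \<Rightarrow> real measure \<Rightarrow> real measure \<Rightarrow> bool" where
  "dirichlet_mean_law c Q \<nu> \<longleftrightarrow>
     (\<exists>D. dirichlet_process (scale_measure (ennreal c) Q) D \<and>
          \<nu> = distr D borel (\<lambda>P. \<integral>x. x \<partial>P))"

definition F_law :: "real \<Rightarrow> real measure" where
  "F_law a = density lborel (\<lambda>u. ennreal (indicator {exp (- a)..1} u / (a * u)))"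

definition Q_law :: "real \<Rightarrow> real measure \<Rightarrow> real measure" where
  "Q_law a H = distr (F_law a \<Otimes>\<^sub>M H) borel (\<lambda>(u, w). (1 - u) * w)"

definition Q_cond_law :: "real \<Rightarrow> real measure \<Rightarrow> real \<Rightarrow> real measure" where
  "Q_cond_law a H w =
     distr (F_law a \<Otimes>\<^sub>M H) borel (\<lambda>(u, x). u * x / (1 + x * (1 - u) * w))"

subsection \<open>The OU model driven by an FGGC subordinator\<close>

definition d_fun :: "real \<Rightarrow> real \<Rightarrow> real" where
  "d_fun c w = c * ln (1 + w)"

definition psi :: "real \<Rightarrow> real measure \<Rightarrow> real \<Rightarrow> real" where
  "psi \<theta> H w = (\<integral>x. d_fun \<theta> (w * x) \<partial>H)"

definition levy_exponent :: "'a measure \<Rightarrow> ('a \<Rightarrow> real) \<Rightarrow> real \<Rightarrow> real" where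
  "levy_exponent \<Omega> X s = - ln (\<integral>x. exp (- s * X x) \<partial>\<Omega>)"

definition subordinator :: "'a measure \<Rightarrow> (real \<Rightarrow> 'a \<Rightarrow> real) \<Rightarrow> bool" where
  "subordinator \<Omega> Z \<longleftrightarrow>
     prob_space \<Omega> \<and>
     (\<forall>t\<ge>0. Z t \<in> borel_measurable \<Omega>) \<and>
     (\<forall>x\<in>space \<Omega>. Z 0 x = 0 \<and> mono_on {0..} (\<lambda>t. Z t x) \<and>
        (\<forall>t\<ge>0. continuous (at_right t) (\<lambda>t. Z t x))) \<and>
     (\<forall>t\<ge>0. \<forall>h\<ge>0. distr \<Omega> borel (\<lambda>x. Z (t + h) x - Z t x) = distr \<Omega> borel (Z h)) \<and>
     (\<forall>(t :: nat \<Rightarrow> real) k. 0 \<le> t 0 \<and> mono t \<longrightarrow>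
        prob_space.indep_vars \<Omega> (\<lambda>_. borel) (\<lambda>i x. Z (t (Suc i)) x - Z (t i) x) {..<k})"

text \<open>The integrability condition says that the integral defining \<^const>\<open>psi\<close> is finite.\<close>

definition FGGC :: "'a measure \<Rightarrow> real \<Rightarrow> real measure \<Rightarrow> (real \<Rightarrow> 'a \<Rightarrow> real) \<Rightarrow> bool" where
  "FGGC \<Omega> \<theta> H Z \<longleftrightarrow>
     subordinator \<Omega> Z \<and>
     prob_space H \<and> sets H = sets borel \<and> (AE x in H. 0 < x) \<and>
     (\<forall>w\<ge>0. integrable H (\<lambda>x. d_fun \<theta> (w * x))) \<and>
     (\<forall>t\<ge>0. \<forall>w\<ge>0. (\<integral>x. exp (- w * Z t x) \<partial>\<Omega>) = exp (- t * psi \<theta> H w))"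

text \<open>The integral of \<open>exp (lam * y)\<close> over \<open>(0, t]\<close> against \<open>Z(d lam y)\<close> equals the pathwise
  Lebesgue--Stieltjes integral of \<open>exp s\<close> over \<open>(0, lam * t]\<close> against \<open>Z(ds)\<close>. Paths are extended
  by \<open>0\<close> to negative times, since \<^const>\<open>interval_measure\<close> needs a distribution function on the
  whole line. For \<open>t = 0\<close> the last equation is trivially true, so \<open>v 0\<close> is a free initial value.\<close>

definition ou_model ::
  "'a measure \<Rightarrow> real \<Rightarrow> real \<Rightarrow> real measure \<Rightarrow> (real \<Rightarrow> 'a \<Rightarrow> real) \<Rightarrow> (real \<Rightarrow> 'a \<Rightarrow> real) \<Rightarrow> bool" where
  "ou_model \<Omega> lam \<theta> H Z v \<longleftrightarrow>
     FGGC \<Omega> \<theta> H Z \<and>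
     v 0 \<in> borel_measurable \<Omega> \<and> (AE x in \<Omega>. 0 \<le> v 0 x) \<and>
     prob_space.indep_set \<Omega> (sets (vimage_algebra (space \<Omega>) (v 0) borel))
       (sets (vimage_algebra (space \<Omega>) (\<lambda>x. \<lambda>t\<in>{0..}. Z t x) (Pi\<^sub>M {0..} (\<lambda>_. borel)))) \<and>
     (\<forall>t\<ge>0. \<forall>x\<in>space \<Omega>.
        v t x = exp (- lam * t) * v 0 x
          + exp (- lam * t) * (LINT s:{0<..lam * t}|interval_measure (\<lambda>s. Z (max 0 s) x). exp s))"

subsection \<open>The likelihoods\<close>

text \<open>Vectors indexed by \<open>1, \<dots>, n\<close> are functions on \<^typ>\<open>nat\<close>.\<close>

definition om :: "real \<Rightarrow> (nat \<Rightarrow> real) \<Rightarrow> nat \<Rightarrow> real" where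
  "om \<beta> y i = ((y i)\<^sup>2 + \<beta>\<^sup>2) / 2"

definition s_coef :: "real \<Rightarrow> real \<Rightarrow> nat \<Rightarrow> (nat \<Rightarrow> real) \<Rightarrow> nat \<Rightarrow> real" where
  "s_coef a \<beta> n y l =
     (1 - exp (- a)) * (\<Sum>i=l..n. om \<beta> y i * exp (- a * (real i - 1)))"

definition v_coef :: "real \<Rightarrow> real \<Rightarrow> nat \<Rightarrow> (nat \<Rightarrow> real) \<Rightarrow> nat \<Rightarrow> real" where
  "v_coef a \<beta> n y i = exp (a * real i) * s_coef a \<beta> n y (i + 1)"

definition Phi_cond :: "real \<Rightarrow> real \<Rightarrow> real measure \<Rightarrow> real \<Rightarrow> real \<Rightarrow> real" where
  "Phi_cond a \<theta> H w v =
     (LINT u:{exp (- a)..1}|lborel. psi \<theta> H (v * u + w * (1 - u)) / u)"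

definition Phi :: "real \<Rightarrow> real \<Rightarrow> real measure \<Rightarrow> real \<Rightarrow> real" where
  "Phi a \<theta> H w = (LINT u:{exp (- a)..1}|lborel. psi \<theta> H (w * (1 - u)) / u)"

definition L1 ::
  "(real \<Rightarrow> real) \<Rightarrow> real \<Rightarrow> real \<Rightarrow> real measure \<Rightarrow> real \<Rightarrow> nat \<Rightarrow> (nat \<Rightarrow> real) \<Rightarrow> real" where
  "L1 \<phi> a \<theta> H \<beta> n y =
     exp (- \<phi> (s_coef a \<beta> n y 1)) * exp (- Phi a \<theta> H (om \<beta> y n)) *
     (\<Prod>i=1..n-1. exp (- Phi_cond a \<theta> H (om \<beta> y i) (v_coef a \<beta> n y i)))"

definition L2 ::
  "(real \<Rightarrow> real) \<Rightarrow> real \<Rightarrow> real \<Rightarrow> real measure \<Rightarrow> real \<Rightarrow> nat \<Rightarrow> (nat \<Rightarrow> real) \<Rightarrow> real" where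
  "L2 \<phi> a \<theta> H \<beta> n y =
     exp (- \<phi> (s_coef a \<beta> n y 1)) * (\<Prod>i=1..n. exp (- Phi a \<theta> H (om \<beta> y i)))"

subsection \<open>Random vectors and densities\<close>

text \<open>Names of the coordinates: \<open>V\<close> for \<open>v(0)\<close>, \<open>TC i\<close>, \<open>MC i\<close> for \<open>(T\<^sub>i, M\<^sub>i)\<close>, \<open>GC i\<close>, \<open>RC i\<close> for
  \<open>(G\<^sub>i, M\<^bsub>\<omega>\<^sub>i\<^esub>)\<close>, and \<open>TV\<close>, \<open>MV\<close> for the two factors of \<open>v(0) = T\<^sub>\<theta> M\<^sub>\<theta>\<close>. A vector is
  a function of the coordinate name.\<close>

datatype coord = V | TV | MV | TC nat | MC nat | GC nat | RC nat

definition idx_Xi1 :: "nat \<Rightarrow> coord set" where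
  "idx_Xi1 n = {V} \<union> TC ` {1..n} \<union> MC ` {1..n} \<union> GC ` {1..n} \<union> RC ` {1..n}"

definition idx_Xi2 :: "nat \<Rightarrow> coord set" where
  "idx_Xi2 n = {V} \<union> TC ` {1..n} \<union> MC ` {1..n}"

definition idx_split :: "nat \<Rightarrow> coord set" where
  "idx_split n = {TV, MV} \<union> TC ` {1..n} \<union> MC ` {1..n} \<union> GC ` {1..n} \<union> RC ` {1..n}"

definition idx_means :: "nat \<Rightarrow> coord set" where
  "idx_means n = {MV} \<union> MC ` {1..n} \<union> RC ` {1..n}"

text \<open>The components of \<open>\<Xi>\<^sub>1\<close>; \<open>R i w\<close> is the variable \<open>M\<^bsub>\<omega>\<^sub>i\<^esub>\<close> at \<open>\<omega>\<^sub>i = w\<close>. The values at \<open>TV\<close>,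
  \<open>MV\<close> are irrelevant, because these names are not in \<open>idx_Xi1\<close>.\<close>

fun Xi :: "('a \<Rightarrow> real) \<Rightarrow> (nat \<Rightarrow> 'a \<Rightarrow> real) \<Rightarrow> (nat \<Rightarrow> 'a \<Rightarrow> real) \<Rightarrow> (nat \<Rightarrow> 'a \<Rightarrow> real) \<Rightarrow>
    (nat \<Rightarrow> real \<Rightarrow> 'a \<Rightarrow> real) \<Rightarrow> (nat \<Rightarrow> real) \<Rightarrow> coord \<Rightarrow> 'a \<Rightarrow> real" where
  "Xi v0 T M G R w V = v0"
| "Xi v0 T M G R w (TC i) = T i"
| "Xi v0 T M G R w (MC i) = M i"
| "Xi v0 T M G R w (GC i) = G i"
| "Xi v0 T M G R w (RC i) = R i (w i)"
| "Xi v0 T M G R w TV = (\<lambda>_. 0)"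
| "Xi v0 T M G R w MV = (\<lambda>_. 0)"

definition leb_coord :: "coord set \<Rightarrow> (coord \<Rightarrow> real) measure" where
  "leb_coord I = Pi\<^sub>M I (\<lambda>_. lborel)"

text \<open>Lebesgue measure on \<open>\<real>\<^sub>+\<^sup>n\<close>.\<close>

definition leb_pos :: "nat \<Rightarrow> (nat \<Rightarrow> real) measure" where
  "leb_pos n = Pi\<^sub>M {1..n} (\<lambda>_. restrict_space lborel {0..})"

definition has_density :: "'a measure \<Rightarrow> 'b measure \<Rightarrow> ('a \<Rightarrow> 'b) \<Rightarrow> ('b \<Rightarrow> real) \<Rightarrow> bool" where
  "has_density \<Omega> \<mu> X f \<longleftrightarrow>
     (\<forall>x\<in>space \<mu>. 0 \<le> f x) \<and> distributed \<Omega> \<mu> X (\<lambda>x. ennreal (f x))"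

definition probability_density :: "'b measure \<Rightarrow> ('b \<Rightarrow> real) \<Rightarrow> bool" where
  "probability_density \<mu> f \<longleftrightarrow>
     f \<in> borel_measurable \<mu> \<and> (\<forall>x\<in>space \<mu>. 0 \<le> f x) \<and> (\<integral>\<^sup>+x. ennreal (f x) \<partial>\<mu>) = 1"

text \<open>\<open>f y\<close> is the density of \<open>\<Xi>\<^sub>1\<close> for given \<open>y\<close>, jointly measurable in both arguments.\<close>

definition Xi1_density ::
  "'a measure \<Rightarrow> real \<Rightarrow> nat \<Rightarrow> ('a \<Rightarrow> real) \<Rightarrow> (nat \<Rightarrow> 'a \<Rightarrow> real) \<Rightarrow> (nat \<Rightarrow> 'a \<Rightarrow> real) \<Rightarrow>
    (nat \<Rightarrow> 'a \<Rightarrow> real) \<Rightarrow> (nat \<Rightarrow> real \<Rightarrow> 'a \<Rightarrow> real) \<Rightarrow>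
    ((nat \<Rightarrow> real) \<Rightarrow> (coord \<Rightarrow> real) \<Rightarrow> real) \<Rightarrow> bool" where
  "Xi1_density \<Omega> \<beta> n v0 T M G R f \<longleftrightarrow>
     (\<lambda>(z, y). f y z) \<in> borel_measurable (leb_coord (idx_Xi1 n) \<Otimes>\<^sub>M leb_pos n) \<and>
     (\<forall>y\<in>space (leb_pos n).
        has_density \<Omega> (leb_coord (idx_Xi1 n))
          (\<lambda>x. \<lambda>c\<in>idx_Xi1 n. Xi v0 T M G R (om \<beta> y) c x) (f y))"

definition Xi2_density ::
  "'a measure \<Rightarrow> nat \<Rightarrow> ('a \<Rightarrow> real) \<Rightarrow> (nat \<Rightarrow> 'a \<Rightarrow> real) \<Rightarrow> (nat \<Rightarrow> 'a \<Rightarrow> real) \<Rightarrow>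
    ((coord \<Rightarrow> real) \<Rightarrow> real) \<Rightarrow> bool" where
  "Xi2_density \<Omega> n v0 T M f \<longleftrightarrow>
     has_density \<Omega> (leb_coord (idx_Xi2 n))
       (\<lambda>x. \<lambda>c\<in>idx_Xi2 n. Xi v0 T M (\<lambda>_ _. 0) (\<lambda>_ _ _. 0) (\<lambda>_. 0) c x) f"

text \<open>The exponential factors multiplying the densities of \<open>\<Xi>\<^sub>1\<close> and \<open>\<Xi>\<^sub>2\<close>.\<close>

definition kernel2 :: "real \<Rightarrow> real \<Rightarrow> nat \<Rightarrow> (coord \<Rightarrow> real) \<Rightarrow> (nat \<Rightarrow> real) \<Rightarrow> real" where
  "kernel2 a \<beta> n z y =
     exp (- s_coef a \<beta> n y 1 * z V) * (\<Prod>i=1..n. exp (- om \<beta> y i * z (TC i) * z (MC i)))"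

definition kernel1 :: "real \<Rightarrow> real \<Rightarrow> nat \<Rightarrow> (coord \<Rightarrow> real) \<Rightarrow> (nat \<Rightarrow> real) \<Rightarrow> real" where
  "kernel1 a \<beta> n z y =
     exp (- s_coef a \<beta> n y 1 * z V) * (\<Prod>i=1..n. exp (- om \<beta> y i * z (TC i) * z (MC i))) *
     (\<Prod>i=1..n. exp (- v_coef a \<beta> n y i * z (GC i) * z (RC i)))"

text \<open>Passage from \<open>(T\<^sub>\<theta>, M\<^sub>\<theta>, \<dots>)\<close> to \<open>(v(0), \<dots>)\<close> with \<open>v(0) = T\<^sub>\<theta> M\<^sub>\<theta>\<close>.\<close>

definition collapse :: "nat \<Rightarrow> (coord \<Rightarrow> real) \<Rightarrow> coord \<Rightarrow> real" where
  "collapse n z = (\<lambda>c\<in>idx_Xi1 n. if c = V then z TV * z MV else z c)"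

text \<open>The product density of \<open>(T\<^sub>\<theta>, M\<^sub>\<theta>, (T\<^sub>i, M\<^sub>i), (G\<^sub>i, M\<^bsub>\<omega>\<^sub>i\<^esub>))\<close> for given \<open>y\<close>.\<close>

definition split_density ::
  "real \<Rightarrow> real \<Rightarrow> real \<Rightarrow> nat \<Rightarrow> (real \<Rightarrow> real) \<Rightarrow> (nat \<Rightarrow> real \<Rightarrow> real) \<Rightarrow>
    (nat \<Rightarrow> real \<Rightarrow> real \<Rightarrow> real) \<Rightarrow> (nat \<Rightarrow> real) \<Rightarrow> (coord \<Rightarrow> real) \<Rightarrow> real" where
  "split_density a \<theta> \<beta> n fMV fM fR y z =
     gamma_density \<theta> (z TV) * fMV (z MV) *
     (\<Prod>i=1..n. gamma_density (\<theta> * a) (z (TC i)) * fM i (z (MC i))) *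
     (\<Prod>i=1..n. gamma_density (\<theta> * a) (z (GC i)) * fR i (om \<beta> y i) (z (RC i)))"

definition means_density ::
  "real \<Rightarrow> real \<Rightarrow> real \<Rightarrow> nat \<Rightarrow> (real \<Rightarrow> real) \<Rightarrow> (nat \<Rightarrow> real \<Rightarrow> real) \<Rightarrow>
    (nat \<Rightarrow> real \<Rightarrow> real \<Rightarrow> real) \<Rightarrow> (nat \<Rightarrow> real) \<Rightarrow> (coord \<Rightarrow> real) \<Rightarrow> real" where
  "means_density a \<theta> \<beta> n fMV fM fR y z =
     fMV (z MV) * (1 + s_coef a \<beta> n y 1 * z MV) powr (- \<theta>) *
     (\<Prod>i=1..n. (1 + om \<beta> y i * z (MC i)) powr (- (\<theta> * a)) *
                (1 + v_coef a \<beta> n y i * z (RC i)) powr (- (\<theta> * a)) *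
                fM i (z (MC i)) * fR i (om \<beta> y i) (z (RC i)))"

end

theory Submission
  imports Defs
begin

text \<open>
  Let \<open>T\<close> be a Gamma\<open>(c,1)\<close> variable and \<open>M\<close> an independent mean of the Dirichlet process with shape
  \<open>c Q\<close>, where \<open>Q\<close> lives on the nonnegative numbers. Everything rests, for \<open>w \<ge> 0\<close>, on
  \<open>E e\<^sup>-\<^sup>w\<^sup>T\<^sup>M = E (1 + w M)\<^sup>-\<^sup>c = exp (- c \<integral> ln (1 + w x) Q(dx))\<close>.
  The first equality integrates \<open>T\<close> out. The second one is the Markov--Krein identity for Dirichlet
  means. By definition \<open>M\<close> is the ratio \<open>\<integral> x m(dx) / m(\<real>)\<close> for a Gamma random measure \<open>m\<close>; with a
  simple function in place of \<open>x\<close> this is a ratio of two linear forms in independent Gamma variables,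
  and such a ratio does not change when the variables are rescaled, whereas rescaling tilts their law
  exponentially. Averaging over all scales proves the identity for simple functions
  (\<open>gamma_vector_ratio\<close>). Increasing simple functions lead to \<open>x\<close> itself; the integral
  \<open>\<integral> x m(dx)\<close> is finite almost surely because the logarithmic integrals are finite and tend to \<open>0\<close> with
  \<open>w\<close> (\<open>dirichlet_mean_transform\<close>).

  The exponents of the two likelihoods have exactly this form: \<open>\<Phi>(\<omega>) = \<theta> a \<integral> ln (1 + \<omega> x) Q\<^sub>a(dx)\<close>, and
  the factorization
  \<open>1 + (v u + \<omega> (1 - u)) x = (1 + \<omega> (1 - u) x) (1 + v u x / (1 + x (1 - u) \<omega>))\<close>
  shows that \<open>\<Phi>(\<omega>|v) - \<Phi>(\<omega>)\<close> is the integral of \<open>\<theta> a ln (1 + v r)\<close> against the law \<open>Q\<close> conditional on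
  \<open>\<omega>\<close> (\<open>Phi_eq\<close>, \<open>Phi_cond_eq\<close>). Hence (i) and (ii); for \<open>i = n\<close> the coefficient \<open>v\<^sub>n\<close> vanishes, so the
  product over \<open>G\<^sub>i\<close> may run up to \<open>n\<close> although the likelihood has no conditional factor there.

  By independence, the expectation of the exponential kernel under the law of \<open>\<Xi>\<close> factorizes into the
  transforms above, so that for each \<open>y\<close> the kernel times the density of \<open>\<Xi>\<close> integrates to the
  likelihood at \<open>y\<close> (\<open>nn_integral_laplace_kernel\<close>). The likelihood is positive and has a finite
  integral over \<open>y\<close>, and dividing by this integral gives the joint densities (iii) and (iv)
  (\<open>probability_density_augmented\<close>). For (v), the product law of \<open>(T\<^sub>\<theta>, M\<^sub>\<theta>)\<close> and the other components is
  mapped to the law of \<open>\<Xi>\<^sub>1\<close> by multiplying the first two coordinates (\<open>law_collapse\<close>), hence the same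
  normalizing constant works. Integrating out a Gamma coordinate \<open>t\<close> with parameter \<open>c\<close> turns
  \<open>e\<^sup>-\<^sup>b\<^sup>t\<^sup>m\<close> into \<open>(1 + b m)\<^sup>-\<^sup>c\<close>; this holds where the mean \<open>m\<close> is nonnegative, that is, almost surely
  (\<open>nn_integral_gamma_mixture\<close>).
\<close>

section \<open>The Gamma law\<close>

lemma nn_integral_gamma_kernel:
  fixes c B :: real
  assumes c: "0 < c" and B: "0 < B"
  shows "(\<integral>\<^sup>+t. ennreal (indicator {0<..} t * (t powr (c - 1) * exp (- B * t))) \<partial>lborel)
    = ennreal (Gamma c * B powr (- c))"
proof -
  have *: "((\<lambda>t. indicator {0<..} t * (t powr (c - 1) * exp (- t))) has_integral Gamma c) UNIV"
  proof -
    have "((\<lambda>t. t powr (c - 1) / exp t) has_integral Gamma c) {0..}"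
      by (rule Gamma_integral_real[OF c])
    then have "((\<lambda>t. if t \<in> {0..} then t powr (c - 1) / exp t else 0) has_integral Gamma c) UNIV"
      by (rule iffD2[OF has_integral_restrict_UNIV])
    then show ?thesis
      by (rule has_integral_spike[of "{0}", rotated 2]) (auto simp: exp_minus field_simps)
  qed
  have 1: "(\<integral>\<^sup>+t. ennreal (indicator {0<..} t * (t powr (c - 1) * exp (- t))) \<partial>lborel) = ennreal (Gamma c)"
    by (rule nn_integral_has_integral_lborel[OF _ _ *]) auto
  have "(\<integral>\<^sup>+t. ennreal (indicator {0<..} t * (t powr (c - 1) * exp (- t))) \<partial>lborel)
      = ennreal B * (\<integral>\<^sup>+t. ennreal (indicator {0<..} (B * t) * ((B * t) powr (c - 1) * exp (- (B * t)))) \<partial>lborel)"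
    using B by (subst nn_integral_real_affine[where c=B and t=0]) auto
  also have "\<dots> = (\<integral>\<^sup>+t. ennreal (B powr c) * ennreal (indicator {0<..} t * (t powr (c - 1) * exp (- B * t))) \<partial>lborel)"
    using B by (subst nn_integral_cmult[symmetric])
      (auto intro!: nn_integral_cong simp: ennreal_mult[symmetric] indicator_def powr_mult powr_diff zero_less_mult_iff split: if_splits)
  also have "\<dots> = ennreal (B powr c) * (\<integral>\<^sup>+t. ennreal (indicator {0<..} t * (t powr (c - 1) * exp (- B * t))) \<partial>lborel)"
    by (rule nn_integral_cmult) simp
  finally have 2: "ennreal (Gamma c) = ennreal (B powr c) * (\<integral>\<^sup>+t. ennreal (indicator {0<..} t * (t powr (c - 1) * exp (- B * t))) \<partial>lborel)"
    using 1 by simp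
  have "ennreal (B powr (- c)) * ennreal (Gamma c)
     = (ennreal (B powr (- c)) * ennreal (B powr c)) * (\<integral>\<^sup>+t. ennreal (indicator {0<..} t * (t powr (c - 1) * exp (- B * t))) \<partial>lborel)"
    by (subst 2) (simp only: mult.assoc)
  also have "ennreal (B powr (- c)) * ennreal (B powr c) = 1"
    using B by (simp add: ennreal_mult[symmetric] powr_minus)
  finally show ?thesis
    using c by (simp add: ennreal_mult[symmetric] mult.commute Gamma_real_pos)
qed

text \<open>The substitution \<open>t \<mapsto> 1 / t\<close> reduces this integral to the Gamma integral.\<close>

lemma nn_integral_inverse_gamma_kernel:
  fixes c B :: real
  assumes c: "0 < c" and B: "0 < B"
  shows "(\<integral>\<^sup>+t. ennreal (indicator {0<..} t * (t powr (- c - 1) * exp (- B / t))) \<partial>lborel)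
    = ennreal (Gamma c * B powr (- c))"
proof -
  let ?f = "\<lambda>t. t powr (c - 1) * exp (- B * t)"
  let ?S = "{0<..} :: real set"
  let ?I = "Gamma c * B powr (- c)"
  have I: "0 \<le> ?I" using c by (simp add: less_imp_le Gamma_real_pos)
  have img: "inverse ` ?S = ?S"
    by (auto simp: image_iff intro!: bexI[of _ "inverse _"])
  have hb: "has_bochner_integral lborel (\<lambda>t. indicator ?S t * ?f t) ?I"
    by (rule has_bochner_integral_nn_integral)
       (use nn_integral_gamma_kernel[OF c B] I in \<open>auto simp: \<close>)
  have "?f absolutely_integrable_on ?S"
    using hb by (auto simp: set_integrable_def has_bochner_integral_iff integrable_completion)
  moreover have "integral ?S ?f = ?I"
  proof -
    have "((\<lambda>t. indicator ?S t * ?f t) has_integral ?I) UNIV"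
      using hb has_integral_integral_lborel[of "\<lambda>t. indicator ?S t * ?f t"]
      by (auto simp: has_bochner_integral_iff)
    then have "((\<lambda>t. if t \<in> ?S then ?f t else 0) has_integral ?I) UNIV"
      by (rule has_integral_eq[rotated]) auto
    then have "(?f has_integral ?I) ?S"
      by (rule iffD1[OF has_integral_restrict_UNIV])
    then show ?thesis by (rule integral_unique)
  qed
  ultimately have A: "(\<lambda>x. \<bar>- (inverse x ^ 2)\<bar> * ?f (inverse x)) absolutely_integrable_on ?S \<and>
     integral ?S (\<lambda>x. \<bar>- (inverse x ^ 2)\<bar> * ?f (inverse x)) = ?I"
  proof (subst has_absolute_integral_change_of_variables_1'[where g=inverse])
    show "(inverse has_real_derivative - (inverse x ^ 2)) (at x within ?S)" if "x \<in> ?S" for x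
      using that by (auto intro!: derivative_eq_intros simp: power2_eq_square)
  qed (simp_all add: img inj_on_def)
  have eq: "\<bar>- (inverse x ^ 2)\<bar> * ?f (inverse x) = x powr (- c - 1) * exp (- B / x)" if "x \<in> ?S" for x
  proof -
    have "inverse x ^ 2 = x powr (-2)" using that by (simp add: powr_minus powr_numeral power_inverse)
    moreover have "inverse x powr (c - 1) = x powr (1 - c)"
      using that powr_minus[of x "c - 1"] by (simp add: inverse_powr)
    moreover have "x powr (- 1 - c) = x powr (- c - 1)"
      by (rule arg_cong[where f="(powr) x"]) simp
    ultimately show ?thesis using that
      by (simp add: powr_add[symmetric] divide_inverse flip: mult.assoc)
  qed
  have "((\<lambda>x. \<bar>- (inverse x ^ 2)\<bar> * ?f (inverse x)) has_integral ?I) ?S"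
    using A[THEN conjunct2] integrable_integral[OF set_lebesgue_integral_eq_integral(1)[OF A[THEN conjunct1]]]
    by (simp only:)
  then have hi: "((\<lambda>x. x powr (- c - 1) * exp (- B / x)) has_integral ?I) ?S"
    by (rule has_integral_eq[rotated]) (rule eq)
  then have "((\<lambda>t. indicator ?S t * (t powr (- c - 1) * exp (- B / t))) has_integral ?I) UNIV"
    by (subst (asm) has_integral_restrict_UNIV[symmetric]) (auto elim!: has_integral_eq[rotated])
  from nn_integral_has_integral_lborel[OF _ _ this] show ?thesis by auto
qed

lemma sets_gamma_law [simp, measurable_cong]: "sets (gamma_law c) = sets borel"
  by (simp add: gamma_law_def)

lemma space_gamma_law [simp]: "space (gamma_law c) = UNIV"
  by (simp add: gamma_law_def)

lemma gamma_density_nonneg: "0 < c \<Longrightarrow> 0 \<le> gamma_density c x"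
  by (simp add: gamma_density_def less_imp_le Gamma_real_pos)

lemma measurable_gamma_density [measurable]: "gamma_density c \<in> borel_measurable borel"
  unfolding gamma_density_def by measurable

lemma nn_integral_gamma_law:
  assumes "0 < c" and [measurable]: "h \<in> borel_measurable borel"
  shows "(\<integral>\<^sup>+x. h x \<partial>gamma_law c) = (\<integral>\<^sup>+x. ennreal (gamma_density c x) * h x \<partial>lborel)"
  using assms by (simp add: gamma_law_def nn_integral_density)

lemma gamma_law_laplace:
  assumes c: "0 \<le> c" and b: "0 \<le> b"
  shows "(\<integral>\<^sup>+x. ennreal (exp (- b * x)) \<partial>gamma_law c) = ennreal ((1 + b) powr (- c))"
proof (cases "c = 0")
  case True
  then show ?thesis using b by (simp add: gamma_law_def nn_integral_return)
next
  case False
  with c have c: "0 < c" by simp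
  have G: "0 < Gamma c" using c by (rule Gamma_real_pos)
  have "(\<integral>\<^sup>+x. ennreal (exp (- b * x)) \<partial>gamma_law c) =
     (\<integral>\<^sup>+x. ennreal (1 / Gamma c) * ennreal (indicator {0<..} x * (x powr (c - 1) * exp (- (1 + b) * x))) \<partial>lborel)"
    using c G by (subst nn_integral_gamma_law)
      (auto intro!: nn_integral_cong simp: ennreal_mult[symmetric] gamma_density_def indicator_def exp_add[symmetric] algebra_simps)
  also have "\<dots> = ennreal (1 / Gamma c) * ennreal (Gamma c * (1 + b) powr (- c))"
    using c b by (subst nn_integral_cmult, simp, subst nn_integral_gamma_kernel) auto
  also have "\<dots> = ennreal ((1 + b) powr (- c))"
    using G by (simp add: ennreal_mult[symmetric])
  finally show ?thesis .
qed

lemma prob_space_gamma_law [simp]: "0 \<le> c \<Longrightarrow> prob_space (gamma_law c)"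
  using gamma_law_laplace[of c 0] by (intro prob_spaceI) simp

lemma AE_gamma_law_pos: "0 < c \<Longrightarrow> AE x in gamma_law c. 0 < x"
  unfolding gamma_law_def
  by (auto simp: AE_density gamma_density_def intro!: AE_I2 split: if_splits)

lemma AE_gamma_law_nonneg: "0 \<le> c \<Longrightarrow> AE x in gamma_law c. 0 \<le> x"
proof (cases "c = 0")
  case True
  then have "gamma_law c = return borel 0" by (simp add: gamma_law_def)
  then show ?thesis by (simp only:) (subst AE_return; simp)
next
  case False
  assume "0 \<le> c"
  with False have "AE x in gamma_law c. 0 < x" by (intro AE_gamma_law_pos) simp
  then show ?thesis by eventually_elim simp
qed

text \<open>Rescaling a Gamma variable amounts to an exponential tilting of its law, since
  \<open>x\<^sup>c\<^sup>-\<^sup>1 dx\<close> is homogeneous of degree \<open>c\<close>. The case \<open>c = 0\<close> is included because a Gamma random measure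
  vanishes on the null sets of its shape measure.\<close>

lemma gamma_law_tilt:
  assumes c: "0 \<le> c" and t: "0 < t"
  shows "distr (gamma_law c) borel (\<lambda>x. x / t)
    = density (gamma_law c) (\<lambda>x. ennreal (t powr c * exp (- (t - 1) * x)))"
proof (rule measure_eqI)
  fix A :: "real set" assume "A \<in> sets (distr (gamma_law c) borel (\<lambda>x. x / t))"
  then have A [measurable]: "A \<in> sets borel" by simp
  show "emeasure (distr (gamma_law c) borel (\<lambda>x. x / t)) A =
      emeasure (density (gamma_law c) (\<lambda>x. ennreal (t powr c * exp (- (t - 1) * x)))) A"
  proof (cases "c = 0")
    case True
    have "emeasure (distr (gamma_law c) borel (\<lambda>x. x / t)) A = (\<integral>\<^sup>+x. indicator A (x / t) \<partial>gamma_law c)"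
      by (subst nn_integral_indicator[symmetric], simp, subst nn_integral_distr) auto
    also have "\<dots> = indicator A 0"
      using True by (simp add: gamma_law_def nn_integral_return)
    finally show ?thesis using True t
      by (subst emeasure_density) (auto simp: gamma_law_def nn_integral_return)
  next
    case False
    with c have c: "0 < c" by simp
    have G: "0 < Gamma c" using c by (rule Gamma_real_pos)
    have "emeasure (distr (gamma_law c) borel (\<lambda>x. x / t)) A = (\<integral>\<^sup>+x. indicator A (x / t) \<partial>gamma_law c)"
      by (subst nn_integral_indicator[symmetric], simp, subst nn_integral_distr) auto
    also have "\<dots> = (\<integral>\<^sup>+x. ennreal (gamma_density c x) * indicator A (x / t) \<partial>lborel)"
      using c by (intro nn_integral_gamma_law) auto
    also have "\<dots> = ennreal t * (\<integral>\<^sup>+x. ennreal (gamma_density c (t * x)) * indicator A x \<partial>lborel)"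
      using t by (subst nn_integral_real_affine[where c=t and t=0]) auto
    also have "\<dots> = (\<integral>\<^sup>+x. ennreal t * (ennreal (gamma_density c (t * x)) * indicator A x) \<partial>lborel)"
      by (rule nn_integral_cmult[symmetric]) simp
    also have "\<dots> = (\<integral>\<^sup>+x. ennreal (gamma_density c x) * (ennreal (t powr c * exp (- (t - 1) * x)) * indicator A x) \<partial>lborel)"
    proof (rule nn_integral_cong)
      fix x :: real
      have "t * gamma_density c (t * x) = gamma_density c x * (t powr c * exp (- (t - 1) * x))"
        using t by (auto simp: gamma_density_def powr_mult powr_diff zero_less_mult_iff exp_add[symmetric] exp_diff[symmetric] field_simps)
          
      then show "ennreal t * (ennreal (gamma_density c (t * x)) * indicator A x)
        = ennreal (gamma_density c x) * (ennreal (t powr c * exp (- (t - 1) * x)) * indicator A x)"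
        using t c by (simp add: mult.assoc[symmetric] ennreal_mult[symmetric] gamma_density_nonneg)
    qed
    also have "\<dots> = (\<integral>\<^sup>+x. ennreal (t powr c * exp (- (t - 1) * x)) * indicator A x \<partial>gamma_law c)"
      using c by (intro nn_integral_gamma_law[symmetric]) auto
    also have "\<dots> = emeasure (density (gamma_law c) (\<lambda>x. ennreal (t powr c * exp (- (t - 1) * x)))) A"
      by (subst emeasure_density) auto
    finally show ?thesis .
  qed
qed simp

section \<open>Ratios of linear forms in independent Gamma variables\<close>

text \<open>A finite product of sigma-finite measures is determined by its values on boxes, and on a box the
  integral of a product of functions of the single coordinates factorizes.\<close>

lemma PiM_density_eq:
  assumes fin: "finite I"
    and M: "\<And>i. i \<in> I \<Longrightarrow> sigma_finite_measure (M i)"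
    and f [measurable]: "\<And>i. i \<in> I \<Longrightarrow> f i \<in> borel_measurable (M i)"
    and D: "\<And>i. i \<in> I \<Longrightarrow> sigma_finite_measure (density (M i) (f i))"
  shows "density (PiM I M) (\<lambda>x. \<Prod>i\<in>I. f i (x i)) = PiM I (\<lambda>i. density (M i) (f i))"
proof -
  \<comment> \<open>The locale of products requires sigma-finiteness at every index, so both families are extended
    by a finite measure outside \<open>I\<close>.\<close>
  define M' where "M' i = (if i \<in> I then M i else count_space {undefined})" for i
  define D' where "D' i = (if i \<in> I then density (M i) (f i) else count_space {undefined})" for i
  interpret M': product_sigma_finite M'
    using M by (auto simp: product_sigma_finite_def M'_def intro!: sigma_finite_measure_count_space_finite)
  interpret D': product_sigma_finite D'
    using D by (auto simp: product_sigma_finite_def D'_def intro!: sigma_finite_measure_count_space_finite)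
  have MM': "PiM I M = PiM I M'" and DD': "PiM I (\<lambda>i. density (M i) (f i)) = PiM I D'"
    by (auto intro!: PiM_cong simp: M'_def D'_def)
  have f' [measurable]: "f i \<in> borel_measurable (M' i)" if "i \<in> I" for i
    using that by (simp add: M'_def)
  have "density (PiM I M') (\<lambda>x. \<Prod>i\<in>I. f i (x i)) = PiM I D'"
  proof (rule D'.PiM_eqI[OF fin])
    show "sets (density (PiM I M') (\<lambda>x. \<Prod>i\<in>I. f i (x i))) = sets (PiM I D')"
      by (auto intro!: sets_PiM_cong simp: M'_def D'_def)
  next
    fix A assume A: "\<And>i. i \<in> I \<Longrightarrow> A i \<in> sets (D' i)"
    then have A' [measurable]: "\<And>i. i \<in> I \<Longrightarrow> A i \<in> sets (M' i)" by (auto simp: M'_def D'_def)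
    have "emeasure (density (PiM I M') (\<lambda>x. \<Prod>i\<in>I. f i (x i))) (Pi\<^sub>E I A)
        = (\<integral>\<^sup>+x. (\<Prod>i\<in>I. f i (x i)) * indicator (Pi\<^sub>E I A) x \<partial>PiM I M')"
      using fin by (subst emeasure_density) (auto intro!: sets_PiM_I_finite)
    also have "\<dots> = (\<integral>\<^sup>+x. (\<Prod>i\<in>I. f i (x i) * indicator (A i) (x i)) \<partial>PiM I M')"
    proof (rule nn_integral_cong)
      fix x assume "x \<in> space (PiM I M')"
      then have "indicator (Pi\<^sub>E I A) x = (\<Prod>i\<in>I. indicator (A i) (x i) :: ennreal)"
        using fin by (auto simp: space_PiM PiE_def indicator_def Pi_iff split: if_splits)
      then show "(\<Prod>i\<in>I. f i (x i)) * indicator (Pi\<^sub>E I A) x = (\<Prod>i\<in>I. f i (x i) * indicator (A i) (x i))"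
        by (simp add: prod.distrib)
    qed
    also have "\<dots> = (\<Prod>i\<in>I. \<integral>\<^sup>+x. f i x * indicator (A i) x \<partial>M' i)"
      by (rule M'.product_nn_integral_prod[OF fin]) measurable
    also have "\<dots> = (\<Prod>i\<in>I. emeasure (D' i) (A i))"
    proof (rule prod.cong[OF refl])
      fix i assume i: "i \<in> I"
      then show "(\<integral>\<^sup>+x. f i x * indicator (A i) x \<partial>M' i) = emeasure (D' i) (A i)"
        using A'[OF i] f[OF i] by (simp add: D'_def M'_def emeasure_density)
    qed
    finally show "emeasure (density (PiM I M') (\<lambda>x. \<Prod>i\<in>I. f i (x i))) (Pi\<^sub>E I A)
        = (\<Prod>i\<in>I. emeasure (D' i) (A i))" .
  qed
  then show ?thesis by (simp add: MM' DD')
qed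

lemma PiM_gamma_law_tilt:
  fixes g :: "'i \<Rightarrow> real"
  assumes fin: "finite I" and g: "\<And>i. i \<in> I \<Longrightarrow> 0 \<le> g i" and t: "0 < t"
    and h [measurable]: "h \<in> borel_measurable (PiM I (\<lambda>_. borel))"
  shows "(\<integral>\<^sup>+x. h (\<lambda>i\<in>I. x i / t) \<partial>PiM I (\<lambda>i. gamma_law (g i)))
    = (\<integral>\<^sup>+x. ennreal (t powr sum g I * exp (- (t - 1) * sum x I)) * h x \<partial>PiM I (\<lambda>i. gamma_law (g i)))"
proof -
  let ?K = "PiM I (\<lambda>i. gamma_law (g i))"
  let ?f = "\<lambda>i x. ennreal (t powr g i * exp (- (t - 1) * x))"
  have setsK [measurable_cong]: "sets ?K = sets (PiM I (\<lambda>_. borel))"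
    by (intro sets_PiM_cong) auto
  have cm [measurable]: "compose I (\<lambda>x. x / t) \<in> measurable ?K (PiM I (\<lambda>_. borel))"
    unfolding compose_def by measurable
  have ps: "prob_space (distr (gamma_law (g i)) borel (\<lambda>x. x / t))" if "i \<in> I" for i
    using g[OF that] by (intro prob_space.prob_space_distr) auto
  have ps': "prob_space (density (gamma_law (g i)) (?f i))" if "i \<in> I" for i
    using ps[OF that] unfolding gamma_law_tilt[OF g[OF that] t] .
  have "density ?K (\<lambda>x. \<Prod>i\<in>I. ?f i (x i)) = PiM I (\<lambda>i. density (gamma_law (g i)) (?f i))"
    using g by (intro PiM_density_eq[OF fin] prob_space_imp_sigma_finite[OF ps'])
      (auto intro!: prob_space_imp_sigma_finite)
  also have "\<dots> = PiM I (\<lambda>i. distr (gamma_law (g i)) borel (\<lambda>x. x / t))"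
    using g t by (intro PiM_cong) (auto simp: gamma_law_tilt)
  also have "\<dots> = distr ?K (PiM I (\<lambda>_. borel)) (compose I (\<lambda>x. x / t))"
  proof -
    have "distr ?K (PiM I (\<lambda>i. gamma_law 1)) (compose I (\<lambda>x. x / t)) =
       PiM I (\<lambda>i. distr (gamma_law (g i)) (gamma_law 1) (\<lambda>x. x / t))"
      using fin g by (intro distr_PiM_finite_prob_space') auto
    also have "distr ?K (PiM I (\<lambda>i. gamma_law 1)) (compose I (\<lambda>x. x / t)) = distr ?K (PiM I (\<lambda>_. borel)) (compose I (\<lambda>x. x / t))"
      by (intro distr_cong sets_PiM_cong) auto
    also have "PiM I (\<lambda>i. distr (gamma_law (g i)) (gamma_law 1) (\<lambda>x. x / t)) = PiM I (\<lambda>i. distr (gamma_law (g i)) borel (\<lambda>x. x / t))"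
      by (intro PiM_cong distr_cong) auto
    finally show ?thesis by simp
  qed
  finally have eq: "distr ?K (PiM I (\<lambda>_. borel)) (compose I (\<lambda>x. x / t)) = density ?K (\<lambda>x. \<Prod>i\<in>I. ?f i (x i))" ..
  have "(\<integral>\<^sup>+x. h (\<lambda>i\<in>I. x i / t) \<partial>?K) = (\<integral>\<^sup>+x. h x \<partial>distr ?K (PiM I (\<lambda>_. borel)) (compose I (\<lambda>x. x / t)))"
    using cm by (subst nn_integral_distr) (auto simp: compose_def)
  also have "\<dots> = (\<integral>\<^sup>+x. (\<Prod>i\<in>I. ?f i (x i)) * h x \<partial>?K)"
    unfolding eq by (subst nn_integral_density) auto
  also have "\<dots> = (\<integral>\<^sup>+x. ennreal (t powr sum g I * exp (- (t - 1) * sum x I)) * h x \<partial>?K)"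
  proof (intro nn_integral_cong arg_cong2[where f="(*)"] refl)
    fix x
    have "(\<Prod>i\<in>I. ?f i (x i)) = ennreal (\<Prod>i\<in>I. t powr g i * exp (- (t - 1) * x i))"
      by (rule prod_ennreal) simp
    also have "(\<Prod>i\<in>I. t powr g i * exp (- (t - 1) * x i)) = t powr sum g I * exp (- (t - 1) * sum x I)"
      using t fin by (simp add: prod.distrib powr_sum exp_sum sum_distrib_left)
    finally show "(\<Prod>i\<in>I. ?f i (x i)) = ennreal (t powr sum g I * exp (- (t - 1) * sum x I))" .
  qed
  finally show ?thesis .
qed

lemma gamma_vector_laplace:
  fixes g b :: "'i \<Rightarrow> real"
  assumes fin: "finite I" and g: "\<And>i. i \<in> I \<Longrightarrow> 0 \<le> g i" and b: "\<And>i. i \<in> I \<Longrightarrow> 0 \<le> b i"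
  shows "(\<integral>\<^sup>+x. ennreal (exp (- (\<Sum>i\<in>I. b i * x i))) \<partial>PiM I (\<lambda>i. gamma_law (g i)))
    = ennreal (\<Prod>i\<in>I. (1 + b i) powr (- g i))"
proof -
  define g' where "g' i = (if i \<in> I then g i else 0)" for i
  have g': "0 \<le> g' i" for i using g by (simp add: g'_def)
  interpret product_sigma_finite "\<lambda>i. gamma_law (g' i)"
    using g' by (auto simp: product_sigma_finite_def intro!: prob_space_imp_sigma_finite)
  have "PiM I (\<lambda>i. gamma_law (g i)) = PiM I (\<lambda>i. gamma_law (g' i))"
    by (intro PiM_cong) (auto simp: g'_def)
  then have "(\<integral>\<^sup>+x. ennreal (exp (- (\<Sum>i\<in>I. b i * x i))) \<partial>PiM I (\<lambda>i. gamma_law (g i)))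
    = (\<integral>\<^sup>+x. (\<Prod>i\<in>I. ennreal (exp (- b i * x i))) \<partial>PiM I (\<lambda>i. gamma_law (g' i)))"
    using fin by (auto simp: prod_ennreal exp_sum sum_negf[symmetric] intro!: nn_integral_cong)
  also have "\<dots> = (\<Prod>i\<in>I. \<integral>\<^sup>+x. ennreal (exp (- b i * x)) \<partial>gamma_law (g' i))"
    using fin by (intro product_nn_integral_prod) auto
  also have "\<dots> = (\<Prod>i\<in>I. ennreal ((1 + b i) powr (- g i)))"
  proof (rule prod.cong[OF refl])
    fix i assume "i \<in> I"
    then show "(\<integral>\<^sup>+x. ennreal (exp (- b i * x)) \<partial>gamma_law (g' i)) = ennreal ((1 + b i) powr (- g i))"
      using gamma_law_laplace[OF g' b, of i i] by (simp add: g'_def)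
  qed
  also have "\<dots> = ennreal (\<Prod>i\<in>I. (1 + b i) powr (- g i))"
    by (rule prod_ennreal) simp
  finally show ?thesis .
qed

text \<open>Write \<open>s = \<Sum> x\<^sub>i\<close>, \<open>y = \<Sum> b\<^sub>i x\<^sub>i\<close> and \<open>c = \<Sum> g\<^sub>i\<close>. The number \<open>(1 + y/s)\<^sup>-\<^sup>c = s\<^sup>c (s + y)\<^sup>-\<^sup>c\<close> is an
  inverse-Gamma integral over a scale \<open>t\<close>, whose integrand is \<open>1/t\<close> times the function
  \<open>s\<^sup>c e\<^sup>-\<^sup>s\<^sup>-\<^sup>y\<close> evaluated at \<open>x / t\<close>. The tilting formula replaces \<open>x / t\<close> by \<open>x\<close>, after which the integral
  over \<open>t\<close> is a Gamma integral that cancels \<open>s\<^sup>c\<close> and leaves \<open>e\<^sup>-\<^sup>y\<close>.\<close>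

lemma gamma_vector_ratio:
  fixes g b :: "'i \<Rightarrow> real"
  assumes fin: "finite I" and g: "\<And>i. i \<in> I \<Longrightarrow> 0 \<le> g i" and b: "\<And>i. i \<in> I \<Longrightarrow> 0 \<le> b i"
    and c: "0 < sum g I"
  shows "(\<integral>\<^sup>+x. ennreal ((1 + (\<Sum>i\<in>I. b i * x i) / sum x I) powr (- sum g I)) \<partial>PiM I (\<lambda>i. gamma_law (g i)))
    = (\<integral>\<^sup>+x. ennreal (exp (- (\<Sum>i\<in>I. b i * x i))) \<partial>PiM I (\<lambda>i. gamma_law (g i)))"
proof -
  let ?K = "PiM I (\<lambda>i. gamma_law (g i))"
  define c where "c = sum g I"
  define s where "s x = sum x I" for x :: "'i \<Rightarrow> real"
  define y where "y x = (\<Sum>i\<in>I. b i * x i)" for x :: "'i \<Rightarrow> real"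
  have c0: "0 < c" using c by (simp add: c_def)
  have G: "0 < Gamma c" using c0 by (rule Gamma_real_pos)
  have pK: "prob_space ?K" using g by (intro prob_space_PiM) auto
  interpret K: prob_space ?K by fact
  interpret P: pair_sigma_finite ?K lborel ..
  have setsK [measurable_cong]: "sets ?K = sets (PiM I (\<lambda>_. borel))"
    by (intro sets_PiM_cong) auto
  have [measurable]: "s \<in> borel_measurable (PiM I (\<lambda>_. borel))" "y \<in> borel_measurable (PiM I (\<lambda>_. borel))"
    unfolding s_def y_def by measurable
  obtain j where j: "j \<in> I" "0 < g j"
    using c g by (metis sum_nonpos not_less)
  have AEnn: "AE x in ?K. \<forall>i\<in>I. 0 \<le> x i"
    using fin g by (auto intro!: AE_finite_allI AE_PiM_component[where P="\<lambda>x. 0 \<le> x"] AE_gamma_law_nonneg)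
  moreover have "AE x in ?K. 0 < x j"
    using g j by (auto intro!: AE_PiM_component[where P="\<lambda>x. 0 < x"] AE_gamma_law_pos)
  ultimately have AE: "AE x in ?K. 0 < s x \<and> 0 \<le> y x"
  proof eventually_elim
    case (elim x)
    have "x j \<le> s x" unfolding s_def using elim j fin by (intro member_le_sum) auto
    then show ?case using elim b by (auto simp: y_def intro!: sum_nonneg)
  qed
  let ?J = "\<lambda>x t. ennreal (indicator {0<..} t * (t powr (- c - 1) * exp (- (s x + y x) / t)))"
  let ?J' = "\<lambda>x t. ennreal (indicator {0<..} t * (t powr (c - 1) * exp (- s x * t)))"
  have "ennreal (Gamma c) * (\<integral>\<^sup>+x. ennreal ((1 + y x / s x) powr (- c)) \<partial>?K)
     = (\<integral>\<^sup>+x. ennreal (Gamma c) * ennreal ((1 + y x / s x) powr (- c)) \<partial>?K)"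
    by (rule nn_integral_cmult[symmetric]) measurable
  also have "\<dots> = (\<integral>\<^sup>+x. (\<integral>\<^sup>+t. ennreal (s x powr c) * ?J x t \<partial>lborel) \<partial>?K)"
  proof (rule nn_integral_cong_AE, use AE in eventually_elim)
    case (elim x)
    have "(\<integral>\<^sup>+t. ennreal (s x powr c) * ?J x t \<partial>lborel) = ennreal (s x powr c) * (\<integral>\<^sup>+t. ?J x t \<partial>lborel)"
      by (rule nn_integral_cmult) measurable
    also have "\<dots> = ennreal (s x powr c) * ennreal (Gamma c * (s x + y x) powr (- c))"
      using elim c0 by (subst nn_integral_inverse_gamma_kernel) auto
    also have "\<dots> = ennreal (Gamma c * (1 + y x / s x) powr (- c))"
    proof -
      have "(1 + y x / s x) powr (- c) = ((s x + y x) / s x) powr (- c)"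
        using elim by (simp add: field_simps)
      also have "\<dots> = s x powr c * (s x + y x) powr (- c)"
        using elim by (simp add: powr_divide powr_minus field_simps)
      finally show ?thesis using G by (simp add: ennreal_mult[symmetric] mult_ac)
    qed
    finally show ?case using G by (simp add: ennreal_mult)
  qed
  also have "\<dots> = (\<integral>\<^sup>+t. (\<integral>\<^sup>+x. ennreal (s x powr c) * ?J x t \<partial>?K) \<partial>lborel)"
    by (rule P.Fubini'[symmetric]) measurable
  also have "\<dots> = (\<integral>\<^sup>+t. (\<integral>\<^sup>+x. ennreal (s x powr c * exp (- y x)) * ?J' x t \<partial>?K) \<partial>lborel)"
  proof (rule nn_integral_cong)
    fix t :: real
    show "(\<integral>\<^sup>+x. ennreal (s x powr c) * ?J x t \<partial>?K) = (\<integral>\<^sup>+x. ennreal (s x powr c * exp (- y x)) * ?J' x t \<partial>?K)"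
    proof (cases "0 < t")
      case True
      define h where "h x = ennreal (s x powr c * exp (- s x - y x))" for x
      have [measurable]: "h \<in> borel_measurable (PiM I (\<lambda>_. borel))" unfolding h_def by measurable
      have scale: "s (\<lambda>i\<in>I. x i / t) = s x / t" "y (\<lambda>i\<in>I. x i / t) = y x / t" for x
        by (auto simp: s_def y_def sum_divide_distrib intro!: sum.cong)
      have "(\<integral>\<^sup>+x. ennreal (s x powr c) * ?J x t \<partial>?K) = (\<integral>\<^sup>+x. ennreal (1 / t) * h (\<lambda>i\<in>I. x i / t) \<partial>?K)"
      proof (rule nn_integral_cong_AE, use AE in eventually_elim)
        case (elim x)
        have "s x powr c * (t powr (- c - 1) * exp (- (s x + y x) / t))
          = 1 / t * ((s x / t) powr c * exp (- (s x / t) - y x / t))"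
          using elim True by (simp add: powr_divide powr_diff powr_minus field_simps)
        then show ?case using True
          by (simp add: h_def scale ennreal_mult[symmetric])
      qed
      also have "\<dots> = ennreal (1 / t) * (\<integral>\<^sup>+x. h (\<lambda>i\<in>I. x i / t) \<partial>?K)"
        by (rule nn_integral_cmult) measurable
      also have "\<dots> = ennreal (1 / t) * (\<integral>\<^sup>+x. ennreal (t powr c * exp (- (t - 1) * s x)) * h x \<partial>?K)"
        unfolding s_def c_def using fin g True by (subst PiM_gamma_law_tilt) auto
      also have "\<dots> = (\<integral>\<^sup>+x. ennreal (1 / t) * (ennreal (t powr c * exp (- (t - 1) * s x)) * h x) \<partial>?K)"
        by (rule nn_integral_cmult[symmetric]) measurable
      also have "\<dots> = (\<integral>\<^sup>+x. ennreal (s x powr c * exp (- y x)) * ?J' x t \<partial>?K)"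
      proof (rule nn_integral_cong)
        fix x
        have "1 / t * (t powr c * exp (- (t - 1) * s x) * (s x powr c * exp (- s x - y x)))
          = s x powr c * exp (- y x) * (t powr (c - 1) * exp (- s x * t))"
          using True by (simp add: powr_diff mult_exp_exp algebra_simps)
        then show "ennreal (1 / t) * (ennreal (t powr c * exp (- (t - 1) * s x)) * h x)
            = ennreal (s x powr c * exp (- y x)) * ?J' x t"
          using True by (simp add: h_def ennreal_mult[symmetric])
      qed
      finally show ?thesis .
    qed simp
  qed
  also have "\<dots> = (\<integral>\<^sup>+x. (\<integral>\<^sup>+t. ennreal (s x powr c * exp (- y x)) * ?J' x t \<partial>lborel) \<partial>?K)"
    by (rule P.Fubini') measurable
  also have "\<dots> = (\<integral>\<^sup>+x. ennreal (Gamma c) * ennreal (exp (- y x)) \<partial>?K)"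
  proof (rule nn_integral_cong_AE, use AE in eventually_elim)
    case (elim x)
    have "(\<integral>\<^sup>+t. ennreal (s x powr c * exp (- y x)) * ?J' x t \<partial>lborel)
        = ennreal (s x powr c * exp (- y x)) * (\<integral>\<^sup>+t. ?J' x t \<partial>lborel)"
      by (rule nn_integral_cmult) measurable
    also have "\<dots> = ennreal (s x powr c * exp (- y x)) * ennreal (Gamma c * s x powr (- c))"
      using elim c0 by (subst nn_integral_gamma_kernel) auto
    also have "\<dots> = ennreal (Gamma c) * ennreal (exp (- y x))"
      using elim G by (simp add: ennreal_mult[symmetric] powr_minus field_simps)
    finally show ?case .
  qed
  also have "\<dots> = ennreal (Gamma c) * (\<integral>\<^sup>+x. ennreal (exp (- y x)) \<partial>?K)"
    by (rule nn_integral_cmult) measurable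
  finally have "ennreal (Gamma c) * (\<integral>\<^sup>+x. ennreal ((1 + y x / s x) powr (- c)) \<partial>?K)
      = ennreal (Gamma c) * (\<integral>\<^sup>+x. ennreal (exp (- y x)) \<partial>?K)" .
  then have "(\<integral>\<^sup>+x. ennreal ((1 + y x / s x) powr (- c)) \<partial>?K) = (\<integral>\<^sup>+x. ennreal (exp (- y x)) \<partial>?K)"
    using G by (simp add: ennreal_mult_cancel_left)
  then show ?thesis by (simp add: y_def s_def c_def)
qed

section \<open>Means of Dirichlet processes\<close>

lemma space_finite_measures: "space finite_measures = {m. finite_measure m \<and> sets m = sets borel}"
  by (auto simp add: finite_measures_def space_Sup_eq_UN)

lemma measurable_emeasure_finite_measures [measurable]:
  "A \<in> sets borel \<Longrightarrow> (\<lambda>m. emeasure m A) \<in> borel_measurable finite_measures"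
  by (auto intro!: measurable_Sup1 measurable_vimage_algebra1 simp: finite_measures_def)

lemma measurable_measure_finite_measures [measurable]:
  "A \<in> sets borel \<Longrightarrow> (\<lambda>m. measure m A) \<in> borel_measurable finite_measures"
  unfolding measure_def by (rule measurable_compose[OF measurable_emeasure_finite_measures]) simp_all

text \<open>The sigma-algebra on finite measures is generated by the evaluations, so a map into this space
  is measurable as soon as its evaluations are.\<close>

lemma measurable_finite_measures:
  "(\<And>x. x \<in> space M \<Longrightarrow> finite_measure (K x) \<and> sets (K x) = sets borel) \<Longrightarrow>
   (\<And>A. A \<in> sets borel \<Longrightarrow> (\<lambda>x. emeasure (K x) A) \<in> borel_measurable M) \<Longrightarrow>
   K \<in> measurable M finite_measures"
  by (auto intro!: measurable_Sup2 measurable_vimage_algebra2 simp: finite_measures_def)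

lemma measurable_nn_integral_finite_measures:
  assumes f: "f \<in> borel_measurable borel"
  shows "(\<lambda>m. integral\<^sup>N m f) \<in> borel_measurable finite_measures" (is "_ \<in> ?B")
  using f
proof induct
  case (cong f g)
  have "integral\<^sup>N m f = integral\<^sup>N m g" for m
    using cong by (intro nn_integral_cong) auto
  then show ?case using cong by simp
next
  case (set A)
  then have "(\<lambda>m. \<integral>\<^sup>+x. indicator A x \<partial>m) \<in> ?B \<longleftrightarrow> (\<lambda>m. emeasure m A) \<in> ?B"
    by (intro measurable_cong nn_integral_indicator) (simp add: space_finite_measures)
  with set show ?case by (simp add: measurable_emeasure_finite_measures)
next
  case (mult f c)
  then have "(\<lambda>m. \<integral>\<^sup>+x. c * f x \<partial>m) \<in> ?B \<longleftrightarrow> (\<lambda>m. c * \<integral>\<^sup>+x. f x \<partial>m) \<in> ?B"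
    by (intro measurable_cong nn_integral_cmult) (auto simp: space_finite_measures)
  with mult show ?case by simp
next
  case (add f g)
  then have "(\<lambda>m. \<integral>\<^sup>+x. f x + g x \<partial>m) \<in> ?B \<longleftrightarrow> (\<lambda>m. (\<integral>\<^sup>+x. f x \<partial>m) + (\<integral>\<^sup>+x. g x \<partial>m)) \<in> ?B"
    by (intro measurable_cong nn_integral_add) (auto simp: space_finite_measures)
  with add show ?case by (simp add: ac_simps)
next
  case (seq F)
  then have "(\<lambda>m. \<integral>\<^sup>+x. (SUP i. F i) x \<partial>m) \<in> ?B \<longleftrightarrow> (\<lambda>m. SUP i. (\<integral>\<^sup>+x. F i x \<partial>m)) \<in> ?B"
    unfolding SUP_apply
    by (intro measurable_cong nn_integral_monotone_convergence_SUP) (auto simp: space_finite_measures)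
  with seq show ?case by (simp add: ac_simps)
qed

lemma measurable_integral_finite_measures:
  fixes f :: "real \<Rightarrow> real"
  assumes f [measurable]: "f \<in> borel_measurable borel"
  shows "(\<lambda>m. \<integral>x. f x \<partial>m) \<in> borel_measurable finite_measures"
proof -
  have [measurable]: "(\<lambda>m. \<integral>\<^sup>+x. ennreal (f x) \<partial>m) \<in> borel_measurable finite_measures"
    "(\<lambda>m. \<integral>\<^sup>+x. ennreal (- f x) \<partial>m) \<in> borel_measurable finite_measures"
    "(\<lambda>m. \<integral>\<^sup>+x. ennreal (norm (f x)) \<partial>m) \<in> borel_measurable finite_measures"
    by (auto intro!: measurable_nn_integral_finite_measures)
  \<comment> \<open>The Bochner integral is \<open>0\<close> for functions that are not integrable.\<close>
  have "(\<lambda>m. if (\<integral>\<^sup>+x. ennreal (norm (f x)) \<partial>m) < \<infinity> then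
      enn2real (\<integral>\<^sup>+x. ennreal (f x) \<partial>m) - enn2real (\<integral>\<^sup>+x. ennreal (- f x) \<partial>m) else 0)
      \<in> borel_measurable finite_measures"
    by measurable
  also have "?this \<longleftrightarrow> ?thesis"
  proof (rule measurable_cong)
    fix m assume "m \<in> space finite_measures"
    then have [measurable_cong]: "sets m = sets borel" by (simp add: space_finite_measures)
    have "integrable m f \<longleftrightarrow> (\<integral>\<^sup>+x. ennreal (norm (f x)) \<partial>m) < \<infinity>"
      by (simp add: integrable_iff_bounded)
    then show "(if (\<integral>\<^sup>+x. ennreal (norm (f x)) \<partial>m) < \<infinity> then
      enn2real (\<integral>\<^sup>+x. ennreal (f x) \<partial>m) - enn2real (\<integral>\<^sup>+x. ennreal (- f x) \<partial>m) else 0) = (\<integral>x. f x \<partial>m)"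
      by (auto simp: real_lebesgue_integral_def not_integrable_integral_eq)
  qed
  finally show ?thesis .
qed

text \<open>The null measure is a finite measure that normalization leaves unchanged, because
  \<open>1 / 0 = \<infinity>\<close> and \<open>\<infinity> * 0 = 0\<close> in the extended nonnegative reals.\<close>

lemma measurable_normalized: "normalized \<in> measurable finite_measures finite_measures"
proof (rule measurable_finite_measures)
  fix m assume "m \<in> space finite_measures"
  then have m: "finite_measure m" "sets m = sets borel" by (auto simp: space_finite_measures)
  interpret finite_measure m by fact
  have "1 / emeasure m (space m) * emeasure m (space m) \<noteq> \<infinity>"
    by (cases "emeasure m (space m) = 0")
       (auto simp: ennreal_mult_eq_top_iff ennreal_divide_eq_top_iff)
  then show "finite_measure (normalized m) \<and> sets (normalized m) = sets borel"
    using m by (auto simp: normalized_def space_scale_measure intro!: finite_measureI)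
next
  fix A :: "real set" assume [measurable]: "A \<in> sets borel"
  have "(\<lambda>m. 1 / emeasure m UNIV * emeasure m A) \<in> borel_measurable finite_measures"
    by measurable
  also have "?this \<longleftrightarrow> (\<lambda>m. emeasure (normalized m) A) \<in> borel_measurable finite_measures"
    by (intro measurable_cong) (auto simp: normalized_def space_finite_measures dest!: sets_eq_imp_space_eq)
  finally show "(\<lambda>m. emeasure (normalized m) A) \<in> borel_measurable finite_measures" .
qed

lemma integral_normalized:
  assumes "finite_measure m" and T: "0 < measure m (space m)" and f [measurable]: "f \<in> borel_measurable m"
  shows "(\<integral>x. f x \<partial>normalized m) = (\<integral>x. f x \<partial>m) / measure m (space m :: real set)"
proof -
  interpret finite_measure m by fact
  have "1 / emeasure m (space m) = ennreal (1 / measure m (space m))"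
    using T by (simp add: emeasure_eq_measure divide_ennreal flip: ennreal_1)
  then have "normalized m = density m (\<lambda>_. ennreal (1 / measure m (space m)))"
    by (intro measure_eqI) (auto simp: normalized_def emeasure_density nn_integral_cmult_indicator)
  then show ?thesis using T by (simp add: integral_density)
qed

lemma integral_finite_range:
  fixes f :: "real \<Rightarrow> real" and h :: "real \<Rightarrow> real" and k :: nat
  assumes fin: "finite_measure M" and sM: "sets M = sets borel" and f: "f \<in> borel_measurable borel" and e: "bij_betw e {..<k} (range f)"
  shows "(\<integral>x. h (f x) \<partial>M) = (\<Sum>j<k. h (e j) * measure M (f -` {e j}))"
proof -
  interpret finite_measure M by fact
  have A: "f -` {e j} \<in> sets M" for j
    using measurable_sets_borel[OF f, of "{e j}"] sM by simp
  have "h (f x) = (\<Sum>j<k. h (e j) * indicator (f -` {e j}) x)" for x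
  proof -
    obtain i where i: "i < k" "f x = e i" using e by (force simp: bij_betw_def)
    have inj: "inj_on e {..<k}" using e by (simp add: bij_betw_def)
    have "(\<Sum>j<k. h (e j) * indicator (f -` {e j}) x) = (\<Sum>j<k. if j = i then h (e j) else 0)"
      using i inj by (intro sum.cong) (auto simp: inj_on_def indicator_def)
    also have "\<dots> = h (e i)" using i by (subst sum.delta) auto
    finally show ?thesis using i by simp
  qed
  then have "(\<integral>x. h (f x) \<partial>M) = (\<integral>x. (\<Sum>j<k. h (e j) * indicator (f -` {e j}) x) \<partial>M)" by simp
  also have "\<dots> = (\<Sum>j<k. h (e j) * measure M (f -` {e j}))"
    using A sets_eq_imp_space_eq[OF sM] by (subst Bochner_Integration.integral_sum) (auto simp: emeasure_eq_measure)
  finally show ?thesis .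
qed

text \<open>On the level sets of a simple function a Gamma random measure is a vector of independent Gamma
  variables, whose parameters add up to the total mass of the shape measure.\<close>

lemma gamma_random_measure_simple:
  fixes f :: "real \<Rightarrow> real"
  assumes N: "gamma_random_measure \<alpha> N"
    and \<alpha>: "finite_measure \<alpha>" "sets \<alpha> = sets borel" "0 < measure \<alpha> UNIV"
    and f [measurable]: "f \<in> borel_measurable borel" and fr: "finite (range f)"
    and f0: "\<And>x. 0 \<le> f x" and w: "0 \<le> w"
  shows "(\<integral>m. exp (- w * (\<integral>x. f x \<partial>m)) \<partial>N) = exp (- (\<integral>x. ln (1 + w * f x) \<partial>\<alpha>))" (is ?laplace)
    and "(\<integral>m. (1 + w * ((\<integral>x. f x \<partial>m) / measure m UNIV)) powr (- measure \<alpha> UNIV) \<partial>N)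
      = exp (- (\<integral>x. ln (1 + w * f x) \<partial>\<alpha>))" (is ?ratio)
proof -
  interpret N: prob_space N using N by (simp add: gamma_random_measure_def)
  interpret \<alpha>: finite_measure \<alpha> by fact
  have sN [measurable_cong]: "sets N = sets finite_measures" using N by (simp add: gamma_random_measure_def)
  have spN: "space N = space finite_measures" by (rule sets_eq_imp_space_eq) (rule sN)
  obtain e k where e: "bij_betw e {..<k::nat} (range f)"
    using ex_bij_betw_nat_finite[OF fr] by (auto simp: atLeast0LessThan)
  define A where "A j = f -` {e j}" for j
  have A [measurable]: "A j \<in> sets borel" for j
    unfolding A_def using measurable_sets_borel[OF f, of "{e j}"] by simp
  have k: "{..<k} \<noteq> {}" using e by (auto simp: bij_betw_def)
  have inj: "inj_on e {..<k}" using e by (simp add: bij_betw_def)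
  have dis: "disjoint_family_on A {..<k}"
    using inj by (auto simp: disjoint_family_on_def A_def inj_on_def)
  have ind: "N.indep_vars (\<lambda>_. borel) (\<lambda>i m. measure m (A i)) {..<k}"
    using N dis A unfolding gamma_random_measure_def by blast
  define g where "g i = measure \<alpha> (A i)" for i
  define b where "b i = w * e i" for i
  have g0: "0 \<le> g i" for i by (simp add: g_def)
  have b0: "0 \<le> b i" if "i \<in> {..<k}" for i
  proof -
    have "e i \<in> range f" using e that by (auto simp: bij_betw_def)
    then show ?thesis using f0 w by (auto simp: b_def)
  qed
  let ?K = "PiM {..<k} (\<lambda>i. gamma_law (g i))"
  let ?X = "\<lambda>m. \<lambda>i\<in>{..<k}. measure m (A i)"
  have "distr N (PiM {..<k} (\<lambda>_. borel)) ?X = PiM {..<k} (\<lambda>i. distr N borel (\<lambda>m. measure m (A i)))"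
    using ind k by (subst (asm) N.indep_vars_iff_distr_eq_PiM') auto
  also have "\<dots> = ?K"
    using N by (intro PiM_cong) (auto simp: gamma_random_measure_def g_def)
  finally have K: "distr N (PiM {..<k} (\<lambda>_. borel)) ?X = ?K" .
  have gsum: "sum g {..<k} = measure \<alpha> UNIV"
    using integral_finite_range[OF \<alpha>(1) \<alpha>(2) f e, of "\<lambda>_. 1"] sets_eq_imp_space_eq[OF \<alpha>(2)]
    by (simp add: g_def A_def)
  have Y: "w * (\<integral>x. f x \<partial>m) = (\<Sum>i<k. b i * ?X m i)" and T: "measure m UNIV = (\<Sum>i<k. ?X m i)"
    if "m \<in> space N" for m
  proof -
    from that have m: "finite_measure m" "sets m = sets borel" by (auto simp: spN space_finite_measures)
    interpret m: finite_measure m by fact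
    show "w * (\<integral>x. f x \<partial>m) = (\<Sum>i<k. b i * ?X m i)"
      using integral_finite_range[OF m(1) m(2) f e, of "\<lambda>x. x"]
      by (simp add: b_def A_def sum_distrib_left mult.assoc)
    show "measure m UNIV = (\<Sum>i<k. ?X m i)"
      using integral_finite_range[OF m(1) m(2) f e, of "\<lambda>_. 1"] sets_eq_imp_space_eq[OF m(2)]
      by (simp add: A_def)
  qed
  have eqexp: "(\<Prod>i<k. (1 + b i) powr (- g i)) = exp (- (\<integral>x. ln (1 + w * f x) \<partial>\<alpha>))"
  proof -
    have "(\<Prod>i<k. (1 + b i) powr (- g i)) = (\<Prod>i<k. exp (- (g i * ln (1 + b i))))"
      using b0 by (intro prod.cong) (auto simp: powr_def add_nonneg_eq_0_iff)
    also have "\<dots> = exp (- (\<Sum>i<k. ln (1 + w * e i) * measure \<alpha> (f -` {e i})))"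
      by (simp add: exp_sum b_def g_def A_def mult.commute flip: sum_negf)
    also have "\<dots> = exp (- (\<integral>x. ln (1 + w * f x) \<partial>\<alpha>))"
      using integral_finite_range[OF \<alpha>(1) \<alpha>(2) f e, of "\<lambda>y. ln (1 + w * y)"] by simp
    finally show ?thesis .
  qed
  have Xm: "?X \<in> measurable N (PiM {..<k} (\<lambda>_. borel))" by measurable
  note meas = measurable_integral_finite_measures[OF f, measurable]
  have "(\<integral>\<^sup>+m. ennreal (exp (- w * (\<integral>x. f x \<partial>m))) \<partial>N) = (\<integral>\<^sup>+m. ennreal (exp (- (\<Sum>i<k. b i * ?X m i))) \<partial>N)"
    using Y by (intro nn_integral_cong) (simp only: minus_mult_left[symmetric])
  also have "\<dots> = (\<integral>\<^sup>+x. ennreal (exp (- (\<Sum>i<k. b i * x i))) \<partial>?K)"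
    unfolding K[symmetric] by (rule nn_integral_distr[OF Xm, symmetric]) measurable
  also have "\<dots> = ennreal (exp (- (\<integral>x. ln (1 + w * f x) \<partial>\<alpha>)))"
    by (subst gamma_vector_laplace) (auto simp: g0 b0 eqexp)
  finally show ?laplace
    by (subst integral_eq_nn_integral) auto
  have "(\<integral>\<^sup>+m. ennreal ((1 + w * ((\<integral>x. f x \<partial>m) / measure m UNIV)) powr (- measure \<alpha> UNIV)) \<partial>N)
    = (\<integral>\<^sup>+m. ennreal ((1 + (\<Sum>i<k. b i * ?X m i) / (\<Sum>i<k. ?X m i)) powr (- sum g {..<k})) \<partial>N)"
  proof (rule nn_integral_cong)
    fix m assume m: "m \<in> space N"
    show "ennreal ((1 + w * ((\<integral>x. f x \<partial>m) / measure m UNIV)) powr (- measure \<alpha> UNIV))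
      = ennreal ((1 + (\<Sum>i<k. b i * ?X m i) / (\<Sum>i<k. ?X m i)) powr (- sum g {..<k}))"
      unfolding gsum T[OF m, symmetric] Y[OF m, symmetric] by simp
  qed
  also have "\<dots> = (\<integral>\<^sup>+x. ennreal ((1 + (\<Sum>i<k. b i * x i) / sum x {..<k}) powr (- sum g {..<k})) \<partial>?K)"
    unfolding K[symmetric] by (rule nn_integral_distr[OF Xm, symmetric]) measurable
  also have "\<dots> = ennreal (exp (- (\<integral>x. ln (1 + w * f x) \<partial>\<alpha>)))"
    using \<alpha>(3) gsum by (subst gamma_vector_ratio, simp_all add: g0 b0, subst gamma_vector_laplace)
      (auto simp: g0 b0 eqexp)
  finally show ?ratio
    by (subst integral_eq_nn_integral) auto
qed

text \<open>Take simple functions \<open>f\<^sub>i\<close> increasing to the positive part of \<open>x\<close>. On both sides the limit is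
  taken by dominated convergence. What needs an argument is that \<open>\<integral> x m(dx)\<close> is finite for almost all
  \<open>m\<close>: otherwise the integral defining the mean would be the default value \<open>0\<close> instead of the limit.\<close>

lemma dirichlet_mean_transform:
  assumes N: "gamma_random_measure \<alpha> N"
    and \<alpha>: "finite_measure \<alpha>" "sets \<alpha> = sets borel" "0 < measure \<alpha> UNIV"
    and nn: "AE x in \<alpha>. 0 \<le> x"
    and int: "\<And>w. 0 \<le> w \<Longrightarrow> integrable \<alpha> (\<lambda>x. ln (1 + w * x))"
  shows "AE m in N. 0 \<le> (\<integral>x. x \<partial>normalized m)"
    and "0 \<le> w \<Longrightarrow> (\<integral>m. (1 + w * (\<integral>x. x \<partial>normalized m)) powr (- measure \<alpha> UNIV) \<partial>N)
      = exp (- (\<integral>x. ln (1 + w * x) \<partial>\<alpha>))"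
proof -
  interpret N: prob_space N using N by (simp add: gamma_random_measure_def)
  interpret \<alpha>: finite_measure \<alpha> by fact
  have [measurable_cong]: "sets \<alpha> = sets borel" by fact
  have sN [measurable_cong]: "sets N = sets finite_measures" using N by (simp add: gamma_random_measure_def)
  have spN: "space N = space finite_measures" by (rule sets_eq_imp_space_eq) (rule sN)
  define c where "c = measure \<alpha> UNIV"
  have c: "0 < c" using \<alpha> by (simp add: c_def)
  have "(\<lambda>x::real. ennreal x) \<in> borel_measurable borel" by simp
  then obtain u :: "nat \<Rightarrow> real \<Rightarrow> ennreal" where u: "\<And>i. simple_function borel (u i)" "incseq u"
      "\<And>i x. u i x < top" "\<And>x. (SUP i. u i x) = ennreal x"
    by (rule borel_measurable_implies_simple_function_sequence') blast
  define f where "f i x = enn2real (u i x)" for i x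
  have uf: "ennreal (f i x) = u i x" for i x using u(3)[of i x] by (simp add: f_def less_top)
  have f0: "0 \<le> f i x" for i x by (simp add: f_def)
  have f_meas [measurable]: "f i \<in> borel_measurable borel" for i
    unfolding f_def using borel_measurable_simple_function[OF u(1)[of i]] by measurable
  have f_range: "finite (range (f i))" for i
  proof -
    have "range (f i) = enn2real ` range (u i)" by (auto simp: f_def)
    then show ?thesis using u(1)[of i] by (simp add: simple_function_def)
  qed
  have u_lim: "(\<lambda>i. u i x) \<longlonglongrightarrow> ennreal x" for x
    using LIMSEQ_SUP[of "\<lambda>i. u i x"] u(2,4) by (auto simp: incseq_def le_fun_def)
  have f_lim: "(\<lambda>i. f i x) \<longlonglongrightarrow> x" if "0 \<le> x" for x
    using tendsto_enn2real[OF u_lim[of x]] that by (simp add: f_def)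
  have f_le: "f i x \<le> x" if "0 \<le> x" for i x
  proof -
    have "u i x \<le> ennreal x" unfolding u(4)[symmetric] by (rule SUP_upper) simp
    then show ?thesis using that by (simp add: uf[symmetric])
  qed
  define Y where "Y i m = (\<integral>x. f i x \<partial>m)" for i m
  define I where "I m = (\<integral>\<^sup>+x. ennreal x \<partial>m)" for m
  have Y_meas [measurable]: "Y i \<in> borel_measurable N" for i
    unfolding Y_def using measurable_integral_finite_measures[OF f_meas] by measurable
  have I_meas [measurable]: "I \<in> borel_measurable N"
    unfolding I_def using measurable_nn_integral_finite_measures[of "\<lambda>x. ennreal x"] by measurable
  have Y0: "0 \<le> Y i m" for i m unfolding Y_def using f0 by (intro integral_nonneg_AE) auto
  have Y_lim: "(\<lambda>i. ennreal (Y i m)) \<longlonglongrightarrow> I m" if "m \<in> space N" for m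
  proof -
    from that have m: "finite_measure m" "sets m = sets borel" by (auto simp: spN space_finite_measures)
    interpret m: finite_measure m by fact
    have [measurable_cong]: "sets m = sets borel" by fact
    have "ennreal (Y i m) = (\<integral>\<^sup>+x. u i x \<partial>m)" for i
    proof -
      have "finite (range (f i))" by (rule f_range)
      then have "bdd_above (range (f i))" by (rule bdd_above_finite)
      then obtain B where B: "\<And>x. f i x \<le> B" by (auto simp: bdd_above_def)
      have "integrable m (f i)"
        using B f0 by (intro m.integrable_const_bound[where B=B]) auto
      then have "(\<integral>\<^sup>+x. ennreal (f i x) \<partial>m) = ennreal (Y i m)"
        unfolding Y_def using f0 by (intro nn_integral_eq_integral) auto
      then show ?thesis by (simp add: uf)
    qed
    moreover have "(\<lambda>i. \<integral>\<^sup>+x. u i x \<partial>m) \<longlonglongrightarrow> (\<integral>\<^sup>+x. ennreal x \<partial>m)"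
      using u(2) u_lim borel_measurable_simple_function[OF u(1)]
      by (intro nn_integral_LIMSEQ) (auto simp: measurable_cong_sets[OF m(2) refl])
    ultimately show ?thesis by (simp add: I_def)
  qed
  define L where "L w = exp (- (\<integral>x. ln (1 + w * x) \<partial>\<alpha>))" for w
  have L_lim: "(\<lambda>i. exp (- (\<integral>x. ln (1 + w * f i x) \<partial>\<alpha>))) \<longlonglongrightarrow> L w" if w: "0 \<le> w" for w
    unfolding L_def
  proof (intro tendsto_exp tendsto_minus integral_dominated_convergence[where w="\<lambda>x. ln (1 + w * x)"] int w)
    show "AE x in \<alpha>. (\<lambda>i. ln (1 + w * f i x)) \<longlonglongrightarrow> ln (1 + w * x)"
      using nn
    proof eventually_elim
      case (elim x)
      then have "1 + w * x \<noteq> 0" using w by (simp add: add_nonneg_eq_0_iff)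
      then show ?case by (intro tendsto_intros f_lim elim)
    qed
    show "AE x in \<alpha>. norm (ln (1 + w * f i x)) \<le> ln (1 + w * x)" for i
      using nn
    proof eventually_elim
      case (elim x)
      have "w * f i x \<le> w * x" "0 \<le> w * f i x" using w f_le[OF elim] f0 by (auto intro: mult_left_mono)
      then show ?case by (auto simp: ln_ge_zero)
    qed
  qed measurable
  have laplace: "(\<integral>m. exp (- w * Y i m) \<partial>N) = exp (- (\<integral>x. ln (1 + w * f i x) \<partial>\<alpha>))" if "0 \<le> w" for i w
    unfolding Y_def using N \<alpha> that by (intro gamma_random_measure_simple) (auto simp: f_range f0)
  have ratio: "(\<integral>m. (1 + w * (Y i m / measure m UNIV)) powr (- c) \<partial>N)
      = exp (- (\<integral>x. ln (1 + w * f i x) \<partial>\<alpha>))" if "0 \<le> w" for i w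
    unfolding Y_def c_def using N \<alpha> that by (intro gamma_random_measure_simple) (auto simp: f_range f0)
  \<comment> \<open>\<open>L w\<close> is the limit of \<open>E exp (- w Y\<^sub>i)\<close>. The exponentials tend to \<open>0\<close> where \<open>I\<close> is infinite, so
    \<open>L w\<close> is at most the probability that \<open>I\<close> is finite; and \<open>L w\<close> tends to \<open>1\<close> as \<open>w\<close> tends to \<open>0\<close>.\<close>
  have L_le: "L w \<le> N.prob {m \<in> space N. I m < top}" if w: "0 < w" for w
  proof -
    define E where "E m = (if I m = top then 0 else exp (- w * enn2real (I m)))" for m
    have E_lim: "(\<lambda>i. exp (- w * Y i m)) \<longlonglongrightarrow> E m" if m: "m \<in> space N" for m
    proof (cases "I m = top")
      case True
      have "filterlim (\<lambda>i. Y i m) at_top sequentially"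
        using Y_lim[OF m] True by (simp add: ennreal_tendsto_top_eq_at_top[unfolded infinity_ennreal_def])
      then have "filterlim (\<lambda>i. w * Y i m) at_top sequentially"
        by (rule filterlim_tendsto_pos_mult_at_top[OF tendsto_const w])
      then have "(\<lambda>i. exp (- (w * Y i m))) \<longlonglongrightarrow> 0"
        by (intro filterlim_compose[OF exp_at_bot] filterlim_compose[OF filterlim_uminus_at_bot_at_top])
      then show ?thesis using True by (simp add: E_def)
    next
      case False
      then have "(\<lambda>i. Y i m) \<longlonglongrightarrow> enn2real (I m)"
        using tendsto_enn2real[OF Y_lim[OF m, THEN tendsto_eq_rhs], of "enn2real (I m)"] Y0
        by (simp add: less_top)
      then show ?thesis using False by (auto simp: E_def intro!: tendsto_intros)
    qed
    have [measurable]: "E \<in> borel_measurable N"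
      by (rule borel_measurable_LIMSEQ_real[OF E_lim]) measurable
    have "(\<lambda>i. \<integral>m. exp (- w * Y i m) \<partial>N) \<longlonglongrightarrow> (\<integral>m. E m \<partial>N)"
    proof (rule integral_dominated_convergence[where w="\<lambda>_. 1"])
      show "AE m in N. (\<lambda>i. exp (- w * Y i m)) \<longlonglongrightarrow> E m"
        using E_lim by (rule AE_I2)
      show "AE m in N. norm (exp (- w * Y i m)) \<le> 1" for i using w Y0 by simp
    qed auto
    then have "(\<lambda>i. exp (- (\<integral>x. ln (1 + w * f i x) \<partial>\<alpha>))) \<longlonglongrightarrow> (\<integral>m. E m \<partial>N)"
      using laplace w by simp
    with L_lim[OF less_imp_le[OF w]] have "L w = (\<integral>m. E m \<partial>N)"
      by (rule LIMSEQ_unique)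
    also have "\<dots> \<le> (\<integral>m. indicator {m \<in> space N. I m < top} m \<partial>N)"
    proof (rule integral_mono_AE)
      show "integrable N E" 
      proof (rule N.integrable_const_bound[where B=1])
        show "AE m in N. norm (E m) \<le> 1" using w by (intro AE_I2) (simp add: E_def)
      qed measurable
      show "AE m in N. E m \<le> indicator {m \<in> space N. I m < top} m"
        using w by (intro AE_I2) (auto simp: E_def indicator_def less_top)
    qed (auto intro!: integrable_real_indicator N.emeasure_finite simp: less_top[symmetric])
    also have "\<dots> = N.prob {m \<in> space N. I m < top}" by simp
    finally show ?thesis .
  qed
  have L1: "(\<lambda>n. L (1 / real (Suc n))) \<longlonglongrightarrow> exp (- (\<integral>x. 0 \<partial>\<alpha>))"
    unfolding L_def
  proof (intro tendsto_exp tendsto_minus integral_dominated_convergence[where w="\<lambda>x. ln (1 + 1 * x)"] int)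
    show "AE x in \<alpha>. (\<lambda>n. ln (1 + 1 / real (Suc n) * x)) \<longlonglongrightarrow> 0"
    proof (rule AE_I2)
      fix x :: real
      have "(\<lambda>n. ln (1 + 1 / real (Suc n) * x)) \<longlonglongrightarrow> ln (1 + 0 * x)"
        by (intro tendsto_intros LIMSEQ_inverse_real_of_nat[unfolded inverse_eq_divide]) simp
      then show "(\<lambda>n. ln (1 + 1 / real (Suc n) * x)) \<longlonglongrightarrow> 0" by simp
    qed
    show "AE x in \<alpha>. norm (ln (1 + 1 / real (Suc n) * x)) \<le> ln (1 + 1 * x)" for n
      using nn
    proof eventually_elim
      case (elim x)
      have "1 / real (Suc n) * x \<le> 1 * x"
        using elim by (intro mult_right_mono) simp_all
      moreover have "0 \<le> 1 / real (Suc n) * x" using elim by simp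
      ultimately show ?case by (auto simp: ln_ge_zero simp del: of_nat_Suc)
    qed
  qed auto
  have "N.prob {m \<in> space N. I m < top} = 1"
  proof (rule antisym)
    have "exp (- (\<integral>x. 0 \<partial>\<alpha>)) \<le> N.prob {m \<in> space N. I m < top}"
      using L_le by (intro LIMSEQ_le_const2[OF L1]) auto
    then show "1 \<le> N.prob {m \<in> space N. I m < top}" by simp
  qed simp
  then have AE_fin: "AE m in N. I m < top"
    by (rule N.AE_prob_1[THEN AE_mp]) auto
  have marg: "distr N borel (\<lambda>m. measure m A) = gamma_law (measure \<alpha> A)" if "A \<in> sets borel" for A
    using N that by (simp add: gamma_random_measure_def)
  \<comment> \<open>A null set of \<open>\<alpha>\<close> carries a Gamma variable with parameter \<open>0\<close>, that is, no mass.\<close>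
  have AE_neg: "AE m in N. measure m {..<0} = 0"
  proof -
    have "AE x in \<alpha>. x \<notin> {..<0}" using nn by eventually_elim auto
    then have "emeasure \<alpha> {..<0} = 0" using AE_iff_measurable[of "{..<0}" \<alpha> "\<lambda>x. x \<notin> {..<0}"]
      sets_eq_imp_space_eq[OF \<alpha>(2)] by auto
    then have "measure \<alpha> {..<0} = 0" by (simp add: measure_def)
    then have "distr N borel (\<lambda>m. measure m {..<0}) = return borel 0"
      using marg[of "{..<0}"] by (simp add: gamma_law_def)
    moreover have "AE y in return borel (0::real). y = 0" by (subst AE_return) auto
    ultimately have "AE y in distr N borel (\<lambda>m. measure m {..<0}). y = 0" by (simp only:)
    then show ?thesis by (subst (asm) AE_distr_iff) auto
  qed
  have AE_pos: "AE m in N. 0 < measure m UNIV"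
  proof -
    have eq: "distr N borel (\<lambda>m. measure m UNIV) = gamma_law c"
      using marg[of UNIV] by (simp add: c_def)
    have "AE y in distr N borel (\<lambda>m. measure m UNIV). 0 < y"
      unfolding eq by (rule AE_gamma_law_pos[OF c])
    then show ?thesis by (subst (asm) AE_distr_iff) auto
  qed
  have AE_main: "AE m in N. 0 \<le> (\<integral>x. x \<partial>normalized m) \<and>
      (\<lambda>i. Y i m / measure m UNIV) \<longlonglongrightarrow> (\<integral>x. x \<partial>normalized m)"
    using AE_fin AE_neg AE_pos AE_space
  proof eventually_elim
    case (elim m)
    then have m: "finite_measure m" "sets m = sets borel" by (auto simp: spN space_finite_measures)
    interpret m: finite_measure m by fact
    have [measurable_cong]: "sets m = sets borel" by fact
    have sp: "space m = UNIV" using sets_eq_imp_space_eq[OF m(2)] by simp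
    have "AE x in m. x \<notin> {..<0}"
      using elim by (intro AE_I[of _ _ "{..<0}"]) (auto simp: m.emeasure_eq_measure m(2))
    then have nnm: "AE x in m. 0 \<le> x" by eventually_elim auto
    have ix: "(\<integral>x. x \<partial>m) = enn2real (I m)"
      unfolding I_def using nnm by (intro integral_eq_nn_integral) auto
    have norm: "(\<integral>x. x \<partial>normalized m) = (\<integral>x. x \<partial>m) / measure m UNIV"
      using elim integral_normalized[OF m(1), of "\<lambda>x. x"] by (simp add: sp)
    have "(\<lambda>i. Y i m) \<longlonglongrightarrow> enn2real (I m)"
      using tendsto_enn2real[OF Y_lim[OF elim(4), THEN tendsto_eq_rhs], of "enn2real (I m)"] Y0 elim(1)
      by (simp add: less_top)
    then show ?case unfolding norm ix using elim(3) by (auto intro!: tendsto_intros)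
  qed
  then show "AE m in N. 0 \<le> (\<integral>x. x \<partial>normalized m)" by eventually_elim simp
  assume w: "0 \<le> w"
  have [measurable]: "(\<lambda>m. \<integral>x. x \<partial>normalized m) \<in> borel_measurable N"
    using measurable_compose[OF measurable_normalized measurable_integral_finite_measures[of "\<lambda>x. x"]]
    by measurable
  have "(\<lambda>i. \<integral>m. (1 + w * (Y i m / measure m UNIV)) powr (- c) \<partial>N)
    \<longlonglongrightarrow> (\<integral>m. (1 + w * (\<integral>x. x \<partial>normalized m)) powr (- c) \<partial>N)"
  proof (rule integral_dominated_convergence[where w="\<lambda>_. 1"])
    show "AE m in N. (\<lambda>i. (1 + w * (Y i m / measure m UNIV)) powr (- c))
        \<longlonglongrightarrow> (1 + w * (\<integral>x. x \<partial>normalized m)) powr (- c)"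
      using AE_main
    proof eventually_elim
      case (elim m)
      then have "1 + w * (\<integral>x. x \<partial>normalized m) \<noteq> 0" using w by (simp add: add_nonneg_eq_0_iff)
      then show ?case using elim by (intro tendsto_intros) auto
    qed
    show "AE m in N. norm ((1 + w * (Y i m / measure m UNIV)) powr (- c)) \<le> 1" for i
    proof (rule AE_I2)
      fix m
      have "0 \<le> w * (Y i m / measure m UNIV)" using w Y0 by simp
      then have "(1 + w * (Y i m / measure m UNIV)) powr (- c) \<le> 1"
        using c powr_mono2'[of "- c" 1 "1 + w * (Y i m / measure m UNIV)"]
        by (simp only: powr_one_eq_one)
      then show "norm ((1 + w * (Y i m / measure m UNIV)) powr (- c)) \<le> 1" by simp
    qed
  qed (auto intro!: measurable_measure_finite_measures)
  then have "(\<lambda>i. exp (- (\<integral>x. ln (1 + w * f i x) \<partial>\<alpha>)))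
      \<longlonglongrightarrow> (\<integral>m. (1 + w * (\<integral>x. x \<partial>normalized m)) powr (- c) \<partial>N)"
    by (simp only: ratio[OF w])
  from LIMSEQ_unique[OF this L_lim[OF w]]
  show "(\<integral>m. (1 + w * (\<integral>x. x \<partial>normalized m)) powr (- measure \<alpha> UNIV) \<partial>N)
      = exp (- (\<integral>x. ln (1 + w * x) \<partial>\<alpha>))"
    by (simp only: c_def L_def)
qed

lemma dirichlet_mean_law_transform:
  assumes \<nu>: "dirichlet_mean_law c Q \<nu>" and c: "0 < c"
    and Q: "prob_space Q" "sets Q = sets borel" and nn: "AE x in Q. 0 \<le> x"
    and int: "\<And>w. 0 \<le> w \<Longrightarrow> integrable Q (\<lambda>x. ln (1 + w * x))"
  shows "AE r in \<nu>. 0 \<le> r"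
    and "0 \<le> w \<Longrightarrow> (\<integral>r. (1 + w * r) powr (- c) \<partial>\<nu>) = exp (- (c * (\<integral>x. ln (1 + w * x) \<partial>Q)))"
proof -
  let ?\<alpha> = "scale_measure (ennreal c) Q"
  interpret Q: prob_space Q by fact
  obtain N where N: "gamma_random_measure ?\<alpha> N"
    and \<nu>_eq: "\<nu> = distr (distr N finite_measures normalized) borel (\<lambda>P. \<integral>x. x \<partial>P)"
    using \<nu> by (auto simp: dirichlet_mean_law_def dirichlet_process_def)
  have sN [measurable_cong]: "sets N = sets finite_measures" using N by (simp add: gamma_random_measure_def)
  have spQ: "space Q = UNIV" using sets_eq_imp_space_eq[OF Q(2)] by simp
  have m1: "normalized \<in> measurable N finite_measures"
    using measurable_normalized by measurable
  have m2: "(\<lambda>P. \<integral>x. x \<partial>P) \<in> borel_measurable finite_measures"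
    by (rule measurable_integral_finite_measures) simp
  have \<nu>': "\<nu> = distr N borel (\<lambda>m. \<integral>x. x \<partial>normalized m)"
    unfolding \<nu>_eq using m1 m2 by (subst distr_distr) (auto simp: comp_def)
  have m3 [measurable]: "(\<lambda>m. \<integral>x. x \<partial>normalized m) \<in> borel_measurable N"
    using measurable_compose[OF m1 m2] .
  have \<alpha>_dens: "?\<alpha> = density Q (\<lambda>_. ennreal c)"
    by (intro measure_eqI) (auto simp: emeasure_density nn_integral_cmult_indicator)
  have \<alpha>: "finite_measure ?\<alpha>" "sets ?\<alpha> = sets borel" "measure ?\<alpha> UNIV = c"
    using c Q(2) Q.prob_space spQ
    by (auto intro!: finite_measureI simp: space_scale_measure ennreal_mult_eq_top_iff measure_def Q.emeasure_space_1[unfolded spQ])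
  have nn': "AE x in ?\<alpha>. 0 \<le> x" unfolding \<alpha>_dens using nn by (subst AE_density) auto
  have int': "integrable ?\<alpha> (\<lambda>x. ln (1 + w * x))" if "0 \<le> w" for w
    unfolding \<alpha>_dens using c int[OF that] Q(2) by (subst integrable_density) auto
  note tr = dirichlet_mean_transform[OF N \<alpha>(1,2) _ nn' int', unfolded \<alpha>(3)]
  show "AE r in \<nu>. 0 \<le> r"
    unfolding \<nu>' using tr(1) c by (subst AE_distr_iff) auto
  assume w: "0 \<le> w"
  have "(\<integral>r. (1 + w * r) powr (- c) \<partial>\<nu>) = exp (- (\<integral>x. ln (1 + w * x) \<partial>?\<alpha>))"
    unfolding \<nu>' using tr(2)[OF c _ w] by (subst integral_distr) auto
  also have "(\<integral>x. ln (1 + w * x) \<partial>?\<alpha>) = c * (\<integral>x. ln (1 + w * x) \<partial>Q)"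
    unfolding \<alpha>_dens using c int[OF w] by (subst integral_density) auto
  finally show "(\<integral>r. (1 + w * r) powr (- c) \<partial>\<nu>) = exp (- (c * (\<integral>x. ln (1 + w * x) \<partial>Q)))" .
qed

section \<open>The exponents of the likelihoods as logarithmic integrals\<close>

lemma sets_F_law [simp, measurable_cong]: "sets (F_law a) = sets borel"
  by (simp add: F_law_def)

lemma space_F_law [simp]: "space (F_law a) = UNIV"
  by (simp add: F_law_def)

lemma integral_F_law:
  fixes g :: "real \<Rightarrow> real"
  assumes a: "0 < a" and [measurable]: "g \<in> borel_measurable borel"
  shows "(LINT u:{exp (- a)..1}|lborel. g u / u) = a * (\<integral>u. g u \<partial>F_law a)"
proof -
  have nn: "0 \<le> indicator {exp (- a)..1} u / (a * u)" for u :: real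
    using a less_le_trans[OF exp_gt_zero[of "- a"], of u] by (auto simp: indicator_def less_imp_le)
  have "(\<integral>u. g u \<partial>F_law a) = (\<integral>u. indicator {exp (- a)..1} u / (a * u) * g u \<partial>lborel)"
    unfolding F_law_def using nn by (subst integral_density) auto
  also have "a * \<dots> = (\<integral>u. a * (indicator {exp (- a)..1} u / (a * u) * g u) \<partial>lborel)"
    by (rule integral_mult_right_zero[symmetric])
  also have "\<dots> = (LINT u:{exp (- a)..1}|lborel. g u / u)"
    unfolding set_lebesgue_integral_def using a by (intro Bochner_Integration.integral_cong) auto
  finally show ?thesis ..
qed

lemma prob_space_F_law:
  assumes a: "0 < a"
  shows "prob_space (F_law a)"
proof (rule prob_spaceI)
  have pos: "0 < u" if "exp (- a) \<le> u" for u :: real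
    using less_le_trans[OF exp_gt_zero that] .
  have "emeasure (F_law a) (space (F_law a)) = (\<integral>\<^sup>+u. ennreal (1 / (a * u)) * indicator {exp (- a)..1} u \<partial>lborel)"
    unfolding F_law_def using a
    by (subst emeasure_density) (auto intro!: nn_integral_cong simp: indicator_def)
  also have "\<dots> = ennreal (ln 1 / a - ln (exp (- a)) / a)"
  proof (rule nn_integral_FTC_Icc)
    show "((\<lambda>u. ln u / a) has_real_derivative 1 / (a * u)) (at u)" if "u \<in> {exp (- a)..1}" for u
      using that pos[of u] a by (auto intro!: derivative_eq_intros)
    show "0 \<le> 1 / (a * u)" if "u \<in> {exp (- a)..1}" for u using that pos[of u] a by simp
  qed (use a in auto)
  finally show "emeasure (F_law a) (space (F_law a)) = 1" using a by simp
qed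

lemma AE_F_law: "AE u in F_law a. 0 \<le> u \<and> u \<le> 1"
proof -
  have "0 \<le> u" if "exp (- a) \<le> u" for u :: real
    using less_le_trans[OF exp_gt_zero that] by simp
  then show ?thesis unfolding F_law_def
    by (subst AE_density) (auto simp: indicator_def split: if_splits)
qed

text \<open>The mixing law \<open>H\<close> of an FGGC subordinator, separated from the process. The last condition says
  that the integral defining \<^const>\<open>psi\<close> is finite.\<close>

locale fggc_mixing =
  fixes H :: "real measure" and a \<theta> :: real
  assumes a_pos: "0 < a" and \<theta>_pos: "0 < \<theta>"
    and prob_H: "prob_space H" and sets_H [measurable_cong]: "sets H = sets borel"
    and H_pos: "AE x in H. 0 < x"
    and H_int: "\<And>w. 0 \<le> w \<Longrightarrow> integrable H (\<lambda>x. ln (1 + w * x))"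
begin

sublocale H: prob_space H by (rule prob_H)
sublocale F: prob_space "F_law a" by (rule prob_space_F_law[OF a_pos])
sublocale FH: pair_prob_space "F_law a" H ..

lemma AE_FH: "AE p in F_law a \<Otimes>\<^sub>M H. 0 \<le> fst p \<and> fst p \<le> 1 \<and> 0 < snd p"
proof (rule FH.AE_pair_measure)
  show "AE u in F_law a. AE x in H. 0 \<le> fst (u, x) \<and> fst (u, x) \<le> 1 \<and> 0 < snd (u, x)"
    using AE_F_law
  proof eventually_elim
    case (elim u)
    show ?case using H_pos by eventually_elim (use elim in auto)
  qed
qed measurable

lemma integrable_ln_dominated:
  fixes f :: "real \<times> real \<Rightarrow> real"
  assumes [measurable]: "f \<in> borel_measurable (F_law a \<Otimes>\<^sub>M H)" and K: "0 \<le> K"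
    and bd: "AE p in F_law a \<Otimes>\<^sub>M H. 0 \<le> f p \<and> f p \<le> K * snd p"
  shows "integrable (F_law a \<Otimes>\<^sub>M H) (\<lambda>p. ln (1 + f p))"
proof (rule Bochner_Integration.integrable_bound)
  show "integrable (F_law a \<Otimes>\<^sub>M H) (\<lambda>p. ln (1 + K * snd p))"
  proof (rule FH.Fubini_integrable)
    show "AE u in F_law a. integrable H (\<lambda>x. ln (1 + K * snd (u, x)))"
      using H_int[OF K] by simp
  qed simp_all
  show "AE p in F_law a \<Otimes>\<^sub>M H. norm (ln (1 + f p)) \<le> norm (ln (1 + K * snd p))"
    using bd by eventually_elim (auto simp: ln_ge_zero)
qed measurable

text \<open>Both \<^const>\<open>Q_law\<close> and \<^const>\<open>Q_cond_law\<close> are laws of functions of \<open>(U, W)\<close> with values between \<open>0\<close>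
  and \<open>W\<close>, so they inherit the integrability of the logarithm from \<open>H\<close>.\<close>

lemma distr_dominated:
  assumes m [measurable]: "g \<in> borel_measurable (F_law a \<Otimes>\<^sub>M H)"
    and bd: "AE p in F_law a \<Otimes>\<^sub>M H. 0 \<le> g p \<and> g p \<le> snd p"
  shows "AE y in distr (F_law a \<Otimes>\<^sub>M H) borel g. 0 \<le> y"
    and "0 \<le> K \<Longrightarrow> integrable (distr (F_law a \<Otimes>\<^sub>M H) borel g) (\<lambda>y. ln (1 + K * y))"
proof -
  show "AE y in distr (F_law a \<Otimes>\<^sub>M H) borel g. 0 \<le> y"
    using bd by (subst AE_distr_iff) auto
  assume K: "0 \<le> K"
  have "AE p in F_law a \<Otimes>\<^sub>M H. 0 \<le> K * g p \<and> K * g p \<le> K * snd p"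
    using bd by eventually_elim (use K in \<open>auto intro: mult_left_mono\<close>)
  then have "integrable (F_law a \<Otimes>\<^sub>M H) (\<lambda>p. ln (1 + K * g p))"
    using K by (intro integrable_ln_dominated) auto
  then show "integrable (distr (F_law a \<Otimes>\<^sub>M H) borel g) (\<lambda>y. ln (1 + K * y))"
    by (subst integrable_distr_eq) auto
qed

text \<open>Fubini's theorem; the bound on \<open>g\<close> makes the logarithm integrable with respect to the product
  measure.\<close>

lemma psi_integral:
  fixes g :: "real \<Rightarrow> real"
  assumes [measurable]: "g \<in> borel_measurable borel" and K: "0 \<le> K"
    and g: "\<And>u. 0 \<le> u \<Longrightarrow> u \<le> 1 \<Longrightarrow> 0 \<le> g u \<and> g u \<le> K"
  shows "(LINT u:{exp (- a)..1}|lborel. psi \<theta> H (g u) / u)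
      = \<theta> * a * (\<integral>p. ln (1 + g (fst p) * snd p) \<partial>(F_law a \<Otimes>\<^sub>M H))"
proof -
  have psi: "psi \<theta> H = (\<lambda>w. \<theta> * (\<integral>x. ln (1 + w * x) \<partial>H))"
    by (simp add: psi_def d_fun_def fun_eq_iff)
  have [measurable]: "(\<lambda>w. \<integral>x. ln (1 + w * x) \<partial>H) \<in> borel_measurable borel"
    by (rule H.borel_measurable_lebesgue_integral) measurable
  have "AE p in F_law a \<Otimes>\<^sub>M H. 0 \<le> g (fst p) * snd p \<and> g (fst p) * snd p \<le> K * snd p"
    using AE_FH by eventually_elim (use g in \<open>auto intro!: mult_nonneg_nonneg mult_right_mono\<close>)
  then have int: "integrable (F_law a \<Otimes>\<^sub>M H) (\<lambda>p. ln (1 + g (fst p) * snd p))"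
    using K by (intro integrable_ln_dominated) auto
  have "(LINT u:{exp (- a)..1}|lborel. psi \<theta> H (g u) / u) = a * (\<integral>u. psi \<theta> H (g u) \<partial>F_law a)"
    using a_pos by (intro integral_F_law) (auto simp: psi)
  also have "\<dots> = a * \<theta> * (\<integral>u. (\<integral>x. ln (1 + g u * x) \<partial>H) \<partial>F_law a)"
    by (simp add: psi)
  also have "(\<integral>u. (\<integral>x. ln (1 + g u * x) \<partial>H) \<partial>F_law a) = (\<integral>p. ln (1 + g (fst p) * snd p) \<partial>(F_law a \<Otimes>\<^sub>M H))"
    using FH.integral_fst'[OF int] by simp
  finally show ?thesis by (simp add: mult_ac)
qed

lemma Phi_eq:
  assumes w: "0 \<le> w"
  shows "Phi a \<theta> H w = \<theta> * a * (\<integral>y. ln (1 + w * y) \<partial>Q_law a H)"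
proof -
  have "Phi a \<theta> H w = \<theta> * a * (\<integral>p. ln (1 + w * (1 - fst p) * snd p) \<partial>(F_law a \<Otimes>\<^sub>M H))"
    unfolding Phi_def using w by (intro psi_integral[where K=w]) (auto simp: mult_left_le)
  also have "(\<integral>p. ln (1 + w * (1 - fst p) * snd p) \<partial>(F_law a \<Otimes>\<^sub>M H)) = (\<integral>y. ln (1 + w * y) \<partial>Q_law a H)"
    unfolding Q_law_def by (subst integral_distr) (auto simp: case_prod_unfold mult.assoc)
  finally show ?thesis .
qed

text \<open>The reason is the factorization \<open>1 + (v u + w (1 - u)) x = (1 + w (1 - u) x) (1 + v r)\<close> with
  \<open>r = u x / (1 + x (1 - u) w)\<close>, whose logarithm is integrated over \<open>(u, x)\<close>.\<close>

lemma Phi_cond_eq: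
  assumes w: "0 \<le> w" and v: "0 \<le> v"
  shows "Phi_cond a \<theta> H w v = Phi a \<theta> H w + \<theta> * a * (\<integral>r. ln (1 + v * r) \<partial>Q_cond_law a H w)"
proof -
  let ?P = "F_law a \<Otimes>\<^sub>M H"
  let ?r = "\<lambda>p. fst p * snd p / (1 + snd p * (1 - fst p) * w)"
  have den: "0 < 1 + snd p * (1 - fst p) * w" if "0 \<le> fst p \<and> fst p \<le> 1 \<and> 0 < snd p" for p :: "real \<times> real"
    using that w by (auto intro!: add_pos_nonneg mult_nonneg_nonneg)
  have r_bd: "0 \<le> ?r p \<and> ?r p \<le> snd p" if "0 \<le> fst p \<and> fst p \<le> 1 \<and> 0 < snd p" for p
  proof
    show "0 \<le> ?r p" using that den[OF that] by simp
    have "fst p * snd p \<le> 1 * snd p" using that by (intro mult_right_mono) auto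
    moreover have "snd p \<le> snd p * (1 + snd p * (1 - fst p) * w)"
      using that w by (simp add: distrib_left)
    ultimately show "?r p \<le> snd p" using den[OF that] by (subst pos_divide_le_eq) auto
  qed
  have b1: "AE p in ?P. 0 \<le> v * ?r p \<and> v * ?r p \<le> v * snd p"
    using AE_FH
  proof eventually_elim
    case (elim p)
    from r_bd[OF elim] show ?case using v by (auto intro!: mult_left_mono simp del: times_divide_eq_right)
  qed
  have b2: "AE p in ?P. 0 \<le> w * (1 - fst p) * snd p \<and> w * (1 - fst p) * snd p \<le> w * snd p"
    using AE_FH
  proof eventually_elim
    case (elim p)
    then show ?case using w by (auto intro!: mult_nonneg_nonneg mult_right_mono simp: mult_left_le)
  qed
  have i1: "integrable ?P (\<lambda>p. ln (1 + v * ?r p))"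
    using v b1 by (intro integrable_ln_dominated[where K=v]) auto
  have i2: "integrable ?P (\<lambda>p. ln (1 + w * (1 - fst p) * snd p))"
    using w b2 by (intro integrable_ln_dominated[where K=w]) auto
  have "Phi_cond a \<theta> H w v = \<theta> * a * (\<integral>p. ln (1 + (v * fst p + w * (1 - fst p)) * snd p) \<partial>?P)"
    unfolding Phi_cond_def
  proof (rule psi_integral[where K="v + w"])
    fix u :: real assume u: "0 \<le> u" "u \<le> 1"
    then show "0 \<le> v * u + w * (1 - u) \<and> v * u + w * (1 - u) \<le> v + w"
      using v w by (auto intro!: add_mono simp: mult_left_le)
  qed (use v w in auto)
  also have "(\<integral>p. ln (1 + (v * fst p + w * (1 - fst p)) * snd p) \<partial>?P)
    = (\<integral>p. ln (1 + w * (1 - fst p) * snd p) + ln (1 + v * ?r p) \<partial>?P)"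
  proof (rule integral_cong_AE)
    show "AE p in ?P. ln (1 + (v * fst p + w * (1 - fst p)) * snd p)
        = ln (1 + w * (1 - fst p) * snd p) + ln (1 + v * ?r p)"
      using AE_FH
    proof eventually_elim
      case (elim p)
      have d: "0 < 1 + w * (1 - fst p) * snd p" using den[OF elim] by (simp add: mult_ac)
      have "0 \<le> v * ?r p" using r_bd[OF elim] v by (intro mult_nonneg_nonneg) auto
      then have p2: "0 < 1 + v * ?r p" by simp
      have "(1 + w * (1 - fst p) * snd p) * (1 + v * ?r p) = 1 + (v * fst p + w * (1 - fst p)) * snd p"
        using d by (simp add: field_simps)
      then show ?case using ln_mult_pos[OF d p2] by simp
    qed
  qed measurable
  also have "\<dots> = (\<integral>p. ln (1 + w * (1 - fst p) * snd p) \<partial>?P) + (\<integral>p. ln (1 + v * ?r p) \<partial>?P)"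
    by (rule Bochner_Integration.integral_add[OF i2 i1])
  also have "(\<integral>p. ln (1 + w * (1 - fst p) * snd p) \<partial>?P) = (\<integral>y. ln (1 + w * y) \<partial>Q_law a H)"
    unfolding Q_law_def by (subst integral_distr) (auto simp: case_prod_unfold mult.assoc)
  also have "(\<integral>p. ln (1 + v * ?r p) \<partial>?P) = (\<integral>r. ln (1 + v * r) \<partial>Q_cond_law a H w)"
    unfolding Q_cond_law_def by (subst integral_distr) (auto simp: case_prod_unfold)
  finally show ?thesis by (simp add: Phi_eq[OF w] distrib_left)
qed

lemma Q_law_mean_transform:
  assumes \<nu>: "dirichlet_mean_law (\<theta> * a) (Q_law a H) \<nu>"
  shows "AE r in \<nu>. 0 \<le> r"
    and "0 \<le> w \<Longrightarrow> (\<integral>r. (1 + w * r) powr (- (\<theta> * a)) \<partial>\<nu>) = exp (- Phi a \<theta> H w)"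
proof -
  have m: "(\<lambda>(u, x). (1 - u) * x) \<in> borel_measurable (F_law a \<Otimes>\<^sub>M H)" by measurable
  have bd: "AE p in F_law a \<Otimes>\<^sub>M H. 0 \<le> (case p of (u, x) \<Rightarrow> (1 - u) * x) \<and> (case p of (u, x) \<Rightarrow> (1 - u) * x) \<le> snd p"
    using AE_FH by eventually_elim (auto intro!: mult_nonneg_nonneg simp: mult_left_le_one_le)
  have Q: "prob_space (Q_law a H)" "sets (Q_law a H) = sets borel"
    unfolding Q_law_def using m by (auto intro!: FH.prob_space_distr)
  note int = distr_dominated[OF m bd, folded Q_law_def]
  have c: "0 < \<theta> * a" using a_pos \<theta>_pos by simp
  note tr = dirichlet_mean_law_transform[OF \<nu> c Q int]
  show "AE r in \<nu>. 0 \<le> r" using tr(1) by simp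
  show "(\<integral>r. (1 + w * r) powr (- (\<theta> * a)) \<partial>\<nu>) = exp (- Phi a \<theta> H w)" if "0 \<le> w"
    using tr(2) that by (simp add: Phi_eq)
qed

lemma Q_cond_law_mean_transform:
  assumes \<nu>: "dirichlet_mean_law (\<theta> * a) (Q_cond_law a H w) \<nu>" and w: "0 \<le> w"
  shows "AE r in \<nu>. 0 \<le> r"
    and "0 \<le> v \<Longrightarrow> (\<integral>r. (1 + v * r) powr (- (\<theta> * a)) \<partial>\<nu>) = exp (Phi a \<theta> H w - Phi_cond a \<theta> H w v)"
proof -
  have m: "(\<lambda>(u, x). u * x / (1 + x * (1 - u) * w)) \<in> borel_measurable (F_law a \<Otimes>\<^sub>M H)" by measurable
  have bd: "AE p in F_law a \<Otimes>\<^sub>M H. 0 \<le> (case p of (u, x) \<Rightarrow> u * x / (1 + x * (1 - u) * w)) \<and>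
      (case p of (u, x) \<Rightarrow> u * x / (1 + x * (1 - u) * w)) \<le> snd p"
    using AE_FH
  proof eventually_elim
    case (elim p)
    obtain u x where p: "p = (u, x)" by (cases p)
    have ux: "0 \<le> u" "u \<le> 1" "0 < x" using elim by (auto simp: p)
    have k: "0 \<le> x * (1 - u) * w" using ux w by (intro mult_nonneg_nonneg) auto
    have "u * x \<le> 1 * x" using ux by (intro mult_right_mono) auto
    moreover have "x \<le> x * (1 + x * (1 - u) * w)" using ux k by (simp add: distrib_left)
    ultimately show ?case using ux k by (auto simp: p pos_divide_le_eq)
  qed
  have Q: "prob_space (Q_cond_law a H w)" "sets (Q_cond_law a H w) = sets borel"
    unfolding Q_cond_law_def using m by (auto intro!: FH.prob_space_distr)
  note int = distr_dominated[OF m bd, folded Q_cond_law_def]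
  have c: "0 < \<theta> * a" using a_pos \<theta>_pos by simp
  note tr = dirichlet_mean_law_transform[OF \<nu> c Q int]
  show "AE r in \<nu>. 0 \<le> r" using tr(1) by simp
  show "(\<integral>r. (1 + v * r) powr (- (\<theta> * a)) \<partial>\<nu>) = exp (Phi a \<theta> H w - Phi_cond a \<theta> H w v)" if "0 \<le> v"
    using tr(2) that w by (simp add: Phi_cond_eq)
qed

end

text \<open>Conditionally on the other factor, the Laplace transform of the Gamma variable is evaluated at a
  nonnegative argument.\<close>

lemma (in prob_space) gamma_product_laplace:
  assumes ind: "indep_var borel T borel X" and T: "distr M borel T = gamma_law c"
    and c: "0 \<le> c" and X: "AE x in M. 0 \<le> X x" and w: "0 \<le> w"
  shows "(\<integral>x. exp (- w * (T x * X x)) \<partial>M) = (\<integral>x. (1 + w * X x) powr (- c) \<partial>M)"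
proof -
  have [measurable]: "T \<in> borel_measurable M" "X \<in> borel_measurable M"
    using ind by (auto dest: indep_var_rv1 indep_var_rv2)
  interpret D: prob_space "distr M borel X" by (rule prob_space_distr) simp
  interpret G: prob_space "gamma_law c" using c by (rule prob_space_gamma_law)
  interpret P: pair_sigma_finite "gamma_law c" "distr M borel X" ..
  have eq: "gamma_law c \<Otimes>\<^sub>M distr M borel X = distr M (borel \<Otimes>\<^sub>M borel) (\<lambda>x. (T x, X x))"
    using ind by (simp add: indep_var_distribution_eq T)
  have "(\<integral>\<^sup>+x. ennreal (exp (- w * (T x * X x))) \<partial>M)
      = (\<integral>\<^sup>+p. ennreal (exp (- w * (fst p * snd p))) \<partial>distr M (borel \<Otimes>\<^sub>M borel) (\<lambda>x. (T x, X x)))"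
    by (subst nn_integral_distr) auto
  also have "\<dots> = (\<integral>\<^sup>+r. (\<integral>\<^sup>+t. ennreal (exp (- w * (t * r))) \<partial>gamma_law c) \<partial>distr M borel X)"
    unfolding eq[symmetric] by (subst P.nn_integral_snd[symmetric]) auto
  also have "\<dots> = (\<integral>\<^sup>+r. ennreal ((1 + w * r) powr (- c)) \<partial>distr M borel X)"
  proof (rule nn_integral_cong_AE)
    have "AE r in distr M borel X. 0 \<le> r" using X by (subst AE_distr_iff) auto
    then show "AE r in distr M borel X.
        (\<integral>\<^sup>+t. ennreal (exp (- w * (t * r))) \<partial>gamma_law c) = ennreal ((1 + w * r) powr (- c))"
    proof eventually_elim
      case (elim r)
      then show ?case using gamma_law_laplace[OF c, of "w * r"] w by (simp add: mult_ac)
    qed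
  qed
  also have "\<dots> = (\<integral>\<^sup>+x. ennreal ((1 + w * X x) powr (- c)) \<partial>M)"
    by (subst nn_integral_distr) auto
  finally show ?thesis by (subst (1 2) integral_eq_nn_integral) auto
qed

section \<open>Mixtures over Gamma variables and joint densities\<close>

text \<open>The many-variable form of the previous computation: the coordinates in \<open>K\<close> are Gamma variables,
  the one at \<open>k\<close> multiplying the coordinate \<open>m k\<close> in \<open>J\<close>. The factor \<open>F\<close> is any measurable
  function of the coordinates in \<open>J\<close>, so that the formula determines the image measure on \<open>J\<close> and not only its total mass.\<close>

lemma nn_integral_gamma_mixture:
  fixes D :: "'i \<Rightarrow> real measure" and \<gamma> b :: "'i \<Rightarrow> real" and m :: "'i \<Rightarrow> 'i"
  assumes fin: "finite J" "finite K" and dis: "J \<inter> K = {}"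
    and D: "\<And>c. prob_space (D c)" "\<And>c. sets (D c) = sets borel"
    and DK: "\<And>k. k \<in> K \<Longrightarrow> D k = gamma_law (\<gamma> k) \<and> 0 \<le> \<gamma> k \<and> 0 \<le> b k \<and> m k \<in> J"
    and Dm: "\<And>k. k \<in> K \<Longrightarrow> AE r in D (m k). 0 \<le> r"
    and F [measurable]: "F \<in> borel_measurable (PiM J (\<lambda>_. borel))"
  shows "(\<integral>\<^sup>+z. F (restrict z J) * (\<Prod>k\<in>K. ennreal (exp (- b k * z k * z (m k)))) \<partial>PiM (J \<union> K) D)
    = (\<integral>\<^sup>+x. F x * (\<Prod>k\<in>K. ennreal ((1 + b k * x (m k)) powr (- \<gamma> k))) \<partial>PiM J D)"
proof -
  interpret product_sigma_finite D
    using D(1) by (auto simp: product_sigma_finite_def intro!: prob_space_imp_sigma_finite)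
  have sD [measurable_cong]: "sets (PiM I D) = sets (PiM I (\<lambda>_. borel))" for I
    by (intro sets_PiM_cong) (auto simp: D(2))
  have mk [measurable]: "m k \<in> J" "m k \<in> J \<union> K" "k \<in> J \<union> K" if "k \<in> K" for k using DK[OF that] that by auto
  have [measurable]: "(\<lambda>z. restrict z J) \<in> measurable (PiM (J \<union> K) (\<lambda>_. borel)) (PiM J (\<lambda>_. borel))"
    by (rule measurable_restrict_subset) auto
  have "(\<integral>\<^sup>+z. F (restrict z J) * (\<Prod>k\<in>K. ennreal (exp (- b k * z k * z (m k)))) \<partial>PiM (J \<union> K) D)
    = (\<integral>\<^sup>+x. (\<integral>\<^sup>+t. F (restrict (merge J K (x, t)) J) * (\<Prod>k\<in>K. ennreal (exp (- b k * merge J K (x, t) k * merge J K (x, t) (m k)))) \<partial>PiM K D) \<partial>PiM J D)"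
    using dis fin by (intro product_nn_integral_fold) measurable
  also have "\<dots> = (\<integral>\<^sup>+x. F x * (\<Prod>k\<in>K. ennreal ((1 + b k * x (m k)) powr (- \<gamma> k))) \<partial>PiM J D)"
  proof (rule nn_integral_cong_AE)
    have "AE x in PiM J D. \<forall>k\<in>K. 0 \<le> x (m k)"
      using fin D(1) DK Dm by (intro AE_finite_allI AE_PiM_component[where P="\<lambda>x. 0 \<le> x"]) auto
    then show "AE x in PiM J D. (\<integral>\<^sup>+t. F (restrict (merge J K (x, t)) J) * (\<Prod>k\<in>K. ennreal (exp (- b k * merge J K (x, t) k * merge J K (x, t) (m k)))) \<partial>PiM K D)
      = F x * (\<Prod>k\<in>K. ennreal ((1 + b k * x (m k)) powr (- \<gamma> k)))"
      using AE_space
    proof eventually_elim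
      case (elim x)
      have x: "restrict (merge J K (x, t)) J = x" for t
        using elim(2) by (auto simp: space_PiM PiE_def extensional_def merge_def restrict_def fun_eq_iff)
      have "(\<integral>\<^sup>+t. F (restrict (merge J K (x, t)) J) * (\<Prod>k\<in>K. ennreal (exp (- b k * merge J K (x, t) k * merge J K (x, t) (m k)))) \<partial>PiM K D)
        = (\<integral>\<^sup>+t. F x * (\<Prod>k\<in>K. ennreal (exp (- (b k * x (m k)) * t k))) \<partial>PiM K D)"
        unfolding x using dis mk(1)
        by (intro nn_integral_cong arg_cong2[where f="(*)"] refl prod.cong arg_cong[where f=ennreal]) (auto simp: merge_def mult_ac)
      also have "\<dots> = F x * (\<integral>\<^sup>+t. (\<Prod>k\<in>K. ennreal (exp (- (b k * x (m k)) * t k))) \<partial>PiM K D)"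
        by (rule nn_integral_cmult) measurable
      also have "(\<integral>\<^sup>+t. (\<Prod>k\<in>K. ennreal (exp (- (b k * x (m k)) * t k))) \<partial>PiM K D)
        = (\<Prod>k\<in>K. \<integral>\<^sup>+t. ennreal (exp (- (b k * x (m k)) * t)) \<partial>D k)"
        using fin D(2) by (intro product_nn_integral_prod) (auto simp: measurable_cong_sets[OF D(2) refl])
      also have "\<dots> = (\<Prod>k\<in>K. ennreal ((1 + b k * x (m k)) powr (- \<gamma> k)))"
      proof (rule prod.cong[OF refl])
        fix k assume k: "k \<in> K"
        then show "(\<integral>\<^sup>+t. ennreal (exp (- (b k * x (m k)) * t)) \<partial>D k) = ennreal ((1 + b k * x (m k)) powr (- \<gamma> k))"
          using DK[OF k] elim(1) gamma_law_laplace[of "\<gamma> k" "b k * x (m k)"] by simp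
      qed
      finally show ?case .
    qed
  qed
  finally show ?thesis .
qed

text \<open>The normalizing constant depends only on \<open>L\<close>. Different integral representations of the same
  likelihood therefore lead to joint densities with the same constant.\<close>

lemma probability_density_augmented:
  fixes q :: "'a \<Rightarrow> 'b \<Rightarrow> real" and L :: "'b \<Rightarrow> real"
  assumes M: "sigma_finite_measure M" and N: "sigma_finite_measure N" and N0: "emeasure N (space N) \<noteq> 0"
    and q [measurable]: "(\<lambda>(z, y). q z y) \<in> borel_measurable (M \<Otimes>\<^sub>M N)"
    and q0: "\<And>z y. z \<in> space M \<Longrightarrow> y \<in> space N \<Longrightarrow> 0 \<le> q z y"
    and q_int: "\<And>y. y \<in> space N \<Longrightarrow> (\<integral>\<^sup>+z. ennreal (q z y) \<partial>M) = ennreal (L y)"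
    and L_pos: "\<And>y. 0 < L y" and L_fin: "(\<integral>\<^sup>+y. ennreal (L y) \<partial>N) < \<infinity>"
  defines "C \<equiv> 1 / enn2real (\<integral>\<^sup>+y. ennreal (L y) \<partial>N)"
  shows "0 < C" and "probability_density (M \<Otimes>\<^sub>M N) (\<lambda>(z, y). C * q z y)"
proof -
  interpret pair_sigma_finite M N using M N by (rule pair_sigma_finite.intro)
  have "(\<lambda>y. \<integral>\<^sup>+z. ennreal (q z y) \<partial>M) \<in> borel_measurable N"
    by measurable
  then have L_meas: "(\<lambda>y. ennreal (L y)) \<in> borel_measurable N"
    by (rule measurable_cong[THEN iffD1, rotated]) (rule q_int)
  have ne: "(\<integral>\<^sup>+y. ennreal (L y) \<partial>N) \<noteq> 0"
  proof
    assume "(\<integral>\<^sup>+y. ennreal (L y) \<partial>N) = 0"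
    then have "AE y in N. ennreal (L y) = 0" using L_meas by (simp add: nn_integral_0_iff_AE)
    then have "AE y in N. False" using L_pos by (simp add: ennreal_eq_0_iff not_le[symmetric])
    then show False using N0 by (simp add: AE_iff_measurable[OF sets.top])
  qed
  have fin: "(\<integral>\<^sup>+y. ennreal (L y) \<partial>N) = ennreal (enn2real (\<integral>\<^sup>+y. ennreal (L y) \<partial>N))"
    using L_fin by (simp add: less_top)
  show C: "0 < C" using ne L_fin by (simp add: C_def enn2real_positive_iff zero_less_iff_neq_zero)
  have "(\<integral>\<^sup>+p. ennreal (C * q (fst p) (snd p)) \<partial>(M \<Otimes>\<^sub>M N)) = (\<integral>\<^sup>+y. (\<integral>\<^sup>+z. ennreal (C * q z y) \<partial>M) \<partial>N)"
    by (subst nn_integral_snd[symmetric]) auto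
  also have "\<dots> = (\<integral>\<^sup>+y. ennreal C * ennreal (L y) \<partial>N)"
  proof (rule nn_integral_cong)
    fix y assume y: "y \<in> space N"
    have "(\<integral>\<^sup>+z. ennreal (C * q z y) \<partial>M) = (\<integral>\<^sup>+z. ennreal C * ennreal (q z y) \<partial>M)"
      using C q0[OF _ y] by (intro nn_integral_cong) (simp add: ennreal_mult)
    also have "\<dots> = ennreal C * ennreal (L y)"
      using y q_int[OF y] by (subst nn_integral_cmult) auto
    finally show "(\<integral>\<^sup>+z. ennreal (C * q z y) \<partial>M) = ennreal C * ennreal (L y)" .
  qed
  also have "\<dots> = ennreal C * (\<integral>\<^sup>+y. ennreal (L y) \<partial>N)"
    using L_meas by (rule nn_integral_cmult)
  also have "\<dots> = 1"
    using C by (subst fin) (simp add: C_def ennreal_mult[symmetric])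
  finally show "probability_density (M \<Otimes>\<^sub>M N) (\<lambda>(z, y). C * q z y)"
    using C q0 by (auto simp: probability_density_def case_prod_unfold space_pair_measure less_imp_le)
qed

lemma nn_integral_pair_eqI:
  assumes N: "sigma_finite_measure N" and M: "sigma_finite_measure M" "sigma_finite_measure M'"
    and f [measurable]: "f \<in> borel_measurable (M \<Otimes>\<^sub>M N)" and g [measurable]: "g \<in> borel_measurable (M' \<Otimes>\<^sub>M N)"
    and eq: "\<And>y. y \<in> space N \<Longrightarrow> (\<integral>\<^sup>+x. f (x, y) \<partial>M) = (\<integral>\<^sup>+x. g (x, y) \<partial>M')"
  shows "(\<integral>\<^sup>+p. f p \<partial>(M \<Otimes>\<^sub>M N)) = (\<integral>\<^sup>+p. g p \<partial>(M' \<Otimes>\<^sub>M N))"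
proof -
  interpret P: pair_sigma_finite M N using M N by (intro pair_sigma_finite.intro)
  interpret P': pair_sigma_finite M' N using M N by (intro pair_sigma_finite.intro)
  show ?thesis
    unfolding P.nn_integral_snd[OF f, symmetric] P'.nn_integral_snd[OF g, symmetric]
    by (rule nn_integral_cong) (rule eq)
qed

lemma distr_density_eqI:
  assumes f [measurable]: "f \<in> measurable M N" and g [measurable]: "g \<in> borel_measurable M"
    and h [measurable]: "h \<in> borel_measurable N"
    and eq: "\<And>A. A \<in> sets N \<Longrightarrow> (\<integral>\<^sup>+p. g p * indicator A (f p) \<partial>M) = (\<integral>\<^sup>+q. h q * indicator A q \<partial>N)"
  shows "distr (density M g) N f = density N h"
proof (rule measure_eqI)
  fix A assume "A \<in> sets (distr (density M g) N f)"
  then have A [measurable]: "A \<in> sets N" by simp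
  have f': "f \<in> measurable (density M g) N" by measurable
  have "emeasure (distr (density M g) N f) A = (\<integral>\<^sup>+q. indicator A q \<partial>distr (density M g) N f)"
    by (subst nn_integral_indicator) auto
  also have "\<dots> = (\<integral>\<^sup>+p. indicator A (f p) \<partial>density M g)"
    using f' by (subst nn_integral_distr) auto
  also have "\<dots> = (\<integral>\<^sup>+p. g p * indicator A (f p) \<partial>M)"
    by (subst nn_integral_density) auto
  also have "\<dots> = emeasure (density N h) A"
    by (subst eq[OF A]) (simp add: emeasure_density)
  finally show "emeasure (distr (density M g) N f) A = emeasure (density N h) A" .
qed simp

lemma measurable_section_fst:
  "f \<in> borel_measurable (M \<Otimes>\<^sub>M N) \<Longrightarrow> y \<in> space N \<Longrightarrow> (\<lambda>z. f (z, y)) \<in> borel_measurable M"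
  using measurable_compose[OF measurable_Pair2'] .

lemma has_densityD:
  assumes "has_density M N X f"
  shows "X \<in> measurable M N" "f \<in> borel_measurable N" "\<And>x. x \<in> space N \<Longrightarrow> 0 \<le> f x"
    "density N (\<lambda>x. ennreal (f x)) = distr M N X"
proof -
  show nn: "0 \<le> f x" if "x \<in> space N" for x
    using assms that by (simp add: has_density_def)
  show "X \<in> measurable M N" "density N (\<lambda>x. ennreal (f x)) = distr M N X"
    using assms by (auto simp: has_density_def distributed_def)
  have "(\<lambda>x. enn2real (ennreal (f x))) \<in> borel_measurable N"
    using assms by (auto simp: has_density_def distributed_def)
  then show "f \<in> borel_measurable N"
    by (rule measurable_cong[THEN iffD1, rotated]) (simp add: nn)
qed

section \<open>Coordinates, coefficients and kernels\<close>

lemma sets_leb_coord [measurable_cong]: "sets (leb_coord I) = sets (PiM I (\<lambda>_. borel))"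
  unfolding leb_coord_def by (intro sets_PiM_cong) auto

lemma sigma_finite_leb_coord: "finite I \<Longrightarrow> sigma_finite_measure (leb_coord I)"
  unfolding leb_coord_def
  by (intro product_sigma_finite.sigma_finite)
     (auto simp: product_sigma_finite_def intro: sigma_finite_lborel)

lemma leb_pos_component [measurable]:
  "i \<in> {1..n} \<Longrightarrow> (\<lambda>y. y i) \<in> borel_measurable (leb_pos n)"
  unfolding leb_pos_def
  by (rule measurable_compose[OF measurable_component_singleton]) (auto intro: measurable_restrict_space1)

lemma sigma_finite_half_line: "sigma_finite_measure (restrict_space lborel {0::real..})"
  by (rule sigma_finite_measure_restrict_space) (auto intro: sigma_finite_lborel)

lemma sigma_finite_leb_pos: "sigma_finite_measure (leb_pos n)"
  unfolding leb_pos_def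
  by (intro product_sigma_finite.sigma_finite)
     (auto simp: product_sigma_finite_def intro: sigma_finite_half_line)

lemma emeasure_leb_pos: "emeasure (leb_pos n) (space (leb_pos n)) \<noteq> 0"
proof -
  interpret product_sigma_finite "\<lambda>_::nat. restrict_space lborel {0::real..}"
    by (auto simp: product_sigma_finite_def intro: sigma_finite_half_line)
  have half: "emeasure (restrict_space lborel {0::real..}) {0..} \<noteq> 0"
    using emeasure_mono[of "{0..1::real}" "{0..}" lborel] by (auto simp: emeasure_restrict_space)
  have "emeasure (leb_pos n) (space (leb_pos n)) = (\<Prod>i\<in>{1..n}. emeasure (restrict_space lborel {0::real..}) {0..})"
    unfolding leb_pos_def space_PiM by (subst emeasure_PiM) (auto simp: space_restrict_space sets_restrict_space)
  with half show ?thesis by simp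
qed

lemma om_nonneg: "0 \<le> om \<beta> y i"
  by (simp add: om_def)

lemma measurable_om [measurable]: "i \<in> {1..n} \<Longrightarrow> (\<lambda>y. om \<beta> y i) \<in> borel_measurable (leb_pos n)"
  unfolding om_def by measurable

lemma s_coef_nonneg: "0 \<le> a \<Longrightarrow> 0 \<le> s_coef a \<beta> n y l"
  unfolding s_coef_def by (intro mult_nonneg_nonneg sum_nonneg) (auto simp: om_nonneg)

lemma v_coef_nonneg: "0 \<le> a \<Longrightarrow> 0 \<le> v_coef a \<beta> n y i"
  unfolding v_coef_def by (intro mult_nonneg_nonneg s_coef_nonneg) auto

lemma measurable_s_coef [measurable]: "1 \<le> l \<Longrightarrow> (\<lambda>y. s_coef a \<beta> n y l) \<in> borel_measurable (leb_pos n)"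
  unfolding s_coef_def by (intro borel_measurable_times borel_measurable_sum borel_measurable_const measurable_om) auto

lemma measurable_v_coef [measurable]: "(\<lambda>y. v_coef a \<beta> n y i) \<in> borel_measurable (leb_pos n)"
  unfolding v_coef_def by (intro borel_measurable_times borel_measurable_const measurable_s_coef) simp

lemma v_coef_last: "v_coef a \<beta> n y n = 0"
  by (simp add: v_coef_def s_coef_def)

lemma finite_idx [simp]: "finite (idx_Xi1 n)" "finite (idx_Xi2 n)" "finite (idx_split n)" "finite (idx_means n)"
  by (auto simp: idx_Xi1_def idx_Xi2_def idx_split_def idx_means_def)

definition gamma_idx :: "nat \<Rightarrow> coord set" where
  "gamma_idx n = TC ` {1..n} \<union> GC ` {1..n}"

text \<open>In the exponent of the kernel a Gamma coordinate \<open>c\<close> occurs in the term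
  \<open>rate c * z c * z (mean_of c)\<close>. The default equations cover \<open>TV\<close>, the Gamma factor of \<open>v(0)\<close>.\<close>

fun mean_of :: "coord \<Rightarrow> coord" where
  "mean_of (TC i) = MC i"
| "mean_of (GC i) = RC i"
| "mean_of _ = MV"

fun rate :: "real \<Rightarrow> real \<Rightarrow> nat \<Rightarrow> (nat \<Rightarrow> real) \<Rightarrow> coord \<Rightarrow> real" where
  "rate a \<beta> n y (TC i) = om \<beta> y i"
| "rate a \<beta> n y (GC i) = v_coef a \<beta> n y i"
| "rate a \<beta> n y _ = s_coef a \<beta> n y 1"

lemma rate_nonneg: "0 \<le> a \<Longrightarrow> 0 \<le> rate a \<beta> n y c"
  by (cases c) (auto simp: om_nonneg s_coef_nonneg v_coef_nonneg)

lemma finite_gamma_idx [simp]: "finite (gamma_idx n)"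
  by (simp add: gamma_idx_def)

lemma inj_on_mean_of: "inj_on mean_of (gamma_idx n)"
  by (auto simp: gamma_idx_def inj_on_def)

lemma prod_TC_GC:
  fixes f :: "coord \<Rightarrow> 'b::comm_monoid_mult"
  shows "(\<Prod>c\<in>gamma_idx n. f c) = (\<Prod>i=1..n. f (TC i)) * (\<Prod>i=1..n. f (GC i))"
  unfolding gamma_idx_def
  by (subst prod.union_disjoint) (auto simp: prod.reindex inj_on_def)

lemma prod_idx_means:
  fixes f :: "coord \<Rightarrow> 'b::comm_monoid_mult"
  shows "(\<Prod>c\<in>idx_means n. f c) = f MV * (\<Prod>i=1..n. f (MC i)) * (\<Prod>i=1..n. f (RC i))"
proof -
  have "(\<Prod>c\<in>MC ` {1..n} \<union> RC ` {1..n}. f c) = (\<Prod>i=1..n. f (MC i)) * (\<Prod>i=1..n. f (RC i))"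
    by (subst prod.union_disjoint) (auto simp: prod.reindex inj_on_def)
  then show ?thesis
    unfolding idx_means_def Un_assoc
    by (subst prod.union_disjoint, simp, simp, force) (simp add: mult_ac)
qed

lemma idx_Xi1_eq: "idx_Xi1 n = insert V (mean_of ` gamma_idx n) \<union> gamma_idx n"
  by (auto simp: idx_Xi1_def gamma_idx_def image_Un image_image)

lemma idx_Xi2_eq: "idx_Xi2 n = insert V (mean_of ` TC ` {1..n}) \<union> TC ` {1..n}"
  by (auto simp: idx_Xi2_def image_image)

lemma idx_split_eq: "idx_split n = idx_means n \<union> insert TV (gamma_idx n)"
  by (auto simp: idx_split_def idx_means_def gamma_idx_def)

lemma kernel1_prod:
  "ennreal (kernel1 a \<beta> n z y) = ennreal (exp (- s_coef a \<beta> n y 1 * z V)) *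
     (\<Prod>k\<in>gamma_idx n. ennreal (exp (- rate a \<beta> n y k * z k * z (mean_of k))))"
  unfolding kernel1_def prod_TC_GC
  by (simp add: ennreal_mult prod_nonneg prod_ennreal mult.assoc)

lemma kernel2_prod:
  "ennreal (kernel2 a \<beta> n z y) = ennreal (exp (- s_coef a \<beta> n y 1 * z V)) *
     (\<Prod>k\<in>TC ` {1..n}. ennreal (exp (- rate a \<beta> n y k * z k * z (mean_of k))))"
  unfolding kernel2_def
  by (simp add: ennreal_mult prod_nonneg prod_ennreal prod.reindex inj_on_def)

lemma measurable_leb_coord_fst [measurable]:
  "c \<in> I \<Longrightarrow> (\<lambda>p. fst p c) \<in> borel_measurable (leb_coord I \<Otimes>\<^sub>M N)"
  by measurable

lemma measurable_kernel2_superset: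
  assumes I: "idx_Xi2 n \<subseteq> I"
  shows "(\<lambda>p. kernel2 a \<beta> n (fst p) (snd p)) \<in> borel_measurable (leb_coord I \<Otimes>\<^sub>M leb_pos n)"
proof -
  have [measurable]: "(\<lambda>p. fst p V) \<in> borel_measurable (leb_coord I \<Otimes>\<^sub>M leb_pos n)"
    using I by (intro measurable_leb_coord_fst) (auto simp: idx_Xi2_def)
  have [measurable]: "(\<lambda>p. fst p (TC i)) \<in> borel_measurable (leb_coord I \<Otimes>\<^sub>M leb_pos n)"
    "(\<lambda>p. fst p (MC i)) \<in> borel_measurable (leb_coord I \<Otimes>\<^sub>M leb_pos n)"
    "(\<lambda>p. om \<beta> (snd p) i) \<in> borel_measurable (leb_coord I \<Otimes>\<^sub>M leb_pos n)" if "i \<in> {1..n}" for i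
    using that I by (auto intro!: measurable_leb_coord_fst measurable_compose[OF measurable_snd measurable_om] simp: idx_Xi2_def)
  have [measurable]: "(\<lambda>p. s_coef a \<beta> n (snd p) 1) \<in> borel_measurable (leb_coord I \<Otimes>\<^sub>M leb_pos n)"
    by (auto intro!: measurable_compose[OF measurable_snd measurable_s_coef])
  show ?thesis
    unfolding kernel2_def
    by (intro borel_measurable_times borel_measurable_prod measurable_compose[OF _ borel_measurable_exp] borel_measurable_uminus) measurable
qed

lemmas measurable_kernel2 = measurable_kernel2_superset[OF order_refl]

lemma measurable_kernel1:
  "(\<lambda>p. kernel1 a \<beta> n (fst p) (snd p)) \<in> borel_measurable (leb_coord (idx_Xi1 n) \<Otimes>\<^sub>M leb_pos n)"
proof -
  have eq: "kernel1 a \<beta> n z y = kernel2 a \<beta> n z y * (\<Prod>i=1..n. exp (- v_coef a \<beta> n y i * z (GC i) * z (RC i)))" for z y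
    by (simp add: kernel1_def kernel2_def)
  have [measurable]: "(\<lambda>p. kernel2 a \<beta> n (fst p) (snd p)) \<in> borel_measurable (leb_coord (idx_Xi1 n) \<Otimes>\<^sub>M leb_pos n)"
    by (rule measurable_kernel2_superset) (auto simp: idx_Xi1_def idx_Xi2_def)
  have [measurable]: "(\<lambda>p. fst p (GC i)) \<in> borel_measurable (leb_coord (idx_Xi1 n) \<Otimes>\<^sub>M leb_pos n)"
    "(\<lambda>p. fst p (RC i)) \<in> borel_measurable (leb_coord (idx_Xi1 n) \<Otimes>\<^sub>M leb_pos n)" if "i \<in> {1..n}" for i
    using that by (auto intro!: measurable_leb_coord_fst simp: idx_Xi1_def)
  have [measurable]: "(\<lambda>p. v_coef a \<beta> n (snd p) i) \<in> borel_measurable (leb_coord (idx_Xi1 n) \<Otimes>\<^sub>M leb_pos n)" for i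
    by (rule measurable_compose[OF measurable_snd measurable_v_coef])
  show ?thesis
    unfolding eq
    by (intro borel_measurable_times borel_measurable_prod measurable_compose[OF _ borel_measurable_exp] borel_measurable_uminus) measurable
qed

lemma kernel_nonneg: "0 \<le> kernel1 a \<beta> n z y" "0 \<le> kernel2 a \<beta> n z y"
  by (auto simp: kernel1_def kernel2_def intro!: mult_nonneg_nonneg prod_nonneg)

lemma L_pos: "0 < L1 \<phi> a \<theta> H \<beta> n y" "0 < L2 \<phi> a \<theta> H \<beta> n y"
  by (auto simp: L1_def L2_def intro!: mult_pos_pos prod_pos)

lemma measurable_collapse: "collapse n \<in> measurable (leb_coord (idx_split n)) (leb_coord (idx_Xi1 n))"
proof -
  have "(\<lambda>z :: coord \<Rightarrow> real. \<lambda>c\<in>idx_Xi1 n. if c = V then z TV * z MV else z c)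
      \<in> measurable (PiM (idx_split n) (\<lambda>_. borel)) (PiM (idx_Xi1 n) (\<lambda>_. borel))"
  proof (rule measurable_restrict)
    fix c assume "c \<in> idx_Xi1 n"
    then show "(\<lambda>z :: coord \<Rightarrow> real. if c = V then z TV * z MV else z c) \<in> borel_measurable (PiM (idx_split n) (\<lambda>_. borel))"
      by (cases "c = V") (auto intro!: borel_measurable_times measurable_component_singleton simp: idx_Xi1_def idx_split_def)
  qed
  then show ?thesis
    unfolding collapse_def[abs_def] by (simp only: measurable_cong_sets[OF sets_leb_coord sets_leb_coord])
qed

lemma kernel1_collapse_prod:
  "ennreal (kernel1 a \<beta> n (collapse n z) y)
    = (\<Prod>k\<in>insert TV (gamma_idx n). ennreal (exp (- rate a \<beta> n y k * z k * z (mean_of k))))"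
proof -
  have V: "collapse n z V = z TV * z MV" by (simp add: collapse_def idx_Xi1_def)
  have other: "collapse n z k = z k" "collapse n z (mean_of k) = z (mean_of k)" if "k \<in> gamma_idx n" for k
    using that by (auto simp: collapse_def idx_Xi1_def gamma_idx_def)
  have "TV \<notin> gamma_idx n" by (auto simp: gamma_idx_def)
  then show ?thesis
    unfolding kernel1_prod V by (simp add: other mult.assoc)
qed

section \<open>Integral representations of the likelihoods\<close>

text \<open>The hypotheses under which the representations of the likelihoods hold.\<close>

locale ou_augmentation =
  fixes \<Omega> :: "'a measure" and Z v :: "real \<Rightarrow> 'a \<Rightarrow> real" and H :: "real measure"
    and lam \<Delta> a \<theta> \<beta> :: real and n :: nat
    and T M G :: "nat \<Rightarrow> 'a \<Rightarrow> real" and R :: "nat \<Rightarrow> real \<Rightarrow> 'a \<Rightarrow> real"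
    and \<phi> :: "real \<Rightarrow> real"
  assumes pos: "0 < lam" "0 < \<Delta>" "0 < \<theta>" "1 \<le> n"
    and a: "a = lam * \<Delta>"
    and model: "ou_model \<Omega> lam \<theta> H Z v"
    and phi: "\<phi> = levy_exponent \<Omega> (v 0)"
    and law_T: "\<And>i. i \<in> {1..n} \<Longrightarrow> distr \<Omega> borel (T i) = gamma_law (\<theta> * a)"
    and law_M: "\<And>i. i \<in> {1..n} \<Longrightarrow>
      dirichlet_mean_law (\<theta> * a) (Q_law a H) (distr \<Omega> borel (M i))"
    and law_G: "\<And>i. i \<in> {1..n} \<Longrightarrow> distr \<Omega> borel (G i) = gamma_law (\<theta> * a)"
    and law_R: "\<And>i y. i \<in> {1..n} \<Longrightarrow> y \<in> space (leb_pos n) \<Longrightarrow>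
      dirichlet_mean_law (\<theta> * a) (Q_cond_law a H (om \<beta> y i)) (distr \<Omega> borel (R i (om \<beta> y i)))"
    and indep: "\<And>y. y \<in> space (leb_pos n) \<Longrightarrow>
      prob_space.indep_vars \<Omega> (\<lambda>_. borel) (Xi (v 0) T M G R (om \<beta> y)) (idx_Xi1 n)"
begin

lemma a_gt_0: "0 < a"
  using pos a by simp

lemma driving_FGGC: "FGGC \<Omega> \<theta> H Z"
  using model unfolding ou_model_def by blast

lemma prob_\<Omega>: "prob_space \<Omega>"
  using driving_FGGC by (simp add: FGGC_def subordinator_def)

sublocale \<Omega>: prob_space \<Omega> by (rule prob_\<Omega>)

sublocale mix: fggc_mixing H a \<theta>
proof (rule fggc_mixing.intro)
  show "prob_space H" "sets H = sets borel" "AE x in H. 0 < x"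
    using driving_FGGC by (auto simp: FGGC_def)
  show "integrable H (\<lambda>x. ln (1 + w * x))" if "0 \<le> w" for w
  proof -
    have "integrable H (\<lambda>x. \<theta> * ln (1 + w * x))"
      using driving_FGGC that by (simp add: FGGC_def d_fun_def)
    then have "integrable H (\<lambda>x. (1 / \<theta>) * (\<theta> * ln (1 + w * x)))"
      by (rule integrable_mult_right)
    then show ?thesis using pos by simp
  qed
qed (use a_gt_0 pos in auto)

abbreviation Y :: "(nat \<Rightarrow> real) set" where
  "Y \<equiv> space (leb_pos n)"

lemma Y_nonempty: obtains y where "y \<in> Y"
  using emeasure_leb_pos[of n] by (metis emeasure_empty all_not_in_conv)

abbreviation Xi_at :: "(nat \<Rightarrow> real) \<Rightarrow> coord \<Rightarrow> 'a \<Rightarrow> real" where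
  "Xi_at y \<equiv> Xi (v 0) T M G R (om \<beta> y)"

lemma rv_Xi: "y \<in> Y \<Longrightarrow> c \<in> idx_Xi1 n \<Longrightarrow> Xi_at y c \<in> borel_measurable \<Omega>"
  using indep by (auto simp: \<Omega>.indep_vars_def)

lemma rv [measurable]:
  "v 0 \<in> borel_measurable \<Omega>"
  "i \<in> {1..n} \<Longrightarrow> T i \<in> borel_measurable \<Omega>"
  "i \<in> {1..n} \<Longrightarrow> M i \<in> borel_measurable \<Omega>"
  "i \<in> {1..n} \<Longrightarrow> G i \<in> borel_measurable \<Omega>"
proof -
  obtain y where y: "y \<in> Y" by (rule Y_nonempty)
  show "v 0 \<in> borel_measurable \<Omega>" using rv_Xi[OF y, of V] by (simp add: idx_Xi1_def)
  assume "i \<in> {1..n}"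
  then show "T i \<in> borel_measurable \<Omega>" "M i \<in> borel_measurable \<Omega>" "G i \<in> borel_measurable \<Omega>"
    using rv_Xi[OF y, of "TC i"] rv_Xi[OF y, of "MC i"] rv_Xi[OF y, of "GC i"] by (auto simp: idx_Xi1_def)
qed

lemma rv_R: "i \<in> {1..n} \<Longrightarrow> y \<in> Y \<Longrightarrow> R i (om \<beta> y i) \<in> borel_measurable \<Omega>"
  using rv_Xi[of y "RC i"] by (auto simp: idx_Xi1_def)

lemma indep_pair:
  assumes y: "y \<in> Y" and cd: "c \<in> idx_Xi1 n" "d \<in> idx_Xi1 n" "c \<noteq> d"
  shows "\<Omega>.indep_var borel (Xi_at y c) borel (Xi_at y d)"
proof -
  have "\<Omega>.indep_var (PiM {c} (\<lambda>_. borel)) (\<lambda>x. \<lambda>i\<in>{c}. Xi_at y i x) (PiM {d} (\<lambda>_. borel)) (\<lambda>x. \<lambda>i\<in>{d}. Xi_at y i x)"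
    using cd by (intro \<Omega>.indep_var_restrict[OF indep[OF y]]) auto
  then have "\<Omega>.indep_var borel ((\<lambda>f. f c) \<circ> (\<lambda>x. \<lambda>i\<in>{c}. Xi_at y i x)) borel ((\<lambda>f. f d) \<circ> (\<lambda>x. \<lambda>i\<in>{d}. Xi_at y i x))"
    by (rule \<Omega>.indep_var_compose) simp_all
  then show ?thesis by (simp add: comp_def)
qed

lemma v0_nonneg: "AE x in \<Omega>. 0 \<le> v 0 x"
  using model unfolding ou_model_def by blast

lemma M_nonneg:
  assumes i: "i \<in> {1..n}"
  shows "AE x in \<Omega>. 0 \<le> M i x"
  using mix.Q_law_mean_transform(1)[OF law_M[OF i]] rv(3)[OF i] by (subst (asm) AE_distr_iff) auto

lemma R_nonneg:
  assumes i: "i \<in> {1..n}" and y: "y \<in> Y"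
  shows "AE x in \<Omega>. 0 \<le> R i (om \<beta> y i) x"
  using mix.Q_cond_law_mean_transform(1)[OF law_R[OF i y] om_nonneg] rv_R[OF i y]
  by (subst (asm) AE_distr_iff) auto

lemma integrable_exp_v0:
  assumes s: "0 \<le> s"
  shows "integrable \<Omega> (\<lambda>x. exp (- s * v 0 x))"
  using v0_nonneg by (intro \<Omega>.integrable_const_bound[where B=1]) (auto simp: s mult_nonneg_nonneg)

text \<open>The exponent is minus the logarithm of an expectation, which is positive.\<close>

lemma exp_phi:
  assumes s: "0 \<le> s"
  shows "exp (- \<phi> s) = (\<integral>x. exp (- s * v 0 x) \<partial>\<Omega>)"
proof -
  have "0 < (\<integral>x. exp (- s * v 0 x) \<partial>\<Omega>)"
    using \<Omega>.integral_less_AE_space[OF _ integrable_exp_v0[OF s], of "\<lambda>_. 0"] by (simp add: \<Omega>.emeasure_space_1)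
  then show ?thesis by (simp add: phi levy_exponent_def)
qed

lemma expectation_powr_M:
  assumes i: "i \<in> {1..n}" and w: "0 \<le> w"
  shows "(\<integral>x. (1 + w * M i x) powr (- (\<theta> * a)) \<partial>\<Omega>) = exp (- Phi a \<theta> H w)"
  using mix.Q_law_mean_transform(2)[OF law_M[OF i] w] i by (subst (asm) integral_distr) auto

lemma expectation_powr_R:
  assumes i: "i \<in> {1..n}" and y: "y \<in> Y" and w: "0 \<le> w"
  shows "(\<integral>x. (1 + w * R i (om \<beta> y i) x) powr (- (\<theta> * a)) \<partial>\<Omega>)
    = exp (Phi a \<theta> H (om \<beta> y i) - Phi_cond a \<theta> H (om \<beta> y i) w)"
  using mix.Q_cond_law_mean_transform(2)[OF law_R[OF i y] om_nonneg w] rv_R[OF i y]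
  by (subst (asm) integral_distr) auto

lemma L2_eq:
  "L2 \<phi> a \<theta> H \<beta> n y = (\<integral>x. exp (- s_coef a \<beta> n y 1 * v 0 x) \<partial>\<Omega>) *
     (\<Prod>i=1..n. \<integral>x. (1 + om \<beta> y i * M i x) powr (- (\<theta> * a)) \<partial>\<Omega>)"
  unfolding L2_def using a_gt_0 by (simp add: exp_phi s_coef_nonneg expectation_powr_M om_nonneg)

text \<open>The factor \<open>exp (- \<Phi>(\<omega>\<^sub>i|v\<^sub>i))\<close> is the product of the transforms of \<open>M\<^sub>i\<close> and of the conditional mean at
  \<open>v\<^sub>i\<close>. At \<open>i = n\<close>, where \<^const>\<open>L1\<close> has the unconditional exponent, the two agree because \<open>v\<^sub>n = 0\<close>.\<close>

lemma L1_eq: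
  assumes y: "y \<in> Y"
  shows "L1 \<phi> a \<theta> H \<beta> n y = (\<integral>x. exp (- s_coef a \<beta> n y 1 * v 0 x) \<partial>\<Omega>) *
     (\<Prod>i=1..n. \<integral>x. (1 + om \<beta> y i * M i x) powr (- (\<theta> * a)) \<partial>\<Omega>) *
     (\<Prod>i=1..n. \<integral>x. (1 + v_coef a \<beta> n y i * R i (om \<beta> y i) x) powr (- (\<theta> * a)) \<partial>\<Omega>)"
proof -
  have last: "Phi_cond a \<theta> H (om \<beta> y n) (v_coef a \<beta> n y n) = Phi a \<theta> H (om \<beta> y n)"
    by (simp add: v_coef_last Phi_cond_def Phi_def)
  have "(\<Prod>i=1..n. \<integral>x. (1 + om \<beta> y i * M i x) powr (- (\<theta> * a)) \<partial>\<Omega>) *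
     (\<Prod>i=1..n. \<integral>x. (1 + v_coef a \<beta> n y i * R i (om \<beta> y i) x) powr (- (\<theta> * a)) \<partial>\<Omega>)
    = (\<Prod>i=1..n. exp (- Phi_cond a \<theta> H (om \<beta> y i) (v_coef a \<beta> n y i)))"
    unfolding prod.distrib[symmetric] using a_gt_0 y
    by (intro prod.cong refl) (simp add: expectation_powr_M expectation_powr_R om_nonneg v_coef_nonneg exp_add[symmetric])
  also have "\<dots> = exp (- Phi a \<theta> H (om \<beta> y n)) * (\<Prod>i=1..n-1. exp (- Phi_cond a \<theta> H (om \<beta> y i) (v_coef a \<beta> n y i)))"
  proof -
    have split: "{1..n} = insert n {1..n-1}" using pos by auto
    show ?thesis unfolding split using pos by (subst prod.insert) (auto simp: last)
  qed
  finally show ?thesis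
    unfolding L1_def using a_gt_0 by (simp add: exp_phi s_coef_nonneg mult.assoc)
qed

lemma laplace_TM:
  assumes i: "i \<in> {1..n}" and w: "0 \<le> w"
  shows "(\<integral>x. exp (- w * (T i x * M i x)) \<partial>\<Omega>) = (\<integral>x. (1 + w * M i x) powr (- (\<theta> * a)) \<partial>\<Omega>)"
proof -
  obtain y where y: "y \<in> Y" by (rule Y_nonempty)
  show ?thesis
    using indep_pair[OF y, of "TC i" "MC i"] i w pos a_gt_0 law_T[OF i] M_nonneg[OF i]
    by (intro \<Omega>.gamma_product_laplace) (auto simp: idx_Xi1_def)
qed

lemma laplace_GR:
  assumes i: "i \<in> {1..n}" and y: "y \<in> Y" and w: "0 \<le> w"
  shows "(\<integral>x. exp (- w * (G i x * R i (om \<beta> y i) x)) \<partial>\<Omega>) = (\<integral>x. (1 + w * R i (om \<beta> y i) x) powr (- (\<theta> * a)) \<partial>\<Omega>)"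
  using indep_pair[OF y, of "GC i" "RC i"] i w pos a_gt_0 law_G[OF i] R_nonneg[OF i y]
  by (intro \<Omega>.gamma_product_laplace) (auto simp: idx_Xi1_def)

text \<open>The marginal laws of the components, extended by a point mass so that they form a family of
  probability measures indexed by all coordinates.\<close>

definition marginal :: "(nat \<Rightarrow> real) \<Rightarrow> coord \<Rightarrow> real measure" where
  "marginal y c = (if c \<in> idx_Xi1 n then distr \<Omega> borel (Xi_at y c) else return borel 0)"

lemma prob_marginal: "y \<in> Y \<Longrightarrow> prob_space (marginal y c)"
  by (auto simp: marginal_def intro!: \<Omega>.prob_space_distr rv_Xi prob_space_return)

lemma sets_marginal [simp]: "sets (marginal y c) = sets borel"
  by (simp add: marginal_def)

lemma marginal_simps:
  "marginal y V = distr \<Omega> borel (v 0)"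
  "i \<in> {1..n} \<Longrightarrow> marginal y (TC i) = gamma_law (\<theta> * a)"
  "i \<in> {1..n} \<Longrightarrow> marginal y (GC i) = gamma_law (\<theta> * a)"
  "i \<in> {1..n} \<Longrightarrow> marginal y (MC i) = distr \<Omega> borel (M i)"
  "i \<in> {1..n} \<Longrightarrow> marginal y (RC i) = distr \<Omega> borel (R i (om \<beta> y i))"
  by (auto simp: marginal_def idx_Xi1_def law_T law_G)

lemma marginal_mean_nonneg:
  assumes y: "y \<in> Y" and k: "k \<in> gamma_idx n"
  shows "AE r in marginal y (mean_of k). 0 \<le> r"
proof -
  obtain i where i: "i \<in> {1..n}" and "k = TC i \<or> k = GC i"
    using k by (auto simp: gamma_idx_def)
  then consider "mean_of k = MC i" | "mean_of k = RC i" by auto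
  then show ?thesis
  proof cases
    case 1
    show ?thesis unfolding 1 marginal_simps(4)[OF i] by (rule mix.Q_law_mean_transform(1)[OF law_M[OF i]])
  next
    case 2
    show ?thesis unfolding 2 marginal_simps(5)[OF i]
      by (rule mix.Q_cond_law_mean_transform(1)[OF law_R[OF i y] om_nonneg])
  qed
qed

lemma law_Xi1:
  assumes y: "y \<in> Y"
  shows "distr \<Omega> (leb_coord (idx_Xi1 n)) (\<lambda>x. \<lambda>c\<in>idx_Xi1 n. Xi_at y c x) = PiM (idx_Xi1 n) (marginal y)"
proof -
  have "distr \<Omega> (leb_coord (idx_Xi1 n)) (\<lambda>x. \<lambda>c\<in>idx_Xi1 n. Xi_at y c x)
     = distr \<Omega> (PiM (idx_Xi1 n) (\<lambda>_. borel)) (\<lambda>x. \<lambda>c\<in>idx_Xi1 n. Xi_at y c x)"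
    by (intro distr_cong sets_leb_coord) auto
  also have "\<dots> = PiM (idx_Xi1 n) (\<lambda>c. distr \<Omega> borel (Xi_at y c))"
    using indep[OF y] by (subst (asm) \<Omega>.indep_vars_iff_distr_eq_PiM') (auto intro: rv_Xi y simp: idx_Xi1_def)
  also have "\<dots> = PiM (idx_Xi1 n) (marginal y)"
    by (intro PiM_cong) (auto simp: marginal_def)
  finally show ?thesis .
qed

lemma law_Xi2:
  assumes y: "y \<in> Y"
  shows "distr \<Omega> (leb_coord (idx_Xi2 n)) (\<lambda>x. \<lambda>c\<in>idx_Xi2 n. Xi (v 0) T M (\<lambda>_ _. 0) (\<lambda>_ _ _. 0) (\<lambda>_. 0) c x)
    = PiM (idx_Xi2 n) (marginal y)"
proof -
  have sub: "idx_Xi2 n \<subseteq> idx_Xi1 n" by (auto simp: idx_Xi1_def idx_Xi2_def)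
  have ind: "\<Omega>.indep_vars (\<lambda>_. borel) (Xi_at y) (idx_Xi2 n)"
    by (rule \<Omega>.indep_vars_subset[OF indep[OF y] sub])
  have eq: "Xi (v 0) T M (\<lambda>_ _. 0) (\<lambda>_ _ _. 0) (\<lambda>_. 0) c = Xi_at y c" if "c \<in> idx_Xi2 n" for c
    using that by (auto simp: idx_Xi2_def)
  have "distr \<Omega> (leb_coord (idx_Xi2 n)) (\<lambda>x. \<lambda>c\<in>idx_Xi2 n. Xi (v 0) T M (\<lambda>_ _. 0) (\<lambda>_ _ _. 0) (\<lambda>_. 0) c x)
     = distr \<Omega> (PiM (idx_Xi2 n) (\<lambda>_. borel)) (\<lambda>x. \<lambda>c\<in>idx_Xi2 n. Xi_at y c x)"
    by (intro distr_cong sets_leb_coord) (auto simp: eq restrict_def)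
  also have "\<dots> = PiM (idx_Xi2 n) (\<lambda>c. distr \<Omega> borel (Xi_at y c))"
    using ind sub by (subst (asm) \<Omega>.indep_vars_iff_distr_eq_PiM') (auto intro: rv_Xi y simp: idx_Xi2_def)
  also have "\<dots> = PiM (idx_Xi2 n) (marginal y)"
    using sub by (intro PiM_cong) (auto simp: marginal_def)
  finally show ?thesis .
qed

lemma nn_integral_marginal_V:
  assumes y: "y \<in> Y"
  shows "(\<integral>\<^sup>+r. ennreal (exp (- s_coef a \<beta> n y 1 * r)) \<partial>marginal y V) = ennreal (\<integral>x. exp (- s_coef a \<beta> n y 1 * v 0 x) \<partial>\<Omega>)"
proof -
  have s: "0 \<le> s_coef a \<beta> n y 1" using a_gt_0 by (intro s_coef_nonneg) simp
  show ?thesis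
    using nn_integral_eq_integral[OF integrable_exp_v0[OF s]] by (simp add: marginal_simps nn_integral_distr)
qed

lemma nn_integral_powr:
  assumes X: "X \<in> borel_measurable \<Omega>" "AE x in \<Omega>. 0 \<le> X x" and w: "0 \<le> w"
  shows "(\<integral>\<^sup>+r. ennreal ((1 + w * r) powr (- (\<theta> * a))) \<partial>distr \<Omega> borel X)
    = ennreal (\<integral>x. (1 + w * X x) powr (- (\<theta> * a)) \<partial>\<Omega>)"
proof -
  note [measurable] = X(1)
  have "integrable \<Omega> (\<lambda>x. (1 + w * X x) powr (- (\<theta> * a)))"
  proof (rule \<Omega>.integrable_const_bound[where B=1])
    show "AE x in \<Omega>. norm ((1 + w * X x) powr (- (\<theta> * a))) \<le> 1"
      using X(2)
    proof eventually_elim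
      case (elim x)
      then show ?case
        using powr_mono2'[of "- (\<theta> * a)" 1 "1 + w * X x"] w pos a_gt_0 by simp
    qed
  qed measurable
  then show ?thesis
    by (simp add: nn_integral_distr nn_integral_eq_integral)
qed

text \<open>The set \<open>K\<close> of Gamma coordinates is arbitrary because \<open>\<Xi>\<^sub>1\<close> contains all of them, whereas \<open>\<Xi>\<^sub>2\<close>
  contains only the \<open>T\<^sub>i\<close>. After the Gamma variables are integrated out, the integrand is a product of
  functions of single coordinates.\<close>

lemma nn_integral_laplace_kernel:
  assumes y: "y \<in> Y" and K: "K \<subseteq> gamma_idx n"
  shows "(\<integral>\<^sup>+z. ennreal (exp (- s_coef a \<beta> n y 1 * z V)) *
        (\<Prod>k\<in>K. ennreal (exp (- rate a \<beta> n y k * z k * z (mean_of k)))) \<partial>PiM (insert V (mean_of ` K) \<union> K) (marginal y))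
    = ennreal (\<integral>x. exp (- s_coef a \<beta> n y 1 * v 0 x) \<partial>\<Omega>) *
        (\<Prod>k\<in>K. ennreal (\<integral>x. (1 + rate a \<beta> n y k * Xi_at y (mean_of k) x) powr (- (\<theta> * a)) \<partial>\<Omega>))"
proof -
  have c: "0 \<le> \<theta> * a" using pos a_gt_0 by simp
  interpret product_sigma_finite "marginal y"
    using prob_marginal[OF y] by (auto simp: product_sigma_finite_def intro!: prob_space_imp_sigma_finite)
  let ?s = "s_coef a \<beta> n y 1"
  let ?J = "insert V (mean_of ` K)"
  let ?F = "\<lambda>x :: coord \<Rightarrow> real. ennreal (exp (- ?s * x V))"
  have finK: "finite K" using K by (rule finite_subset) simp
  have inj: "inj_on mean_of K" using inj_on_mean_of K by (rule inj_on_subset)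
  have K1: "k \<in> idx_Xi1 n" "mean_of k \<in> idx_Xi1 n" "mean_of k \<noteq> V" if "k \<in> K" for k
    using that K by (auto simp: gamma_idx_def idx_Xi1_def)
  define h where "h c r = (if c = V then ennreal (exp (- ?s * r))
    else ennreal ((1 + rate a \<beta> n y (the_inv_into K mean_of c) * r) powr (- (\<theta> * a))))" for c r
  have h: "h V = (\<lambda>r. ennreal (exp (- ?s * r)))"
    "k \<in> K \<Longrightarrow> h (mean_of k) = (\<lambda>r. ennreal ((1 + rate a \<beta> n y k * r) powr (- (\<theta> * a))))" for k
    using K1(3) by (auto simp: h_def the_inv_into_f_f[OF inj])
  have hm: "h c \<in> borel_measurable borel" for c
    by (cases "c = V") (simp_all add: h_def[abs_def])
  have prod_J: "(\<Prod>c\<in>?J. f c) = f V * (\<Prod>k\<in>K. f (mean_of k))" for f :: "coord \<Rightarrow> ennreal"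
  proof -
    have "V \<notin> mean_of ` K" using K1(3) by force
    then show ?thesis using finK by (simp add: prod.reindex[OF inj])
  qed
  have Vm: "?F \<in> borel_measurable (PiM ?J (\<lambda>_. borel))"
    by (intro measurable_compose[OF _ measurable_ennreal] measurable_compose[OF _ borel_measurable_exp] borel_measurable_times
      measurable_component_singleton measurable_const) auto
  have "(\<integral>\<^sup>+z. ?F z * (\<Prod>k\<in>K. ennreal (exp (- rate a \<beta> n y k * z k * z (mean_of k)))) \<partial>PiM (?J \<union> K) (marginal y))
    = (\<integral>\<^sup>+z. ?F (restrict z ?J) * (\<Prod>k\<in>K. ennreal (exp (- rate a \<beta> n y k * z k * z (mean_of k)))) \<partial>PiM (?J \<union> K) (marginal y))"
    by simp
  also have "\<dots> = (\<integral>\<^sup>+x. ?F x * (\<Prod>k\<in>K. ennreal ((1 + rate a \<beta> n y k * x (mean_of k)) powr (- (\<theta> * a)))) \<partial>PiM ?J (marginal y))"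
  proof (rule nn_integral_gamma_mixture)
    have "mean_of k \<notin> gamma_idx n" if "k \<in> gamma_idx n" for k
      using that by (auto simp: gamma_idx_def)
    moreover have "V \<notin> gamma_idx n" by (auto simp: gamma_idx_def)
    ultimately show "?J \<inter> K = {}" using K by blast
    show "marginal y k = gamma_law (\<theta> * a) \<and> 0 \<le> \<theta> * a \<and> 0 \<le> rate a \<beta> n y k \<and> mean_of k \<in> ?J" if "k \<in> K" for k
    proof -
      have "marginal y k = gamma_law (\<theta> * a)" using that K by (auto simp: gamma_idx_def marginal_simps)
      then show ?thesis using that c a_gt_0 by (auto intro: rate_nonneg)
    qed
    show "AE r in marginal y (mean_of k). 0 \<le> r" if "k \<in> K" for k
      using that K by (intro marginal_mean_nonneg[OF y]) auto
  qed (use prob_marginal[OF y] Vm finK in auto)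
  also have "\<dots> = (\<integral>\<^sup>+x. (\<Prod>c\<in>?J. h c (x c)) \<partial>PiM ?J (marginal y))"
    unfolding prod_J by (simp add: h)
  also have "\<dots> = (\<Prod>c\<in>?J. \<integral>\<^sup>+r. h c r \<partial>marginal y c)"
    using hm finK by (intro product_nn_integral_prod) (auto simp: measurable_cong_sets[OF sets_marginal refl])
  also have "\<dots> = ennreal (\<integral>x. exp (- ?s * v 0 x) \<partial>\<Omega>) *
     (\<Prod>k\<in>K. ennreal (\<integral>x. (1 + rate a \<beta> n y k * Xi_at y (mean_of k) x) powr (- (\<theta> * a)) \<partial>\<Omega>))"
  proof -
    have "(\<integral>\<^sup>+r. h (mean_of k) r \<partial>marginal y (mean_of k))
        = ennreal (\<integral>x. (1 + rate a \<beta> n y k * Xi_at y (mean_of k) x) powr (- (\<theta> * a)) \<partial>\<Omega>)" if k: "k \<in> K" for k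
    proof -
      have D: "marginal y (mean_of k) = distr \<Omega> borel (Xi_at y (mean_of k))"
        using K1(2)[OF k] by (simp add: marginal_def)
      have "AE x in \<Omega>. 0 \<le> Xi_at y (mean_of k) x"
        using marginal_mean_nonneg[OF y subsetD[OF K k]] rv_Xi[OF y K1(2)[OF k]] unfolding D by (subst (asm) AE_distr_iff) auto
      then show ?thesis
        unfolding h(2)[OF k] D using a_gt_0 by (intro nn_integral_powr rv_Xi[OF y K1(2)[OF k]] rate_nonneg) auto
    qed
    then show ?thesis
      unfolding prod_J using nn_integral_marginal_V[OF y] by (simp add: h(1))
  qed
  finally show ?thesis .
qed

lemma kernel1_integral:
  assumes y: "y \<in> Y"
  shows "(\<integral>\<^sup>+z. ennreal (kernel1 a \<beta> n z y) \<partial>PiM (idx_Xi1 n) (marginal y)) = ennreal (L1 \<phi> a \<theta> H \<beta> n y)"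
  unfolding kernel1_prod idx_Xi1_eq nn_integral_laplace_kernel[OF y order_refl]
  unfolding L1_eq[OF y] prod_TC_GC
  by (simp add: prod_ennreal ennreal_mult prod_nonneg mult.assoc)

lemma kernel2_integral:
  assumes y: "y \<in> Y"
  shows "(\<integral>\<^sup>+z. ennreal (kernel2 a \<beta> n z y) \<partial>PiM (idx_Xi2 n) (marginal y)) = ennreal (L2 \<phi> a \<theta> H \<beta> n y)"
proof -
  have "TC ` {1..n} \<subseteq> gamma_idx n" by (auto simp: gamma_idx_def)
  then show ?thesis
    unfolding kernel2_prod idx_Xi2_eq L2_eq
    by (subst nn_integral_laplace_kernel[OF y])
      (simp_all add: prod_ennreal ennreal_mult prod_nonneg prod.reindex inj_on_def)
qed

lemma Xi1_densityD:
  assumes f1: "Xi1_density \<Omega> \<beta> n (v 0) T M G R f1"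
  shows "(\<lambda>p. f1 (snd p) (fst p)) \<in> borel_measurable (leb_coord (idx_Xi1 n) \<Otimes>\<^sub>M leb_pos n)"
    and "\<And>y z. y \<in> Y \<Longrightarrow> z \<in> space (leb_coord (idx_Xi1 n)) \<Longrightarrow> 0 \<le> f1 y z"
    and "\<And>y. y \<in> Y \<Longrightarrow> density (leb_coord (idx_Xi1 n)) (\<lambda>z. ennreal (f1 y z)) = PiM (idx_Xi1 n) (marginal y)"
proof -
  show "(\<lambda>p. f1 (snd p) (fst p)) \<in> borel_measurable (leb_coord (idx_Xi1 n) \<Otimes>\<^sub>M leb_pos n)"
    using f1 by (simp add: Xi1_density_def case_prod_unfold)
  have hd: "has_density \<Omega> (leb_coord (idx_Xi1 n)) (\<lambda>x. \<lambda>c\<in>idx_Xi1 n. Xi_at y c x) (f1 y)" if "y \<in> Y" for y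
    using f1 that unfolding Xi1_density_def by blast
  show "0 \<le> f1 y z" if "y \<in> Y" "z \<in> space (leb_coord (idx_Xi1 n))" for y z
    using has_densityD(3)[OF hd] that by blast
  show "density (leb_coord (idx_Xi1 n)) (\<lambda>z. ennreal (f1 y z)) = PiM (idx_Xi1 n) (marginal y)" if "y \<in> Y" for y
    unfolding has_densityD(4)[OF hd[OF that]] by (rule law_Xi1[OF that])
qed

lemma nn_integral_Xi1_density:
  assumes f1: "Xi1_density \<Omega> \<beta> n (v 0) T M G R f1" and y: "y \<in> Y"
    and g [measurable]: "g \<in> borel_measurable (leb_coord (idx_Xi1 n))"
  shows "(\<integral>\<^sup>+z. ennreal (f1 y z) * g z \<partial>leb_coord (idx_Xi1 n)) = (\<integral>\<^sup>+z. g z \<partial>PiM (idx_Xi1 n) (marginal y))"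
proof -
  have [measurable]: "f1 y \<in> borel_measurable (leb_coord (idx_Xi1 n))"
    using measurable_section_fst[OF Xi1_densityD(1)[OF f1] y] by simp
  show ?thesis
    unfolding Xi1_densityD(3)[OF f1 y, symmetric] by (subst nn_integral_density) auto
qed

lemma kernel1_density_integral:
  assumes f1: "Xi1_density \<Omega> \<beta> n (v 0) T M G R f1" and y: "y \<in> Y"
  shows "(\<integral>\<^sup>+z. ennreal (kernel1 a \<beta> n z y * f1 y z) \<partial>leb_coord (idx_Xi1 n)) = ennreal (L1 \<phi> a \<theta> H \<beta> n y)"
proof -
  have [measurable]: "(\<lambda>z. kernel1 a \<beta> n z y) \<in> borel_measurable (leb_coord (idx_Xi1 n))"
    using measurable_section_fst[OF measurable_kernel1 y] by simp
  have "(\<integral>\<^sup>+z. ennreal (kernel1 a \<beta> n z y * f1 y z) \<partial>leb_coord (idx_Xi1 n))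
    = (\<integral>\<^sup>+z. ennreal (f1 y z) * ennreal (kernel1 a \<beta> n z y) \<partial>leb_coord (idx_Xi1 n))"
    using Xi1_densityD(2)[OF f1 y]
    by (intro nn_integral_cong) (simp add: ennreal_mult kernel_nonneg mult.commute)
  also have "\<dots> = ennreal (L1 \<phi> a \<theta> H \<beta> n y)"
    using nn_integral_Xi1_density[OF f1 y, of "\<lambda>z. ennreal (kernel1 a \<beta> n z y)"]
    by (simp add: kernel1_integral[OF y])
  finally show ?thesis .
qed

lemma augmentation_Xi1:
  assumes f1: "Xi1_density \<Omega> \<beta> n (v 0) T M G R f1"
    and fin: "(\<integral>\<^sup>+y. ennreal (L1 \<phi> a \<theta> H \<beta> n y) \<partial>leb_pos n) < \<infinity>"
  shows "\<exists>C>0. probability_density (leb_coord (idx_Xi1 n) \<Otimes>\<^sub>M leb_pos n)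
    (\<lambda>(z, y). C * (kernel1 a \<beta> n z y * f1 y z))"
proof -
  have "(\<lambda>(z, y). kernel1 a \<beta> n z y * f1 y z) \<in> borel_measurable (leb_coord (idx_Xi1 n) \<Otimes>\<^sub>M leb_pos n)"
    unfolding case_prod_unfold by (intro borel_measurable_times measurable_kernel1 Xi1_densityD[OF f1])
  note aug = probability_density_augmented[OF sigma_finite_leb_coord[OF finite_idx(1)] sigma_finite_leb_pos
      emeasure_leb_pos this _ kernel1_density_integral[OF f1] L_pos(1) fin]
  have q0: "0 \<le> kernel1 a \<beta> n z y * f1 y z" if "z \<in> space (leb_coord (idx_Xi1 n))" "y \<in> Y" for z y
    using Xi1_densityD(2)[OF f1] that by (simp add: kernel_nonneg)
  show ?thesis using aug(1)[OF q0] aug(2)[OF q0] by blast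
qed

lemma Xi2_densityD:
  assumes f2: "Xi2_density \<Omega> n (v 0) T M f2"
  shows "f2 \<in> borel_measurable (leb_coord (idx_Xi2 n))"
    and "\<And>z. z \<in> space (leb_coord (idx_Xi2 n)) \<Longrightarrow> 0 \<le> f2 z"
    and "\<And>y. y \<in> Y \<Longrightarrow> density (leb_coord (idx_Xi2 n)) (\<lambda>z. ennreal (f2 z)) = PiM (idx_Xi2 n) (marginal y)"
  using has_densityD(2,3,4)[OF f2[unfolded Xi2_density_def]] law_Xi2 by auto

lemma kernel2_density_integral:
  assumes f2: "Xi2_density \<Omega> n (v 0) T M f2" and y: "y \<in> Y"
  shows "(\<integral>\<^sup>+z. ennreal (kernel2 a \<beta> n z y * f2 z) \<partial>leb_coord (idx_Xi2 n)) = ennreal (L2 \<phi> a \<theta> H \<beta> n y)"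
proof -
  note [measurable] = Xi2_densityD(1)[OF f2]
  have [measurable]: "(\<lambda>z. kernel2 a \<beta> n z y) \<in> borel_measurable (leb_coord (idx_Xi2 n))"
    using measurable_section_fst[OF measurable_kernel2 y] by simp
  have "(\<integral>\<^sup>+z. ennreal (kernel2 a \<beta> n z y * f2 z) \<partial>leb_coord (idx_Xi2 n))
    = (\<integral>\<^sup>+z. ennreal (f2 z) * ennreal (kernel2 a \<beta> n z y) \<partial>leb_coord (idx_Xi2 n))"
    using Xi2_densityD(2)[OF f2]
    by (intro nn_integral_cong) (simp add: ennreal_mult kernel_nonneg mult.commute)
  also have "\<dots> = (\<integral>\<^sup>+z. ennreal (kernel2 a \<beta> n z y) \<partial>density (leb_coord (idx_Xi2 n)) (\<lambda>z. ennreal (f2 z)))"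
    by (subst nn_integral_density) auto
  also have "\<dots> = ennreal (L2 \<phi> a \<theta> H \<beta> n y)"
    unfolding Xi2_densityD(3)[OF f2 y] by (rule kernel2_integral[OF y])
  finally show ?thesis .
qed

lemma augmentation_Xi2:
  assumes f2: "Xi2_density \<Omega> n (v 0) T M f2"
    and fin: "(\<integral>\<^sup>+y. ennreal (L2 \<phi> a \<theta> H \<beta> n y) \<partial>leb_pos n) < \<infinity>"
  shows "\<exists>C>0. probability_density (leb_coord (idx_Xi2 n) \<Otimes>\<^sub>M leb_pos n)
    (\<lambda>(z, y). C * (kernel2 a \<beta> n z y * f2 z))"
proof -
  have "(\<lambda>(z, y). kernel2 a \<beta> n z y * f2 z) \<in> borel_measurable (leb_coord (idx_Xi2 n) \<Otimes>\<^sub>M leb_pos n)"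
    unfolding case_prod_unfold
    by (intro borel_measurable_times measurable_kernel2 measurable_compose[OF measurable_fst Xi2_densityD(1)[OF f2]])
  note aug = probability_density_augmented[OF sigma_finite_leb_coord[OF finite_idx(2)] sigma_finite_leb_pos
      emeasure_leb_pos this _ kernel2_density_integral[OF f2] L_pos(2) fin]
  have q0: "0 \<le> kernel2 a \<beta> n z y * f2 z" if "z \<in> space (leb_coord (idx_Xi2 n))" for z y
    using Xi2_densityD(2)[OF f2] that by (simp add: kernel_nonneg)
  show ?thesis using aug(1)[OF q0] aug(2)[OF q0] by blast
qed

end

section \<open>The product representation of the initial value\<close>

text \<open>The hypotheses of (v): \<open>v(0)\<close> is a product of a Gamma variable and an independent mean, and all
  means have densities.\<close>

locale ou_split = ou_augmentation +
  fixes TV0 MV0 :: "'a \<Rightarrow> real" and fMV :: "real \<Rightarrow> real" and fM :: "nat \<Rightarrow> real \<Rightarrow> real"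
    and fR :: "nat \<Rightarrow> real \<Rightarrow> real \<Rightarrow> real"
  assumes indep_V: "prob_space.indep_var \<Omega> borel TV0 borel MV0"
    and law_TV0: "distr \<Omega> borel TV0 = gamma_law \<theta>"
    and v0_eq: "AE x in \<Omega>. v 0 x = TV0 x * MV0 x"
    and dens_MV: "has_density \<Omega> lborel MV0 fMV"
    and dens_M: "\<And>i. i \<in> {1..n} \<Longrightarrow> has_density \<Omega> lborel (M i) (fM i)"
    and meas_R: "\<And>i. i \<in> {1..n} \<Longrightarrow> (\<lambda>(w, r). fR i w r) \<in> borel_measurable (borel \<Otimes>\<^sub>M borel)"
    and dens_R: "\<And>i y. i \<in> {1..n} \<Longrightarrow> y \<in> space (leb_pos n) \<Longrightarrow>
      has_density \<Omega> lborel (R i (om \<beta> y i)) (fR i (om \<beta> y i))"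
begin

abbreviation dsplit :: "(nat \<Rightarrow> real) \<Rightarrow> (coord \<Rightarrow> real) \<Rightarrow> real" where
  "dsplit \<equiv> split_density a \<theta> \<beta> n fMV fM fR"

abbreviation dmeans :: "(nat \<Rightarrow> real) \<Rightarrow> (coord \<Rightarrow> real) \<Rightarrow> real" where
  "dmeans \<equiv> means_density a \<theta> \<beta> n fMV fM fR"

definition split_marginal :: "(nat \<Rightarrow> real) \<Rightarrow> coord \<Rightarrow> real measure" where
  "split_marginal y c = (if c = TV then gamma_law \<theta> else if c = MV then distr \<Omega> borel MV0 else marginal y c)"

definition coord_density :: "(nat \<Rightarrow> real) \<Rightarrow> coord \<Rightarrow> real \<Rightarrow> real" where
  "coord_density y c = (case c of TV \<Rightarrow> gamma_density \<theta> | MV \<Rightarrow> fMV | TC i \<Rightarrow> gamma_density (\<theta> * a)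
     | GC i \<Rightarrow> gamma_density (\<theta> * a) | MC i \<Rightarrow> fM i | RC i \<Rightarrow> fR i (om \<beta> y i) | V \<Rightarrow> (\<lambda>_. 0))"

definition gamma_par :: "coord \<Rightarrow> real" where
  "gamma_par c = (if c = TV then \<theta> else \<theta> * a)"

lemma rv_V [measurable]: "TV0 \<in> borel_measurable \<Omega>" "MV0 \<in> borel_measurable \<Omega>"
  using indep_V by (auto dest: \<Omega>.indep_var_rv1 \<Omega>.indep_var_rv2)

lemma prob_split_marginal: "y \<in> Y \<Longrightarrow> prob_space (split_marginal y c)"
  using pos by (auto simp: split_marginal_def intro!: prob_marginal \<Omega>.prob_space_distr)

lemma sets_split_marginal [simp]: "sets (split_marginal y c) = sets borel"
  by (simp add: split_marginal_def)

text \<open>The sign of the mean is that of \<open>v(0)\<close>, because the Gamma factor is positive.\<close>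

lemma MV0_nonneg: "AE x in \<Omega>. 0 \<le> MV0 x"
proof -
  have "AE x in \<Omega>. 0 < TV0 x"
  proof -
    have "AE t in distr \<Omega> borel TV0. 0 < t"
      unfolding law_TV0 using pos by (intro AE_gamma_law_pos) auto
    then show ?thesis by (subst (asm) AE_distr_iff) auto
  qed
  then show ?thesis using v0_nonneg v0_eq
    by eventually_elim (simp add: zero_le_mult_iff)
qed

lemma split_marginal_mean_nonneg:
  assumes y: "y \<in> Y" and k: "k \<in> insert TV (gamma_idx n)"
  shows "AE r in split_marginal y (mean_of k). 0 \<le> r"
proof (cases "k = TV")
  case True
  then have "split_marginal y (mean_of k) = distr \<Omega> borel MV0" by (simp add: split_marginal_def)
  moreover have "AE r in distr \<Omega> borel MV0. 0 \<le> r"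
    using MV0_nonneg by (subst AE_distr_iff) auto
  ultimately show ?thesis by (simp only:)
next
  case False
  with k have k: "k \<in> gamma_idx n" by simp
  then have "split_marginal y (mean_of k) = marginal y (mean_of k)" by (auto simp: gamma_idx_def split_marginal_def)
  then show ?thesis using marginal_mean_nonneg[OF y k] by (simp only:)
qed

lemma coord_density:
  assumes y: "y \<in> Y" and c: "c \<in> idx_split n"
  shows "coord_density y c \<in> borel_measurable borel" "0 \<le> coord_density y c r"
    "density lborel (\<lambda>r. ennreal (coord_density y c r)) = split_marginal y c"
proof -
  have gl: "density lborel (\<lambda>x. ennreal (gamma_density b x)) = gamma_law b" if "0 < b" for b
    using that by (simp add: gamma_law_def)
  have distr_lborel: "distr \<Omega> lborel X = distr \<Omega> borel X" for X :: "'a \<Rightarrow> real"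
    by (intro distr_cong) auto
  have pp: "0 < \<theta>" "0 < \<theta> * a" using pos a_gt_0 by auto
  consider "c = TV" | "c = MV" | i where "i \<in> {1..n}" "c = TC i" | i where "i \<in> {1..n}" "c = GC i"
    | i where "i \<in> {1..n}" "c = MC i" | i where "i \<in> {1..n}" "c = RC i"
    using c by (auto simp: idx_split_def)
  then have "coord_density y c \<in> borel_measurable borel \<and> 0 \<le> coord_density y c r \<and>
    density lborel (\<lambda>r. ennreal (coord_density y c r)) = split_marginal y c"
  proof cases
    case 1
    then show ?thesis using pp by (simp add: coord_density_def split_marginal_def gl gamma_density_nonneg)
  next
    case 2
    then show ?thesis using has_densityD[OF dens_MV] by (simp add: coord_density_def split_marginal_def distr_lborel)
  next
    case (3 i)
    then show ?thesis using pp by (simp add: coord_density_def split_marginal_def gl gamma_density_nonneg marginal_simps)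
  next
    case (4 i)
    then show ?thesis using pp by (simp add: coord_density_def split_marginal_def gl gamma_density_nonneg marginal_simps)
  next
    case (5 i)
    then show ?thesis using has_densityD[OF dens_M[OF 5(1)]] by (simp add: coord_density_def split_marginal_def marginal_simps distr_lborel)
  next
    case (6 i)
    then show ?thesis using has_densityD[OF dens_R[OF 6(1) y]] by (simp add: coord_density_def split_marginal_def marginal_simps distr_lborel)
  qed
  then show "coord_density y c \<in> borel_measurable borel" "0 \<le> coord_density y c r"
    "density lborel (\<lambda>r. ennreal (coord_density y c r)) = split_marginal y c" by auto
qed

lemma split_density_prod:
  "dsplit y z = (\<Prod>c\<in>idx_split n. coord_density y c (z c))"
proof -
  have dis: "idx_means n \<inter> insert TV (gamma_idx n) = {}" and TV: "TV \<notin> gamma_idx n"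
    by (auto simp: idx_means_def gamma_idx_def)
  have "(\<Prod>c\<in>idx_split n. coord_density y c (z c)) =
    (\<Prod>c\<in>idx_means n. coord_density y c (z c)) * (\<Prod>c\<in>insert TV (gamma_idx n). coord_density y c (z c))"
    unfolding idx_split_eq using dis by (subst prod.union_disjoint) auto
  also have "\<dots> = dsplit y z"
    using TV by (simp add: prod_idx_means prod_TC_GC coord_density_def split_density_def prod.distrib mult_ac)
  finally show ?thesis ..
qed

lemma means_density_prod:
  "dmeans y x = (\<Prod>c\<in>idx_means n. coord_density y c (x c)) *
    (\<Prod>k\<in>insert TV (gamma_idx n). (1 + rate a \<beta> n y k * x (mean_of k)) powr (- gamma_par k))"
proof -
  have "TV \<notin> gamma_idx n" by (auto simp: gamma_idx_def)
  then show ?thesis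
    by (simp add: prod_idx_means prod_TC_GC coord_density_def means_density_def gamma_par_def prod.distrib mult_ac)
qed

lemma density_prod_coord:
  assumes y: "y \<in> Y" and I: "I \<subseteq> idx_split n"
  shows "density (leb_coord I) (\<lambda>z. ennreal (\<Prod>c\<in>I. coord_density y c (z c))) = PiM I (split_marginal y)"
proof -
  have fin: "finite I" using I by (rule finite_subset) simp
  have "density (leb_coord I) (\<lambda>z. ennreal (\<Prod>c\<in>I. coord_density y c (z c)))
     = density (leb_coord I) (\<lambda>z. \<Prod>c\<in>I. ennreal (coord_density y c (z c)))"
    using coord_density(2)[OF y] I by (intro arg_cong[where f="density _"] ext prod_ennreal[symmetric]) auto
  also have "\<dots> = PiM I (\<lambda>c. density lborel (\<lambda>r. ennreal (coord_density y c r)))"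
    unfolding leb_coord_def
  proof (rule PiM_density_eq[OF fin])
    fix c assume c: "c \<in> I"
    then have c': "c \<in> idx_split n" using I by auto
    show "(\<lambda>r. ennreal (coord_density y c r)) \<in> borel_measurable lborel"
      using coord_density(1)[OF y c'] by simp
    show "sigma_finite_measure (density lborel (\<lambda>r. ennreal (coord_density y c r)))"
      unfolding coord_density(3)[OF y c'] by (rule prob_space_imp_sigma_finite[OF prob_split_marginal[OF y]])
  qed (rule sigma_finite_lborel)
  also have "\<dots> = PiM I (split_marginal y)"
    using coord_density(3)[OF y] I by (intro PiM_cong) auto
  finally show ?thesis .
qed

lemma law_product_V: "distr (gamma_law \<theta> \<Otimes>\<^sub>M distr \<Omega> borel MV0) borel (\<lambda>p. fst p * snd p) = distr \<Omega> borel (v 0)"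
proof -
  have "gamma_law \<theta> \<Otimes>\<^sub>M distr \<Omega> borel MV0 = distr \<Omega> (borel \<Otimes>\<^sub>M borel) (\<lambda>x. (TV0 x, MV0 x))"
    using indep_V by (simp add: \<Omega>.indep_var_distribution_eq law_TV0)
  then have "distr (gamma_law \<theta> \<Otimes>\<^sub>M distr \<Omega> borel MV0) borel (\<lambda>p. fst p * snd p) = distr \<Omega> borel (\<lambda>x. TV0 x * MV0 x)"
    by (simp add: distr_distr comp_def)
  also have "\<dots> = distr \<Omega> borel (v 0)"
    using v0_eq by (intro distr_cong_AE) auto
  finally show ?thesis .
qed

text \<open>Only the coordinate \<open>V\<close> changes, and \<open>v(0)\<close> has the law of the product of its two independent
  factors. On a box, the indicator function splits into a function of \<open>(TV, MV)\<close> and functions of the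
  other single coordinates.\<close>

lemma law_collapse:
  assumes y: "y \<in> Y"
  shows "distr (PiM (idx_split n) (split_marginal y)) (leb_coord (idx_Xi1 n)) (collapse n) = PiM (idx_Xi1 n) (marginal y)"
proof -
  let ?K = "MC ` {1..n} \<union> RC ` {1..n} \<union> gamma_idx n"
  have finK: "finite ?K" by simp
  have split: "idx_split n = {TV, MV} \<union> ?K" and Xi1: "idx_Xi1 n = insert V ?K"
    and dis: "{TV, MV} \<inter> ?K = {}" and V: "V \<notin> ?K"
    by (auto simp: idx_split_def idx_Xi1_def gamma_idx_def)
  interpret DS: product_sigma_finite "split_marginal y"
    using prob_split_marginal[OF y] by (auto simp: product_sigma_finite_def intro!: prob_space_imp_sigma_finite)
  interpret D: product_sigma_finite "marginal y"
    using prob_marginal[OF y] by (auto simp: product_sigma_finite_def intro!: prob_space_imp_sigma_finite)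
  have sDS [measurable_cong]: "sets (PiM I (split_marginal y)) = sets (PiM I (\<lambda>_. borel))" for I
    by (intro sets_PiM_cong) auto
  have cm: "collapse n \<in> measurable (PiM (idx_split n) (split_marginal y)) (leb_coord (idx_Xi1 n))"
    using measurable_collapse by (simp add: measurable_cong_sets[OF sDS refl] measurable_cong_sets[OF sets_leb_coord refl])
  show ?thesis
  proof (rule D.PiM_eqI)
    show "sets (distr (PiM (idx_split n) (split_marginal y)) (leb_coord (idx_Xi1 n)) (collapse n)) = sets (PiM (idx_Xi1 n) (marginal y))"
      by (simp add: sets_leb_coord cong: sets_PiM_cong)
  next
    fix A assume "\<And>c. c \<in> idx_Xi1 n \<Longrightarrow> A c \<in> sets (marginal y c)"
    then have A [measurable]: "A c \<in> sets borel" if "c \<in> idx_Xi1 n" for c using that by simp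
    have AV [measurable]: "A V \<in> sets borel" using A by (simp add: Xi1)
    have AK [measurable]: "A c \<in> sets borel" if "c \<in> ?K" for c using A that by (simp add: Xi1)
    have box: "PiE (idx_Xi1 n) A \<in> sets (leb_coord (idx_Xi1 n))"
      unfolding sets_leb_coord using A by (intro sets_PiM_I_finite) auto
    have "(\<lambda>x :: coord \<Rightarrow> real. x TV * x MV) \<in> borel_measurable (PiM {TV, MV} (\<lambda>_. borel))"
      by (intro borel_measurable_times measurable_component_singleton) auto
    then have prod_TV_MV: "(\<lambda>x. x TV * x MV) \<in> borel_measurable (PiM {TV, MV} (split_marginal y))"
      by (simp only: measurable_cong_sets[OF sDS refl])
    have [measurable]: "(\<lambda>z. z TV) \<in> borel_measurable (PiM ({TV, MV} \<union> ?K) (\<lambda>_. borel))"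
      "(\<lambda>z. z MV) \<in> borel_measurable (PiM ({TV, MV} \<union> ?K) (\<lambda>_. borel))"
      by (auto intro!: measurable_component_singleton)
    have [measurable]: "(\<lambda>z. \<Prod>c\<in>?K. indicator (A c) (z c) :: ennreal) \<in> borel_measurable (PiM ({TV, MV} \<union> ?K) (\<lambda>_. borel))"
    proof (rule borel_measurable_prod_ennreal)
      fix c assume c: "c \<in> ?K"
      have "(\<lambda>z. z c) \<in> borel_measurable (PiM ({TV, MV} \<union> ?K) (\<lambda>_. borel))"
        by (rule measurable_component_singleton) (use c in auto)
      then show "(\<lambda>z. indicator (A c) (z c) :: ennreal) \<in> borel_measurable (PiM ({TV, MV} \<union> ?K) (\<lambda>_. borel))"
        by (rule measurable_compose[OF _ borel_measurable_indicator[OF AK[OF c]]])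
    qed
    have [measurable]: "(\<lambda>z. \<Prod>c\<in>?K. indicator (A c) (z c) :: ennreal) \<in> borel_measurable (PiM ?K (\<lambda>_. borel))"
    proof (rule borel_measurable_prod_ennreal)
      fix c assume c: "c \<in> ?K"
      have "(\<lambda>z. z c) \<in> borel_measurable (PiM ?K (\<lambda>_. borel))"
        by (rule measurable_component_singleton) (use c in auto)
      then show "(\<lambda>z. indicator (A c) (z c) :: ennreal) \<in> borel_measurable (PiM ?K (\<lambda>_. borel))"
        by (rule measurable_compose[OF _ borel_measurable_indicator[OF AK[OF c]]])
    qed
    have "emeasure (distr (PiM (idx_split n) (split_marginal y)) (leb_coord (idx_Xi1 n)) (collapse n)) (PiE (idx_Xi1 n) A)
      = (\<integral>\<^sup>+z. indicator (PiE (idx_Xi1 n) A) (collapse n z) \<partial>PiM (idx_split n) (split_marginal y))"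
      using box by (subst nn_integral_indicator[symmetric], simp, subst nn_integral_distr[OF cm]) auto
    also have "\<dots> = (\<integral>\<^sup>+z. indicator (A V) (z TV * z MV) * (\<Prod>c\<in>?K. indicator (A c) (z c)) \<partial>PiM ({TV, MV} \<union> ?K) (split_marginal y))"
      unfolding split[symmetric]
    proof (rule nn_integral_cong)
      fix z
      have "collapse n z \<in> PiE (idx_Xi1 n) A \<longleftrightarrow> z TV * z MV \<in> A V \<and> (\<forall>c\<in>?K. z c \<in> A c)"
        using V by (auto simp: collapse_def PiE_iff Xi1 split: if_splits)
      then show "indicator (PiE (idx_Xi1 n) A) (collapse n z) = (indicator (A V) (z TV * z MV) * (\<Prod>c\<in>?K. indicator (A c) (z c)) :: ennreal)"
        using finK by (auto simp: indicator_def)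
    qed
    also have "\<dots> = (\<integral>\<^sup>+x. (\<integral>\<^sup>+t. indicator (A V) (merge {TV, MV} ?K (x, t) TV * merge {TV, MV} ?K (x, t) MV) *
        (\<Prod>c\<in>?K. indicator (A c) (merge {TV, MV} ?K (x, t) c)) \<partial>PiM ?K (split_marginal y)) \<partial>PiM {TV, MV} (split_marginal y))"
      using dis finK by (intro DS.product_nn_integral_fold) (auto simp: measurable_cong_sets[OF sDS refl])
    also have "\<dots> = (\<integral>\<^sup>+x. (\<integral>\<^sup>+t. indicator (A V) (x TV * x MV) * (\<Prod>c\<in>?K. indicator (A c) (t c)) \<partial>PiM ?K (split_marginal y)) \<partial>PiM {TV, MV} (split_marginal y))"
    proof (intro nn_integral_cong arg_cong2[where f="(*)"] prod.cong refl)
      fix x t :: "coord \<Rightarrow> real" and c assume "c \<in> ?K"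
      then have "c \<notin> {TV, MV}" using dis by blast
      then show "(indicator (A c) (merge {TV, MV} ?K (x, t) c) :: ennreal) = indicator (A c) (t c)"
        using \<open>c \<in> ?K\<close> by (simp add: merge_def)
    qed (simp add: merge_def)
    also have "\<dots> = (\<integral>\<^sup>+x. indicator (A V) (x TV * x MV) * (\<integral>\<^sup>+t. (\<Prod>c\<in>?K. indicator (A c) (t c)) \<partial>PiM ?K (split_marginal y)) \<partial>PiM {TV, MV} (split_marginal y))"
      by (intro nn_integral_cong nn_integral_cmult) measurable
    also have "(\<integral>\<^sup>+t. (\<Prod>c\<in>?K. indicator (A c) (t c)) \<partial>PiM ?K (split_marginal y)) = (\<Prod>c\<in>?K. \<integral>\<^sup>+r. indicator (A c) r \<partial>split_marginal y c)"
      using finK AK by (intro DS.product_nn_integral_prod) (auto simp: measurable_cong_sets[OF sets_split_marginal refl])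
    also have "\<dots> = (\<Prod>c\<in>?K. emeasure (marginal y c) (A c))"
    proof (rule prod.cong[OF refl])
      fix c assume c: "c \<in> ?K"
      then have "c \<notin> {TV, MV}" using dis by blast
      then show "(\<integral>\<^sup>+r. indicator (A c) r \<partial>split_marginal y c) = emeasure (marginal y c) (A c)"
        using AK[OF c] by (simp add: split_marginal_def)
    qed
    also have "(\<integral>\<^sup>+x. indicator (A V) (x TV * x MV) * (\<Prod>c\<in>?K. emeasure (marginal y c) (A c)) \<partial>PiM {TV, MV} (split_marginal y))
      = (\<integral>\<^sup>+x. indicator (A V) (x TV * x MV) \<partial>PiM {TV, MV} (split_marginal y)) * (\<Prod>c\<in>?K. emeasure (marginal y c) (A c))"
      by (rule nn_integral_multc[OF measurable_compose[OF prod_TV_MV borel_measurable_indicator[OF AV]]])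
    also have "(\<integral>\<^sup>+x. indicator (A V) (x TV * x MV) \<partial>PiM {TV, MV} (split_marginal y))
      = (\<integral>\<^sup>+p. indicator (A V) (fst p * snd p) \<partial>(split_marginal y TV \<Otimes>\<^sub>M split_marginal y MV))"
      by (rule DS.product_nn_integral_pair) (auto simp: split_marginal_def)
    also have "\<dots> = emeasure (marginal y V) (A V)"
    proof -
      have m: "(\<lambda>p. fst p * snd p) \<in> borel_measurable (gamma_law \<theta> \<Otimes>\<^sub>M distr \<Omega> borel MV0)" by measurable
      have "emeasure (marginal y V) (A V) = (\<integral>\<^sup>+r. indicator (A V) r \<partial>distr (gamma_law \<theta> \<Otimes>\<^sub>M distr \<Omega> borel MV0) borel (\<lambda>p. fst p * snd p))"
        unfolding marginal_simps law_product_V using AV by simp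
      also have "\<dots> = (\<integral>\<^sup>+p. indicator (A V) (fst p * snd p) \<partial>(split_marginal y TV \<Otimes>\<^sub>M split_marginal y MV))"
        using AV by (subst nn_integral_distr[OF m]) (auto simp: split_marginal_def)
      finally show ?thesis ..
    qed
    also have "emeasure (marginal y V) (A V) * (\<Prod>c\<in>?K. emeasure (marginal y c) (A c)) = (\<Prod>c\<in>idx_Xi1 n. emeasure (marginal y c) (A c))"
      unfolding Xi1 using V finK by (subst prod.insert) auto
    finally show "emeasure (distr (PiM (idx_split n) (split_marginal y)) (leb_coord (idx_Xi1 n)) (collapse n)) (PiE (idx_Xi1 n) A)
      = (\<Prod>c\<in>idx_Xi1 n. emeasure (marginal y c) (A c))" .
  qed simp
qed

lemma measurable_coord_density:
  assumes c: "c \<in> I" and I: "I \<subseteq> idx_split n"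
  shows "(\<lambda>p. coord_density (snd p) c (fst p c)) \<in> borel_measurable (leb_coord I \<Otimes>\<^sub>M leb_pos n)"
proof -
  have c_meas [measurable]: "(\<lambda>p. fst p c) \<in> borel_measurable (leb_coord I \<Otimes>\<^sub>M leb_pos n)"
    using c by (rule measurable_leb_coord_fst)
  have const: "(\<lambda>p. coord_density (snd p) c (fst p c)) \<in> borel_measurable (leb_coord I \<Otimes>\<^sub>M leb_pos n)"
    if "\<And>y. coord_density y c = f" and "f \<in> borel_measurable borel" for f
    using measurable_compose[OF c_meas that(2)] by (simp add: that(1))
  have R: "(\<lambda>p. fR i (om \<beta> (snd p) i) (fst p c)) \<in> borel_measurable (leb_coord I \<Otimes>\<^sub>M leb_pos n)"
    if i: "i \<in> {1..n}" for i
  proof -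
    have "(\<lambda>p. (om \<beta> (snd p) i, fst p c)) \<in> measurable (leb_coord I \<Otimes>\<^sub>M leb_pos n) (borel \<Otimes>\<^sub>M borel)"
      by (intro measurable_Pair measurable_compose[OF measurable_snd measurable_om[OF i]]) measurable
    from measurable_compose[OF this meas_R[OF i]] show ?thesis by simp
  qed
  consider "c = TV" | "c = MV" | i where "i \<in> {1..n}" "c = TC i" | i where "i \<in> {1..n}" "c = GC i"
    | i where "i \<in> {1..n}" "c = MC i" | i where "i \<in> {1..n}" "c = RC i"
    using c I by (auto simp: idx_split_def)
  then show ?thesis
  proof cases
    case 1
    then show ?thesis by (intro const[of "gamma_density \<theta>"]) (auto simp: coord_density_def)
  next
    case 2
    then show ?thesis using has_densityD(2)[OF dens_MV] by (intro const[of fMV]) (auto simp: coord_density_def)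
  next
    case (3 i)
    then show ?thesis by (intro const[of "gamma_density (\<theta> * a)"]) (auto simp: coord_density_def)
  next
    case (4 i)
    then show ?thesis by (intro const[of "gamma_density (\<theta> * a)"]) (auto simp: coord_density_def)
  next
    case (5 i)
    then show ?thesis using has_densityD(2)[OF dens_M[OF 5(1)]]
      by (intro const[of "fM i"]) (auto simp: coord_density_def)
  next
    case (6 i)
    then show ?thesis using R[OF 6(1)] by (simp add: coord_density_def)
  qed
qed

lemma idx_means_subset: "idx_means n \<subseteq> idx_split n"
  by (auto simp: idx_means_def idx_split_def)

lemma measurable_split_density:
  "(\<lambda>p. dsplit (snd p) (fst p)) \<in> borel_measurable (leb_coord (idx_split n) \<Otimes>\<^sub>M leb_pos n)"
  unfolding split_density_prod by (intro borel_measurable_prod measurable_coord_density) auto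

lemma measurable_means_density:
  "(\<lambda>p. dmeans (snd p) (fst p)) \<in> borel_measurable (leb_coord (idx_means n) \<Otimes>\<^sub>M leb_pos n)"
proof -
  have rate: "(\<lambda>p. rate a \<beta> n (snd p) k) \<in> borel_measurable (leb_coord (idx_means n) \<Otimes>\<^sub>M leb_pos n)"
    and mean: "(\<lambda>p. fst p (mean_of k)) \<in> borel_measurable (leb_coord (idx_means n) \<Otimes>\<^sub>M leb_pos n)"
    if "k \<in> insert TV (gamma_idx n)" for k
  proof -
    show "(\<lambda>p. fst p (mean_of k)) \<in> borel_measurable (leb_coord (idx_means n) \<Otimes>\<^sub>M leb_pos n)"
      using that by (intro measurable_leb_coord_fst) (auto simp: gamma_idx_def idx_means_def)
    have "(\<lambda>y. rate a \<beta> n y k) \<in> borel_measurable (leb_pos n)"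
      using that by (auto simp: gamma_idx_def intro!: measurable_om measurable_v_coef measurable_s_coef)
    then show "(\<lambda>p. rate a \<beta> n (snd p) k) \<in> borel_measurable (leb_coord (idx_means n) \<Otimes>\<^sub>M leb_pos n)"
      by (rule measurable_compose[OF measurable_snd])
  qed
  have factor: "(\<lambda>p. (1 + rate a \<beta> n (snd p) k * fst p (mean_of k)) powr (- gamma_par k))
      \<in> borel_measurable (leb_coord (idx_means n) \<Otimes>\<^sub>M leb_pos n)" if "k \<in> insert TV (gamma_idx n)" for k
  proof -
    note [measurable] = rate[OF that] mean[OF that]
    show ?thesis by measurable
  qed
  show ?thesis
    unfolding means_density_prod
    by (intro borel_measurable_times borel_measurable_prod measurable_coord_density idx_means_subset factor)
qed

lemma split_density_nonneg: "y \<in> Y \<Longrightarrow> 0 \<le> dsplit y z"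
  unfolding split_density_prod by (intro prod_nonneg coord_density) auto

lemma means_density_nonneg: "y \<in> Y \<Longrightarrow> 0 \<le> dmeans y x"
  unfolding means_density_prod
  by (intro mult_nonneg_nonneg prod_nonneg coord_density) (use idx_means_subset in auto)

lemma nn_integral_split_density:
  assumes y: "y \<in> Y" and g [measurable]: "g \<in> borel_measurable (leb_coord (idx_split n))"
  shows "(\<integral>\<^sup>+z. ennreal (dsplit y z) * g z \<partial>leb_coord (idx_split n))
    = (\<integral>\<^sup>+z. g z \<partial>PiM (idx_split n) (split_marginal y))"
proof -
  have [measurable]: "(\<lambda>z. dsplit y z) \<in> borel_measurable (leb_coord (idx_split n))"
    using measurable_section_fst[OF measurable_split_density y] by simp
  show ?thesis
    unfolding density_prod_coord[OF y order_refl, symmetric] split_density_prod[symmetric]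
    by (subst nn_integral_density) auto
qed

lemma nn_integral_collapse:
  assumes y: "y \<in> Y" and g [measurable]: "g \<in> borel_measurable (leb_coord (idx_Xi1 n))"
  shows "(\<integral>\<^sup>+z. ennreal (dsplit y z) * g (collapse n z) \<partial>leb_coord (idx_split n))
    = (\<integral>\<^sup>+z. g z \<partial>PiM (idx_Xi1 n) (marginal y))"
proof -
  have cm: "collapse n \<in> measurable (PiM (idx_split n) (split_marginal y)) (leb_coord (idx_Xi1 n))"
  proof -
    have eq: "sets (PiM (idx_split n) (split_marginal y)) = sets (leb_coord (idx_split n))"
      unfolding sets_leb_coord by (intro sets_PiM_cong) auto
    show ?thesis unfolding measurable_cong_sets[OF eq refl] by (rule measurable_collapse)
  qed
  have "(\<integral>\<^sup>+z. ennreal (dsplit y z) * g (collapse n z) \<partial>leb_coord (idx_split n))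
    = (\<integral>\<^sup>+z. g (collapse n z) \<partial>PiM (idx_split n) (split_marginal y))"
    by (rule nn_integral_split_density[OF y measurable_compose[OF measurable_collapse g]])
  also have "\<dots> = (\<integral>\<^sup>+z. g z \<partial>PiM (idx_Xi1 n) (marginal y))"
    unfolding law_collapse[OF y, symmetric] using g by (subst nn_integral_distr[OF cm]) simp_all
  finally show ?thesis .
qed

text \<open>Integrating out all Gamma coordinates, \<open>TV\<close> included, against an arbitrary function \<open>F\<close> of the
  means. With \<open>F = 1\<close> this gives the normalizing constant, with indicator functions the image measure.\<close>

lemma nn_integral_means:
  assumes y: "y \<in> Y" and F: "F \<in> borel_measurable (leb_coord (idx_means n))"
  shows "(\<integral>\<^sup>+z. ennreal (kernel1 a \<beta> n (collapse n z) y * dsplit y z) *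
        F (restrict z (idx_means n)) \<partial>leb_coord (idx_split n))
    = (\<integral>\<^sup>+x. ennreal (dmeans y x) * F x \<partial>leb_coord (idx_means n))"
proof -
  let ?K = "insert TV (gamma_idx n)"
  let ?E = "\<lambda>z. \<Prod>k\<in>?K. ennreal (exp (- rate a \<beta> n y k * z k * z (mean_of k)))"
  let ?P = "\<lambda>x. \<Prod>k\<in>?K. ennreal ((1 + rate a \<beta> n y k * x (mean_of k)) powr (- gamma_par k))"
  have F' [measurable]: "F \<in> borel_measurable (PiM (idx_means n) (\<lambda>_. borel))"
    using F by (simp add: measurable_cong_sets[OF sets_leb_coord refl])
  have [measurable]: "(\<lambda>z. restrict z (idx_means n)) \<in> measurable (leb_coord (idx_split n)) (leb_coord (idx_means n))"
    unfolding measurable_cong_sets[OF sets_leb_coord sets_leb_coord]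
    by (rule measurable_restrict_subset[OF idx_means_subset])
  have kc: "(\<lambda>z. kernel1 a \<beta> n (collapse n z) y) \<in> borel_measurable (leb_coord (idx_split n))"
    using measurable_compose[OF measurable_collapse measurable_section_fst[OF measurable_kernel1 y]] by simp
  have E [measurable]: "?E \<in> borel_measurable (leb_coord (idx_split n))"
    unfolding kernel1_collapse_prod[symmetric] using kc by measurable
  have "(\<integral>\<^sup>+z. ennreal (kernel1 a \<beta> n (collapse n z) y * dsplit y z) *
        F (restrict z (idx_means n)) \<partial>leb_coord (idx_split n))
    = (\<integral>\<^sup>+z. ennreal (dsplit y z) * (F (restrict z (idx_means n)) * ?E z) \<partial>leb_coord (idx_split n))"
    unfolding kernel1_collapse_prod[symmetric] using split_density_nonneg[OF y]
    by (intro nn_integral_cong) (simp add: ennreal_mult kernel_nonneg mult_ac)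
  also have "\<dots> = (\<integral>\<^sup>+z. F (restrict z (idx_means n)) * ?E z \<partial>PiM (idx_means n \<union> ?K) (split_marginal y))"
    unfolding idx_split_eq[symmetric]
  proof (rule nn_integral_split_density[OF y])
    show "(\<lambda>z. F (restrict z (idx_means n)) * ?E z) \<in> borel_measurable (leb_coord (idx_split n))"
      using E measurable_compose[OF _ F, of "\<lambda>z. restrict z (idx_means n)"] by measurable
  qed
  also have "\<dots> = (\<integral>\<^sup>+x. F x * ?P x \<partial>PiM (idx_means n) (split_marginal y))"
  proof (rule nn_integral_gamma_mixture)
    show "idx_means n \<inter> ?K = {}" by (auto simp: idx_means_def gamma_idx_def)
    have pp: "0 < \<theta>" "0 < \<theta> * a" using pos a_gt_0 by auto
    show "split_marginal y k = gamma_law (gamma_par k) \<and> 0 \<le> gamma_par k \<and> 0 \<le> rate a \<beta> n y k \<and> mean_of k \<in> idx_means n"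
      if "k \<in> ?K" for k
    proof -
      have "0 \<le> rate a \<beta> n y k" using a_gt_0 by (intro rate_nonneg) simp
      then show ?thesis using that pp
        by (auto simp: gamma_idx_def idx_means_def split_marginal_def marginal_simps gamma_par_def)
    qed
    show "AE r in split_marginal y (mean_of k). 0 \<le> r" if "k \<in> ?K" for k
      using y that by (rule split_marginal_mean_nonneg)
  qed (use prob_split_marginal[OF y] F' in auto)
  also have "\<dots> = (\<integral>\<^sup>+x. ennreal (\<Prod>c\<in>idx_means n. coord_density y c (x c)) * (F x * ?P x) \<partial>leb_coord (idx_means n))"
  proof -
    have m1: "(\<lambda>x. \<Prod>c\<in>idx_means n. coord_density y c (x c)) \<in> borel_measurable (leb_coord (idx_means n))"
    proof (rule borel_measurable_prod)
      fix c assume "c \<in> idx_means n"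
      from measurable_section_fst[OF measurable_coord_density[OF this idx_means_subset] y]
      show "(\<lambda>x. coord_density y c (x c)) \<in> borel_measurable (leb_coord (idx_means n))" by simp
    qed
    have mP: "?P \<in> borel_measurable (leb_coord (idx_means n))"
    proof (rule borel_measurable_prod_ennreal)
      fix k assume "k \<in> ?K"
      then have mk: "mean_of k \<in> idx_means n" by (auto simp: gamma_idx_def idx_means_def)
      have [measurable]: "(\<lambda>x. x (mean_of k)) \<in> borel_measurable (leb_coord (idx_means n))"
        unfolding measurable_cong_sets[OF sets_leb_coord refl] by (rule measurable_component_singleton[OF mk])
      show "(\<lambda>x. ennreal ((1 + rate a \<beta> n y k * x (mean_of k)) powr (- gamma_par k))) \<in> borel_measurable (leb_coord (idx_means n))"
        by measurable
    qed
    show ?thesis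
      unfolding density_prod_coord[OF y idx_means_subset, symmetric]
      using m1 mP F by (subst nn_integral_density) auto
  qed
  also have "\<dots> = (\<integral>\<^sup>+x. ennreal (dmeans y x) * F x \<partial>leb_coord (idx_means n))"
  proof (rule nn_integral_cong)
    fix x
    have nn: "0 \<le> (\<Prod>c\<in>idx_means n. coord_density y c (x c))"
      using coord_density(2)[OF y] idx_means_subset by (intro prod_nonneg) auto
    have "?P x = ennreal (\<Prod>k\<in>?K. (1 + rate a \<beta> n y k * x (mean_of k)) powr (- gamma_par k))"
      by (rule prod_ennreal) simp
    then show "ennreal (\<Prod>c\<in>idx_means n. coord_density y c (x c)) * (F x * ?P x)
        = ennreal (dmeans y x) * F x"
      unfolding means_density_prod using nn by (simp add: ennreal_mult prod_nonneg mult_ac)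
  qed
  finally show ?thesis .
qed

lemma split_density_integral:
  assumes y: "y \<in> Y"
  shows "(\<integral>\<^sup>+z. ennreal (kernel1 a \<beta> n (collapse n z) y * dsplit y z) \<partial>leb_coord (idx_split n))
    = ennreal (L1 \<phi> a \<theta> H \<beta> n y)"
proof -
  have [measurable]: "(\<lambda>z. kernel1 a \<beta> n z y) \<in> borel_measurable (leb_coord (idx_Xi1 n))"
    using measurable_section_fst[OF measurable_kernel1 y] by simp
  have "(\<integral>\<^sup>+z. ennreal (kernel1 a \<beta> n (collapse n z) y * dsplit y z) \<partial>leb_coord (idx_split n))
    = (\<integral>\<^sup>+z. ennreal (dsplit y z) * ennreal (kernel1 a \<beta> n (collapse n z) y) \<partial>leb_coord (idx_split n))"
    using split_density_nonneg[OF y] by (intro nn_integral_cong) (simp add: ennreal_mult kernel_nonneg mult.commute)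
  also have "\<dots> = (\<integral>\<^sup>+z. ennreal (kernel1 a \<beta> n z y) \<partial>PiM (idx_Xi1 n) (marginal y))"
    by (rule nn_integral_collapse[OF y, of "\<lambda>z. ennreal (kernel1 a \<beta> n z y)"]) measurable
  finally show ?thesis by (simp add: kernel1_integral[OF y])
qed

lemma means_density_integral:
  assumes y: "y \<in> Y"
  shows "(\<integral>\<^sup>+x. ennreal (dmeans y x) \<partial>leb_coord (idx_means n)) = ennreal (L1 \<phi> a \<theta> H \<beta> n y)"
  using nn_integral_means[OF y, of "\<lambda>_. 1"] split_density_integral[OF y] by simp

lemma measurable_split_integrand:
  "(\<lambda>(z, y). kernel1 a \<beta> n (collapse n z) y * dsplit y z)
    \<in> borel_measurable (leb_coord (idx_split n) \<Otimes>\<^sub>M leb_pos n)"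
proof -
  have "(\<lambda>p. (collapse n (fst p), snd p)) \<in> measurable (leb_coord (idx_split n) \<Otimes>\<^sub>M leb_pos n) (leb_coord (idx_Xi1 n) \<Otimes>\<^sub>M leb_pos n)"
    by (intro measurable_Pair measurable_compose[OF measurable_fst measurable_collapse] measurable_snd)
  from measurable_compose[OF this measurable_kernel1]
  show ?thesis unfolding case_prod_unfold by (intro borel_measurable_times measurable_split_density) simp
qed

definition norm_const :: real where
  "norm_const = 1 / enn2real (\<integral>\<^sup>+y. ennreal (L1 \<phi> a \<theta> H \<beta> n y) \<partial>leb_pos n)"

lemma probability_density_split:
  assumes fin: "(\<integral>\<^sup>+y. ennreal (L1 \<phi> a \<theta> H \<beta> n y) \<partial>leb_pos n) < \<infinity>"
  shows "0 < norm_const"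
    and "probability_density (leb_coord (idx_split n) \<Otimes>\<^sub>M leb_pos n)
      (\<lambda>(z, y). norm_const * (kernel1 a \<beta> n (collapse n z) y * dsplit y z))"
    and "probability_density (leb_coord (idx_means n) \<Otimes>\<^sub>M leb_pos n)
      (\<lambda>(x, y). norm_const * dmeans y x)"
proof -
  note s = probability_density_augmented[OF sigma_finite_leb_coord[OF finite_idx(3)] sigma_finite_leb_pos
      emeasure_leb_pos measurable_split_integrand _ split_density_integral L_pos(1) fin, folded norm_const_def]
  have q0: "0 \<le> kernel1 a \<beta> n (collapse n z) y * dsplit y z" if "y \<in> Y" for z y
    using split_density_nonneg[OF that] by (simp add: kernel_nonneg)
  show "0 < norm_const" by (rule s(1)[OF q0])
  show "probability_density (leb_coord (idx_split n) \<Otimes>\<^sub>M leb_pos n)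
      (\<lambda>(z, y). norm_const * (kernel1 a \<beta> n (collapse n z) y * dsplit y z))"
    by (rule s(2)[OF q0])
  have m: "(\<lambda>(x, y). dmeans y x) \<in> borel_measurable (leb_coord (idx_means n) \<Otimes>\<^sub>M leb_pos n)"
    unfolding case_prod_unfold by (rule measurable_means_density)
  show "probability_density (leb_coord (idx_means n) \<Otimes>\<^sub>M leb_pos n)
      (\<lambda>(x, y). norm_const * dmeans y x)"
    by (rule probability_density_augmented(2)[OF sigma_finite_leb_coord[OF finite_idx(4)] sigma_finite_leb_pos
      emeasure_leb_pos m _ means_density_integral L_pos(1) fin, folded norm_const_def])
      (rule means_density_nonneg)
qed

lemma distr_collapse_density:
  assumes C: "0 \<le> C" and f1: "Xi1_density \<Omega> \<beta> n (v 0) T M G R f1"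
  shows "distr (density (leb_coord (idx_split n) \<Otimes>\<^sub>M leb_pos n)
        (\<lambda>p. ennreal ((\<lambda>(z, y). C * (kernel1 a \<beta> n (collapse n z) y * dsplit y z)) p)))
      (leb_coord (idx_Xi1 n) \<Otimes>\<^sub>M leb_pos n) (\<lambda>(z, y). (collapse n z, y))
    = density (leb_coord (idx_Xi1 n) \<Otimes>\<^sub>M leb_pos n) (\<lambda>(z, y). ennreal (C * (kernel1 a \<beta> n z y * f1 y z)))"
    (is "distr (density ?M (\<lambda>p. ennreal (?g p))) ?N ?c = density ?N ?h")
proof (rule distr_density_eqI)
  show cm: "?c \<in> measurable ?M ?N"
    unfolding case_prod_unfold
    by (intro measurable_Pair measurable_compose[OF measurable_fst measurable_collapse] measurable_snd)
  show gm: "(\<lambda>p. ennreal (?g p)) \<in> borel_measurable ?M"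
    using measurable_split_integrand unfolding case_prod_unfold by measurable
  have "(\<lambda>p. kernel1 a \<beta> n (fst p) (snd p) * f1 (snd p) (fst p)) \<in> borel_measurable ?N"
    by (intro borel_measurable_times measurable_kernel1 Xi1_densityD(1)[OF f1])
  then show hm: "?h \<in> borel_measurable ?N"
    unfolding case_prod_unfold by measurable
  fix A assume A: "A \<in> sets ?N"
  have iA: "(indicator A :: _ \<Rightarrow> ennreal) \<in> borel_measurable ?N"
    using A by (rule borel_measurable_indicator)
  show "(\<integral>\<^sup>+p. ennreal (?g p) * indicator A (?c p) \<partial>?M) = (\<integral>\<^sup>+q. ?h q * indicator A q \<partial>?N)"
  proof (rule nn_integral_pair_eqI[OF sigma_finite_leb_pos sigma_finite_leb_coord[OF finite_idx(3)] sigma_finite_leb_coord[OF finite_idx(1)]])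
    fix y assume y: "y \<in> Y"
    define F where "F z = ennreal (C * kernel1 a \<beta> n z y) * indicator A (z, y)" for z
    have F: "F \<in> borel_measurable (leb_coord (idx_Xi1 n))"
      unfolding F_def using measurable_section_fst[OF measurable_kernel1[of a \<beta> n] y] measurable_section_fst[OF iA y] by simp
    have "(\<integral>\<^sup>+z. ennreal (?g (z, y)) * indicator A (?c (z, y)) \<partial>leb_coord (idx_split n))
      = (\<integral>\<^sup>+z. ennreal (dsplit y z) * F (collapse n z) \<partial>leb_coord (idx_split n))"
      using split_density_nonneg[OF y] C
      by (intro nn_integral_cong) (simp add: F_def ennreal_mult kernel_nonneg mult_ac)
    also have "\<dots> = (\<integral>\<^sup>+z. ennreal (f1 y z) * F z \<partial>leb_coord (idx_Xi1 n))"
      by (simp add: nn_integral_collapse[OF y F] nn_integral_Xi1_density[OF f1 y F])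
    also have "\<dots> = (\<integral>\<^sup>+z. ?h (z, y) * indicator A (z, y) \<partial>leb_coord (idx_Xi1 n))"
      using Xi1_densityD(2)[OF f1 y] C
      by (intro nn_integral_cong) (simp add: F_def ennreal_mult kernel_nonneg mult_ac)
    finally show "(\<integral>\<^sup>+z. ennreal (?g (z, y)) * indicator A (?c (z, y)) \<partial>leb_coord (idx_split n))
      = (\<integral>\<^sup>+z. ?h (z, y) * indicator A (z, y) \<partial>leb_coord (idx_Xi1 n))" .
  qed (intro borel_measurable_times_ennreal gm hm iA measurable_compose[OF cm iA])+
qed

lemma distr_means_density:
  assumes C: "0 \<le> C"
  shows "distr (density (leb_coord (idx_split n) \<Otimes>\<^sub>M leb_pos n)
        (\<lambda>p. ennreal ((\<lambda>(z, y). C * (kernel1 a \<beta> n (collapse n z) y * dsplit y z)) p)))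
      (leb_coord (idx_means n) \<Otimes>\<^sub>M leb_pos n) (\<lambda>(z, y). (restrict z (idx_means n), y))
    = density (leb_coord (idx_means n) \<Otimes>\<^sub>M leb_pos n) (\<lambda>p. ennreal ((\<lambda>(z, y). C * dmeans y z) p))"
    (is "distr (density ?M (\<lambda>p. ennreal (?g p))) ?N ?r = density ?N (\<lambda>p. ennreal (?h p))")
proof (rule distr_density_eqI)
  have "(\<lambda>z. restrict z (idx_means n)) \<in> measurable (leb_coord (idx_split n)) (leb_coord (idx_means n))"
    unfolding measurable_cong_sets[OF sets_leb_coord sets_leb_coord]
    by (rule measurable_restrict_subset[OF idx_means_subset])
  then show rm: "?r \<in> measurable ?M ?N"
    unfolding case_prod_unfold by (intro measurable_Pair measurable_compose[OF measurable_fst] measurable_snd)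
  show gm: "(\<lambda>p. ennreal (?g p)) \<in> borel_measurable ?M"
    using measurable_split_integrand unfolding case_prod_unfold by measurable
  show hm: "(\<lambda>p. ennreal (?h p)) \<in> borel_measurable ?N"
    using measurable_means_density unfolding case_prod_unfold by measurable
  fix A assume A: "A \<in> sets ?N"
  have iA: "(indicator A :: _ \<Rightarrow> ennreal) \<in> borel_measurable ?N"
    using A by (rule borel_measurable_indicator)
  show "(\<integral>\<^sup>+p. ennreal (?g p) * indicator A (?r p) \<partial>?M) = (\<integral>\<^sup>+q. ennreal (?h q) * indicator A q \<partial>?N)"
  proof (rule nn_integral_pair_eqI[OF sigma_finite_leb_pos sigma_finite_leb_coord[OF finite_idx(3)] sigma_finite_leb_coord[OF finite_idx(4)]])
    fix y assume y: "y \<in> Y"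
    define F where "F x = ennreal C * indicator A (x, y)" for x
    have F: "F \<in> borel_measurable (leb_coord (idx_means n))"
      unfolding F_def using measurable_section_fst[OF iA y] by simp
    have "(\<integral>\<^sup>+z. ennreal (?g (z, y)) * indicator A (?r (z, y)) \<partial>leb_coord (idx_split n))
      = (\<integral>\<^sup>+z. ennreal (kernel1 a \<beta> n (collapse n z) y * dsplit y z) * F (restrict z (idx_means n)) \<partial>leb_coord (idx_split n))"
      using split_density_nonneg[OF y] C
      by (intro nn_integral_cong) (simp add: F_def ennreal_mult kernel_nonneg mult_ac)
    also have "\<dots> = (\<integral>\<^sup>+x. ennreal (dmeans y x) * F x \<partial>leb_coord (idx_means n))"
      by (rule nn_integral_means[OF y F])
    also have "\<dots> = (\<integral>\<^sup>+x. ennreal (?h (x, y)) * indicator A (x, y) \<partial>leb_coord (idx_means n))"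
      using means_density_nonneg[OF y] C by (intro nn_integral_cong) (simp add: F_def ennreal_mult mult_ac)
    finally show "(\<integral>\<^sup>+z. ennreal (?g (z, y)) * indicator A (?r (z, y)) \<partial>leb_coord (idx_split n))
      = (\<integral>\<^sup>+x. ennreal (?h (x, y)) * indicator A (x, y) \<partial>leb_coord (idx_means n))" .
  qed (intro borel_measurable_times_ennreal gm hm iA measurable_compose[OF rm iA])+
qed

end

section \<open>The augmented joint densities\<close>

theorem theorem6p1:
  fixes \<Omega> :: "'a measure" and Z v :: "real \<Rightarrow> 'a \<Rightarrow> real" and H :: "real measure"
    and lam \<Delta> a \<theta> \<beta> :: real and n :: nat
    and T M G :: "nat \<Rightarrow> 'a \<Rightarrow> real" and R :: "nat \<Rightarrow> real \<Rightarrow> 'a \<Rightarrow> real"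
    and \<phi> :: "real \<Rightarrow> real"
  assumes pos: "0 < lam" "0 < \<Delta>" "0 < \<theta>" "1 \<le> n"
    and a: "a = lam * \<Delta>"
    and model: "ou_model \<Omega> lam \<theta> H Z v"
    and phi: "\<phi> = levy_exponent \<Omega> (v 0)"
    and law_T: "\<And>i. i \<in> {1..n} \<Longrightarrow> distr \<Omega> borel (T i) = gamma_law (\<theta> * a)"
    and law_M: "\<And>i. i \<in> {1..n} \<Longrightarrow>
      dirichlet_mean_law (\<theta> * a) (Q_law a H) (distr \<Omega> borel (M i))"
    and law_G: "\<And>i. i \<in> {1..n} \<Longrightarrow> distr \<Omega> borel (G i) = gamma_law (\<theta> * a)"
    and law_R: "\<And>i y. i \<in> {1..n} \<Longrightarrow> y \<in> space (leb_pos n) \<Longrightarrow>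
      dirichlet_mean_law (\<theta> * a) (Q_cond_law a H (om \<beta> y i)) (distr \<Omega> borel (R i (om \<beta> y i)))"
    and indep: "\<And>y. y \<in> space (leb_pos n) \<Longrightarrow>
      prob_space.indep_vars \<Omega> (\<lambda>_. borel) (Xi (v 0) T M G R (om \<beta> y)) (idx_Xi1 n)"
  shows
    "(\<comment> \<open>(i)\<close>
      \<forall>y\<in>space (leb_pos n).
        L1 \<phi> a \<theta> H \<beta> n y =
          (\<integral>x. exp (- s_coef a \<beta> n y 1 * v 0 x) \<partial>\<Omega>) *
          (\<Prod>i=1..n. \<integral>x. exp (- om \<beta> y i * (T i x * M i x)) \<partial>\<Omega>) *
          (\<Prod>i=1..n. \<integral>x. exp (- v_coef a \<beta> n y i * (G i x * R i (om \<beta> y i) x)) \<partial>\<Omega>)) \<and>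
     (\<comment> \<open>(ii)\<close>
      \<forall>y\<in>space (leb_pos n).
        L2 \<phi> a \<theta> H \<beta> n y =
          (\<integral>x. exp (- s_coef a \<beta> n y 1 * v 0 x) \<partial>\<Omega>) *
          (\<Prod>i=1..n. \<integral>x. exp (- om \<beta> y i * (T i x * M i x)) \<partial>\<Omega>)) \<and>
     (\<comment> \<open>(iii)\<close>
      \<forall>f1. Xi1_density \<Omega> \<beta> n (v 0) T M G R f1 \<and>
        (\<integral>\<^sup>+y. ennreal (L1 \<phi> a \<theta> H \<beta> n y) \<partial>leb_pos n) < \<infinity> \<longrightarrow>
        (\<exists>C>0. probability_density (leb_coord (idx_Xi1 n) \<Otimes>\<^sub>M leb_pos n)
                 (\<lambda>(z, y). C * (kernel1 a \<beta> n z y * f1 y z))) \<and>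
        (\<forall>y\<in>space (leb_pos n).
          (\<integral>\<^sup>+z. ennreal (kernel1 a \<beta> n z y * f1 y z) \<partial>leb_coord (idx_Xi1 n))
            = ennreal (L1 \<phi> a \<theta> H \<beta> n y))) \<and>
     (\<comment> \<open>(iv)\<close>
      \<forall>f2. Xi2_density \<Omega> n (v 0) T M f2 \<and>
        (\<integral>\<^sup>+y. ennreal (L2 \<phi> a \<theta> H \<beta> n y) \<partial>leb_pos n) < \<infinity> \<longrightarrow>
        (\<exists>C>0. probability_density (leb_coord (idx_Xi2 n) \<Otimes>\<^sub>M leb_pos n)
                 (\<lambda>(z, y). C * (kernel2 a \<beta> n z y * f2 z))) \<and>
        (\<forall>y\<in>space (leb_pos n).
          (\<integral>\<^sup>+z. ennreal (kernel2 a \<beta> n z y * f2 z) \<partial>leb_coord (idx_Xi2 n))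
            = ennreal (L2 \<phi> a \<theta> H \<beta> n y))) \<and>
     (\<comment> \<open>(v)\<close>
      \<forall>TV0 MV0 fMV fM fR.
        prob_space.indep_var \<Omega> borel TV0 borel MV0 \<and>
        distr \<Omega> borel TV0 = gamma_law \<theta> \<and>
        (AE x in \<Omega>. v 0 x = TV0 x * MV0 x) \<and>
        has_density \<Omega> lborel MV0 fMV \<and>
        (\<forall>i\<in>{1..n}. has_density \<Omega> lborel (M i) (fM i)) \<and>
        (\<forall>i\<in>{1..n}. (\<lambda>(w, r). fR i w r) \<in> borel_measurable (borel \<Otimes>\<^sub>M borel)) \<and>
        (\<forall>i\<in>{1..n}. \<forall>y\<in>space (leb_pos n).
           has_density \<Omega> lborel (R i (om \<beta> y i)) (fR i (om \<beta> y i))) \<and>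
        (\<integral>\<^sup>+y. ennreal (L1 \<phi> a \<theta> H \<beta> n y) \<partial>leb_pos n) < \<infinity> \<longrightarrow>
        (\<exists>C>0.
          (let \<mu> = leb_coord (idx_split n) \<Otimes>\<^sub>M leb_pos n;
               g = (\<lambda>(z, y). C * (kernel1 a \<beta> n (collapse n z) y *
                                   split_density a \<theta> \<beta> n fMV fM fR y z));
               \<nu> = leb_coord (idx_means n) \<Otimes>\<^sub>M leb_pos n;
               h = (\<lambda>(z, y). C * means_density a \<theta> \<beta> n fMV fM fR y z)
           in probability_density \<mu> g \<and>
              (\<comment> \<open>\<open>g\<close> is the joint density of (iii) with \<open>v(0)\<close> written as a product\<close>
               \<forall>f1. Xi1_density \<Omega> \<beta> n (v 0) T M G R f1 \<longrightarrow>
                 distr (density \<mu> (\<lambda>p. ennreal (g p)))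
                     (leb_coord (idx_Xi1 n) \<Otimes>\<^sub>M leb_pos n) (\<lambda>(z, y). (collapse n z, y))
                   = density (leb_coord (idx_Xi1 n) \<Otimes>\<^sub>M leb_pos n)
                       (\<lambda>(z, y). ennreal (C * (kernel1 a \<beta> n z y * f1 y z)))) \<and>
              probability_density \<nu> h \<and>
              (\<comment> \<open>\<open>h\<close> is obtained from \<open>g\<close> by integrating out all Gamma variables\<close>
               distr (density \<mu> (\<lambda>p. ennreal (g p))) \<nu> (\<lambda>(z, y). (restrict z (idx_means n), y))
                 = density \<nu> (\<lambda>p. ennreal (h p))))))"
proof -
  interpret ou_augmentation \<Omega> Z v H lam \<Delta> a \<theta> \<beta> n T M G R \<phi>
    by (rule ou_augmentation.intro) fact+
  have a0: "0 \<le> a" using a_gt_0 by simp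
  show ?thesis
  proof (intro conjI allI impI ballI, goal_cases)
    case (1 y)
    show ?case
      unfolding L1_eq[OF 1] using 1 a0
      by (intro arg_cong2[where f="(*)"] prod.cong refl laplace_TM[symmetric] laplace_GR[symmetric]
          om_nonneg v_coef_nonneg)
  next
    case (2 y)
    show ?case
      unfolding L2_eq
      by (intro arg_cong2[where f="(*)"] prod.cong refl laplace_TM[symmetric] om_nonneg)
  next
    case (3 f1)
    then show ?case using augmentation_Xi1 by blast
  next
    case (4 f1 y)
    then show ?case using kernel1_density_integral by blast
  next
    case (5 f2)
    then show ?case using augmentation_Xi2 by blast
  next
    case (6 f2 y)
    then show ?case using kernel2_density_integral by blast
  next
    case (7 TV0 MV0 fMV fM fR)
    then have "ou_split \<Omega> Z v H lam \<Delta> a \<theta> \<beta> n T M G R \<phi> TV0 MV0 fMV fM fR"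
      by (intro ou_split.intro ou_augmentation_axioms ou_split_axioms.intro) blast+
    then interpret S: ou_split \<Omega> Z v H lam \<Delta> a \<theta> \<beta> n T M G R \<phi> TV0 MV0 fMV fM fR .
    have fin: "(\<integral>\<^sup>+y. ennreal (L1 \<phi> a \<theta> H \<beta> n y) \<partial>leb_pos n) < \<infinity>" using 7 by blast
    note pd = S.probability_density_split[OF fin]
    note C = less_imp_le[OF pd(1)]
    show ?case
      unfolding Let_def
      by (rule exI[of _ S.norm_const], intro conjI allI impI pd S.distr_means_density[OF C])
        (rule S.distr_collapse_density[OF C])
  qed
qed

end
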